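(* Let $c>0$ and $k\in(0,c/4)$, and let $u_0=u_0(\cdot;k,c)$ be the smooth solitary wave profile of the Degasperis–Procesi equation with speed $c$ and asymptotic end state $k$. For $\alpha\in(0,1)$, the essential spectrum of $\mathcal A_\alpha[u_0]$ acting on $L^2(\mathbb R)$ lies in the open left half-plane $\operatorname{Re}(\lambda)<0$ provided that $$0<\alpha^2<\frac{c-4k}{c-k},$$ in which case the spectral gap for the essential spectrum, i.e. the distance between the imaginary axis and the essential spectrum, is $$\Delta_\alpha=\alpha\left(c-k-\frac{3k}{1-\alpha^2}\right)>0.$$
   Context: The Degasperis–Procesi (DP) equation is $u_t-u_{txx}=3u_xu_{xx}-4uu_x+uu_{xxx}$. For each $c>0$ and $k\in(0,c/4)$ it is known that there is a smooth traveling wave $u(x,t)=u_0(x-ct)$, with non-constant even profile $u_0=u_0(\cdot;k,c)\in C^\infty(\mathbb R)$ satisfying $(c-u_0)^3(u_0-u_0'')=k(c-k)^3$, $u_0'(0)=0$, $u_0(\xi)\to k$ as $|\xi|\to\infty$, $0<u_0<c$ and $u_0-u_0''>0$ on $\mathbb R$. Linearizing DP about $u_0$ in the moving frame $\xi=x-ct$ gives $v_t=\mathcal A[u_0]v$ with $\mathcal A[u_0]v=(1-\partial_\xi^2)^{-1}\left[c\,\partial_\xi(1-\partial_\xi^2)v-\partial_\xi(4-\partial_\xi^2)(u_0v)\right]$. The conjugated operator is $\mathcal A_\alpha[u_0]=e^{\alpha\xi}\mathcal A[u_0]e^{-\alpha\xi}$, i.e. $$\mathcal A_\alpha[u_0]w=c(\partial_\xi-\alpha)w-(\partial_\xi-\alpha)(1-(\partial_\xi-\alpha)^2)^{-1}(4-(\partial_\xi-\alpha)^2)(u_0w),$$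 acting on $L^2(\mathbb R)$ with domain $H^1(\mathbb R)$, the inverse being a Fourier multiplier. The essential spectrum is the set of $\lambda\in\mathbb C$ such that $\lambda I-\mathcal A_\alpha[u_0]$ is not Fredholm of index zero. *)

theory Defs
  imports "HOL-Analysis.Analysis"
begin

section \<open>The Hilbert space $L^2(\mathbb{R};\mathbb{C})$\<close>

definition square_integrable :: "(real \<Rightarrow> complex) \<Rightarrow> bool" where
  "square_integrable f \<longleftrightarrow>
     f \<in> borel_measurable lborel \<and> integrable lborel (\<lambda>x. (norm (f x))\<^sup>2)"

lemma square_integrable_zero: "square_integrable (\<lambda>_. 0)"
  by (simp add: square_integrable_def)

lemma square_integrable_scale:
  assumes "square_integrable f"
  shows "square_integrable (\<lambda>x. a * f x)"
  using assms by (auto simp: square_integrable_def norm_mult power_mult_distrib)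

lemma square_integrable_add:
  assumes "square_integrable f" "square_integrable g"
  shows "square_integrable (\<lambda>x. f x + g x)"
proof -
  have [measurable]: "f \<in> borel_measurable lborel" "g \<in> borel_measurable lborel"
    using assms by (auto simp: square_integrable_def)
  have bound: "(norm (a + b))\<^sup>2 \<le> 2 * (norm a)\<^sup>2 + 2 * (norm b)\<^sup>2" for a b :: complex
  proof -
    have "(norm (a + b))\<^sup>2 \<le> (norm a + norm b)\<^sup>2"
      by (intro power_mono norm_triangle_ineq norm_ge_zero)
    also have "\<dots> \<le> 2 * (norm a)\<^sup>2 + 2 * (norm b)\<^sup>2"
      using sum_squares_bound[of "norm a" "norm b"] by (simp add: power2_sum)
    finally show ?thesis .
  qed
  have "integrable lborel (\<lambda>x. 2 * (norm (f x))\<^sup>2 + 2 * (norm (g x))\<^sup>2)"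
    using assms by (auto simp: square_integrable_def)
  then have "integrable lborel (\<lambda>x. (norm (f x + g x))\<^sup>2)"
    by (rule Bochner_Integration.integrable_bound) (auto intro!: AE_I2 bound)
  then show ?thesis
    by (simp add: square_integrable_def)
qed

lemma square_integrable_uminus:
  "square_integrable f \<Longrightarrow> square_integrable (\<lambda>x. - f x)"
  using square_integrable_scale[of f "-1"] by simp

lemma square_integrable_diff:
  "square_integrable f \<Longrightarrow> square_integrable g \<Longrightarrow> square_integrable (\<lambda>x. f x - g x)"
  using square_integrable_add[of f "\<lambda>x. - g x"] square_integrable_uminus[of g] by simp

lemma integrable_inner_square_integrable:
  assumes "square_integrable f" "square_integrable g"
  shows "integrable lborel (\<lambda>x. inner (f x) (g x))"
proof -
  have "(\<lambda>x. inner (f x) (g x)) =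
      (\<lambda>x. ((norm (f x + g x))\<^sup>2 - (norm (f x))\<^sup>2 - (norm (g x))\<^sup>2) / 2)"
    by (intro ext) (simp only: dot_norm)
  moreover have "integrable lborel (\<lambda>x. (norm (f x + g x))\<^sup>2)"
    using square_integrable_add[OF assms] by (simp add: square_integrable_def)
  ultimately show ?thesis
    using assms by (simp only: square_integrable_def) simp
qed

definition l2_eq :: "(real \<Rightarrow> complex) \<Rightarrow> (real \<Rightarrow> complex) \<Rightarrow> bool" where
  "l2_eq f g \<longleftrightarrow>
     square_integrable f \<and> square_integrable g \<and> (AE x in lborel. f x = g x)"

lemma part_equivp_l2_eq: "part_equivp l2_eq"
proof (rule part_equivpI)
  show "\<exists>f. l2_eq f f"
    using square_integrable_zero by (auto simp: l2_eq_def)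
  show "symp l2_eq"
    by (auto simp: symp_def l2_eq_def elim: AE_mp)
  show "transp l2_eq"
  proof (rule transpI)
    fix f g h assume "l2_eq f g" "l2_eq g h"
    then show "l2_eq f h"
      unfolding l2_eq_def by (auto elim: AE_mp)
  qed
qed

quotient_type l2 = "real \<Rightarrow> complex" / partial: l2_eq
  by (rule part_equivp_l2_eq)

instantiation l2 :: ab_group_add
begin

lift_definition zero_l2 :: l2 is "\<lambda>_. 0"
  by (simp add: l2_eq_def square_integrable_zero)

lift_definition plus_l2 :: "l2 \<Rightarrow> l2 \<Rightarrow> l2" is "\<lambda>f g x. f x + g x"
  by (auto simp: l2_eq_def square_integrable_add elim: AE_mp)

lift_definition minus_l2 :: "l2 \<Rightarrow> l2 \<Rightarrow> l2" is "\<lambda>f g x. f x - g x"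
  by (auto simp: l2_eq_def square_integrable_diff elim: AE_mp)

lift_definition uminus_l2 :: "l2 \<Rightarrow> l2" is "\<lambda>f x. - f x"
  by (auto simp: l2_eq_def square_integrable_uminus elim: AE_mp)

instance
proof
  fix a b c :: l2
  show "a + b + c = a + (b + c)"
    by transfer (auto simp: l2_eq_def add.assoc square_integrable_add)
  show "a + b = b + a"
    by transfer (auto simp: l2_eq_def add.commute square_integrable_add)
  show "0 + a = a"
    by transfer (auto simp: l2_eq_def)
  show "- a + a = 0"
    by transfer (auto simp: l2_eq_def square_integrable_zero)
  show "a - b = a + - b"
    by transfer (auto simp: l2_eq_def square_integrable_diff)
qed

end

lift_definition scaleC_l2 :: "complex \<Rightarrow> l2 \<Rightarrow> l2" is "\<lambda>a f x. a * f x"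
  by (auto simp: l2_eq_def square_integrable_scale elim: AE_mp)

text \<open>The real inner product is the real part of the usual sesquilinear one, so the norm it
  induces is the usual $L^2$ norm.\<close>

instantiation l2 :: real_inner
begin

definition scaleR_l2 :: "real \<Rightarrow> l2 \<Rightarrow> l2" where
  "scaleR_l2 r f = scaleC_l2 (of_real r) f"

lift_definition inner_l2 :: "l2 \<Rightarrow> l2 \<Rightarrow> real" is
  "\<lambda>f g. integral\<^sup>L lborel (\<lambda>x. inner (f x) (g x))"
proof -
  fix f f' g g' assume "l2_eq f f'" "l2_eq g g'"
  then show "integral\<^sup>L lborel (\<lambda>x. inner (f x) (g x)) = integral\<^sup>L lborel (\<lambda>x. inner (f' x) (g' x))"
    by (intro integral_cong_AE) (auto simp: l2_eq_def square_integrable_def elim: AE_mp)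
qed

definition norm_l2 :: "l2 \<Rightarrow> real" where
  "norm_l2 f = sqrt (inner f f)"

definition sgn_l2 :: "l2 \<Rightarrow> l2" where
  "sgn_l2 f = inverse (norm f) *\<^sub>R f"

definition dist_l2 :: "l2 \<Rightarrow> l2 \<Rightarrow> real" where
  "dist_l2 f g = norm (f - g)"

definition uniformity_l2 :: "(l2 \<times> l2) filter" where
  "uniformity_l2 = (INF e\<in>{0<..}. principal {(x, y). dist x y < e})"

definition open_l2 :: "l2 set \<Rightarrow> bool" where
  "open_l2 U \<longleftrightarrow> (\<forall>x\<in>U. \<forall>\<^sub>F (x', y) in uniformity. x' = x \<longrightarrow> y \<in> U)"

instance
proof
  fix x y z :: l2 and r s :: real and U :: "l2 set"
  show "r *\<^sub>R (x + y) = r *\<^sub>R x + r *\<^sub>R y"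
    unfolding scaleR_l2_def
    by transfer (auto simp: l2_eq_def ring_distribs square_integrable_add square_integrable_scale)
  show "(r + s) *\<^sub>R x = r *\<^sub>R x + s *\<^sub>R x"
    unfolding scaleR_l2_def
    by transfer (auto simp: l2_eq_def ring_distribs square_integrable_add square_integrable_scale)
  show "r *\<^sub>R s *\<^sub>R x = (r * s) *\<^sub>R x"
    unfolding scaleR_l2_def
    by transfer (auto simp: l2_eq_def mult.assoc square_integrable_scale)
  show "1 *\<^sub>R x = x"
    unfolding scaleR_l2_def by transfer (auto simp: l2_eq_def)
  show "sgn x = inverse (norm x) *\<^sub>R x"
    by (rule sgn_l2_def)
  show "dist x y = norm (x - y)"
    by (rule dist_l2_def)
  show "uniformity = (INF e\<in>{0<..}. principal {(x, y). dist (x::l2) y < e})"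
    by (rule uniformity_l2_def)
  show "open U \<longleftrightarrow> (\<forall>x\<in>U. \<forall>\<^sub>F (x', y) in uniformity. x' = x \<longrightarrow> y \<in> U)"
    by (rule open_l2_def)
  show "inner x y = inner y x"
    by transfer (simp add: inner_commute)
  show "inner (x + y) z = inner x z + inner y z"
    by transfer (simp add: inner_add_left l2_eq_def integrable_inner_square_integrable)
  show "inner (r *\<^sub>R x) y = r * inner x y"
    unfolding scaleR_l2_def
    by transfer (simp flip: scaleR_conv_of_real)
  show "0 \<le> inner x x"
    by transfer simp
  show "inner x x = 0 \<longleftrightarrow> x = 0"
  proof transfer
    fix f assume "l2_eq f f"
    then have f: "square_integrable f" by (simp add: l2_eq_def)
    have "(LINT x|lborel. inner (f x) (f x)) = 0 \<longleftrightarrow> (AE x in lborel. inner (f x) (f x) = 0)"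
      by (rule integral_nonneg_eq_0_iff_AE[OF integrable_inner_square_integrable[OF f f]]) simp
    then show "(LINT x|lborel. inner (f x) (f x)) = 0 \<longleftrightarrow> l2_eq f (\<lambda>_. 0)"
      using f square_integrable_zero by (simp add: l2_eq_def)
  qed
  show "norm x = sqrt (inner x x)"
    by (rule norm_l2_def)
qed

end

interpretation l2: vector_space scaleC_l2
proof
  fix a b :: complex and x y :: l2
  show "scaleC_l2 a (x + y) = scaleC_l2 a x + scaleC_l2 a y"
    by transfer (auto simp: l2_eq_def ring_distribs square_integrable_add square_integrable_scale)
  show "scaleC_l2 (a + b) x = scaleC_l2 a x + scaleC_l2 b x"
    by transfer (auto simp: l2_eq_def ring_distribs square_integrable_add square_integrable_scale)
  show "scaleC_l2 a (scaleC_l2 b x) = scaleC_l2 (a * b) x"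
    by transfer (auto simp: l2_eq_def mult.assoc square_integrable_scale)
  show "scaleC_l2 1 x = x"
    by transfer (auto simp: l2_eq_def)
qed

text \<open>\<open>rep_l2\<close> chooses a representative of a class; \<open>l2_of\<close> is the class of a
  square integrable function.\<close>

definition l2_of :: "(real \<Rightarrow> complex) \<Rightarrow> l2" where
  "l2_of f = (if square_integrable f then abs_l2 f else 0)"


section \<open>Fourier transform, Fourier multipliers and $H^1(\mathbb{R})$\<close>

text \<open>The transform is $\hat f(\eta) = \int e^{-i\eta x} f(x)\,dx$, extended to $L^2$ as the
  $L^2$-limit of the transforms of the truncations of $f$ to $[-n,n]$. By Plancherel's theorem
  these limits exist and \<open>fourier_l2\<close> is a bijection of $L^2$, which makes \<open>lim\<close> and \<open>inv\<close>
  below meaningful; \<open>\<partial>\<close> corresponds to multiplication by $i\eta$.\<close>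

definition fourier_l2 :: "l2 \<Rightarrow> l2" where
  "fourier_l2 f =
     lim (\<lambda>n::nat. l2_of (\<lambda>\<eta>.
       LINT x:{- real n..real n}|lborel. exp (- (\<i> * of_real \<eta> * of_real x)) * rep_l2 f x))"

definition fourier_multiplier :: "(real \<Rightarrow> complex) \<Rightarrow> l2 \<Rightarrow> l2" where
  "fourier_multiplier m f = inv fourier_l2 (l2_of (\<lambda>\<eta>. m \<eta> * rep_l2 (fourier_l2 f) \<eta>))"

definition sobolev_H1 :: "l2 set" where
  "sobolev_H1 =
     {f. square_integrable (\<lambda>\<eta>. of_real (sqrt (1 + \<eta>\<^sup>2)) * rep_l2 (fourier_l2 f) \<eta>)}"

definition multiply_l2 :: "(real \<Rightarrow> real) \<Rightarrow> l2 \<Rightarrow> l2" where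
  "multiply_l2 u f = l2_of (\<lambda>x. of_real (u x) * rep_l2 f x)"


section \<open>Fredholm operators and the essential spectrum\<close>

text \<open>An operator is given by its domain \<open>D\<close> and a function \<open>T\<close> whose values outside \<open>D\<close>
  are irrelevant.\<close>

definition op_kernel :: "l2 set \<Rightarrow> (l2 \<Rightarrow> l2) \<Rightarrow> l2 set" where
  "op_kernel D T = {f \<in> D. T f = 0}"

definition finite_dim :: "l2 set \<Rightarrow> bool" where
  "finite_dim V \<longleftrightarrow> (\<exists>B. finite B \<and> l2.span B = V)"

definition finite_codim :: "l2 set \<Rightarrow> bool" where
  "finite_codim V \<longleftrightarrow> (\<exists>B. finite B \<and> l2.span (V \<union> B) = UNIV)"

text \<open>For a subspace \<open>V\<close> of finite codimension this is the dimension of the quotient $L^2/V$.\<close>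

definition codim :: "l2 set \<Rightarrow> nat" where
  "codim V = (LEAST n. \<exists>B. finite B \<and> card B = n \<and> l2.span (V \<union> B) = UNIV)"

definition fredholm :: "l2 set \<Rightarrow> (l2 \<Rightarrow> l2) \<Rightarrow> bool" where
  "fredholm D T \<longleftrightarrow>
     finite_dim (op_kernel D T) \<and> closed (T ` D) \<and> finite_codim (T ` D)"

definition fredholm_index :: "l2 set \<Rightarrow> (l2 \<Rightarrow> l2) \<Rightarrow> int" where
  "fredholm_index D T = int (l2.dim (op_kernel D T)) - int (codim (T ` D))"

definition essential_spectrum :: "l2 set \<Rightarrow> (l2 \<Rightarrow> l2) \<Rightarrow> complex set" where
  "essential_spectrum D A =
     {z. \<not> (fredholm D (\<lambda>f. scaleC_l2 z f - A f) \<and>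
            fredholm_index D (\<lambda>f. scaleC_l2 z f - A f) = 0)}"


section \<open>The solitary wave and the conjugated linearized operator\<close>

definition dp_solitary_profile :: "real \<Rightarrow> real \<Rightarrow> (real \<Rightarrow> real) \<Rightarrow> bool" where
  "dp_solitary_profile c k u \<longleftrightarrow>
     (\<forall>n x. (deriv ^^ n) u field_differentiable (at x)) \<and>
     (\<exists>x y. u x \<noteq> u y) \<and>
     (\<forall>x. u (- x) = u x) \<and>
     (\<forall>x. (c - u x) ^ 3 * (u x - deriv (deriv u) x) = k * (c - k) ^ 3) \<and>
     deriv u 0 = 0 \<and>
     (u \<longlongrightarrow> k) at_infinity \<and>
     (\<forall>x. 0 < u x \<and> u x < c) \<and>
     (\<forall>x. u x - deriv (deriv u) x > 0)"

text \<open>\<open>conj_symbol \<alpha> \<eta>\<close> is the symbol of $\partial-\alpha$. The factor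
  $(\partial-\alpha)(1-(\partial-\alpha)^2)^{-1}(4-(\partial-\alpha)^2)$ is read as one Fourier
  multiplier (of order one), since $4-(\partial-\alpha)^2$ alone maps $H^1$ out of $L^2$.\<close>

definition conj_symbol :: "real \<Rightarrow> real \<Rightarrow> complex" where
  "conj_symbol \<alpha> \<eta> = \<i> * of_real \<eta> - of_real \<alpha>"

definition dp_conj_operator :: "real \<Rightarrow> real \<Rightarrow> (real \<Rightarrow> real) \<Rightarrow> l2 \<Rightarrow> l2" where
  "dp_conj_operator c \<alpha> u w =
     scaleC_l2 (of_real c) (fourier_multiplier (conj_symbol \<alpha>) w)
     - fourier_multiplier
         (\<lambda>\<eta>. conj_symbol \<alpha> \<eta> * inverse (1 - (conj_symbol \<alpha> \<eta>)\<^sup>2) * (4 - (conj_symbol \<alpha> \<eta>)\<^sup>2))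
         (multiply_l2 u w)"

end

theory Submission
  imports Defs "HOL-Probability.Characteristic_Functions"
begin

text \<open>
Write \<open>s = \<i> \<eta> - \<alpha>\<close> and \<open>r = s / (1 - s\<^sup>2)\<close>; the order-one symbol in the operator is \<open>s + 3 r\<close>. The
substitution \<open>v = (c - u) w / (c - k)\<close>, which preserves $H^1$ because \<open>u\<close> is Lipschitz and stays below
\<open>c\<close>, turns \<open>z - A\<close> into an operator with constant-coefficient leading part, and composing with
the inverse of \<open>Q(D)\<close>, \<open>Q = z - (c - k) s\<close>, gives \<open>m(D) + K\<close> on $L^2$. Here \<open>m = 1 + 3 k r / Q\<close>, and
\<open>K\<close> is built from operators \<open>\<phi> \<circ> n(D)\<close> with \<open>\<phi>\<close> and \<open>n\<close> vanishing at infinity, so it is a norm limit of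
operators of finite rank.

The real part of \<open>Q + 3 k r\<close> is smallest at \<open>\<eta> = 0\<close>, where it equals \<open>Re z + \<Delta>\<close>. If \<open>Re z > - \<Delta>\<close>, then
\<open>1 / m\<close> is bounded and \<open>m(D) + K\<close> is an invertible operator plus one of finite rank, hence Fredholm of
index zero. If \<open>z = - \<Delta>\<close>, then \<open>m\<close> vanishes at \<open>\<eta> = 0\<close>, so \<open>m(D)\<close> is arbitrarily small on the
infinite-dimensional spaces of functions with frequencies near \<open>0\<close>, which is incompatible with a
closed range and a finite-dimensional kernel.
\<close>

subsection \<open>The space $L^2$: representatives, Fatou, completeness\<close>

text \<open>The operator differs from its limit at infinity by, among others, the function
  \<open>u - k\<close> times a derivative. That term has the same order as the operator and is not
  compact relative to it, so constant-coefficient comparison fails directly; hence the substitution,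
  after which variable coefficients occur only in terms followed by a smoothing factor. Division by
  \<open>Q\<close> is legitimate because \<open>Re Q\<close> is the constant
  \<open>Re z + (c - k) \<alpha>\<close>, and \<open>\<Delta>\<close> falls short of
  \<open>(c - k) \<alpha>\<close> by \<open>3 k \<alpha> / (1 - \<alpha>\<^sup>2)\<close>; the line
  \<open>Re z = - \<Delta>\<close> therefore still lies where \<open>Q\<close> has no zero. A
  half-plane free of essential spectrum and one point on its boundary already determine the
  distance, so the whole spectral curve is never computed. The transform is given by
  \<open>lim\<close> and its inverse by \<open>inv\<close>, so completeness and Fourier inversion
  have to come before any statement on the operator. Index zero is counted by hand for the identity
  plus finite rank, and invertible factors carry it over.\<close>

lemma l2_eq_refl_iff: "l2_eq f f \<longleftrightarrow> square_integrable f"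
  by (auto simp: l2_eq_def)

lemma square_integrable_rep [simp]: "square_integrable (rep_l2 f)"
  using Quotient3_rep_reflp[OF Quotient3_l2, of f] by (simp add: l2_eq_refl_iff)

lemma square_integrable_measurable [measurable_dest]:
  "square_integrable f \<Longrightarrow> f \<in> borel_measurable lborel"
  by (simp add: square_integrable_def)

lemma measurable_rep_l2 [measurable]: "rep_l2 f \<in> borel_measurable lborel"
  using square_integrable_measurable square_integrable_rep by blast

lemma l2_of_rep [simp]: "l2_of (rep_l2 f) = f"
  by (simp add: l2_of_def Quotient3_abs_rep[OF Quotient3_l2])

lemma l2_of_eq_iff:
  assumes "square_integrable f" "square_integrable g"
  shows "l2_of f = l2_of g \<longleftrightarrow> (AE x in lborel. f x = g x)"
  using Quotient3_rel[OF Quotient3_l2, of f g] assms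
  by (auto simp: l2_of_def l2_eq_def)

lemma square_integrable_cong_AE:
  assumes "AE x in lborel. f x = g x" "f \<in> borel_measurable lborel" "g \<in> borel_measurable lborel"
  shows "square_integrable f \<longleftrightarrow> square_integrable g"
proof -
  have "integrable lborel (\<lambda>x. (norm (f x))\<^sup>2) \<longleftrightarrow> integrable lborel (\<lambda>x. (norm (g x))\<^sup>2)"
    using assms by (intro integrable_cong_AE) auto
  then show ?thesis using assms by (auto simp: square_integrable_def)
qed

lemma l2_of_cong_AE:
  assumes "AE x in lborel. f x = g x" "f \<in> borel_measurable lborel" "g \<in> borel_measurable lborel"
  shows "l2_of f = l2_of g"
proof (cases "square_integrable f")
  case True
  then have "square_integrable g" using square_integrable_cong_AE[OF assms] by simp
  with True show ?thesis using l2_of_eq_iff assms(1) by blast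
next
  case False
  then have "\<not> square_integrable g" using square_integrable_cong_AE[OF assms] by simp
  with False show ?thesis by (simp add: l2_of_def)
qed

lemma rep_l2_of:
  assumes "square_integrable f"
  shows "AE x in lborel. rep_l2 (l2_of f) x = f x"
  using l2_of_eq_iff[of "rep_l2 (l2_of f)" f] assms by simp

lemma l2_of_zero: "l2_of (\<lambda>_. 0) = 0"
  by (simp add: l2_of_def square_integrable_zero zero_l2.abs_eq)

lemma l2_of_add:
  "square_integrable f \<Longrightarrow> square_integrable g \<Longrightarrow> l2_of (\<lambda>x. f x + g x) = l2_of f + l2_of g"
  by (simp add: l2_of_def square_integrable_add plus_l2.abs_eq l2_eq_refl_iff)

lemma l2_of_diff:
  "square_integrable f \<Longrightarrow> square_integrable g \<Longrightarrow> l2_of (\<lambda>x. f x - g x) = l2_of f - l2_of g"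
  by (simp add: l2_of_def square_integrable_diff minus_l2.abs_eq l2_eq_refl_iff)

lemma l2_of_scale:
  "square_integrable f \<Longrightarrow> l2_of (\<lambda>x. a * f x) = scaleC_l2 a (l2_of f)"
  by (simp add: l2_of_def square_integrable_scale scaleC_l2.abs_eq l2_eq_refl_iff)

lemma inner_l2_of:
  "square_integrable f \<Longrightarrow> square_integrable g \<Longrightarrow>
    inner (l2_of f) (l2_of g) = (LINT x|lborel. inner (f x) (g x))"
  by (simp add: l2_of_def inner_l2.abs_eq l2_eq_refl_iff)

lemma norm_l2_of: "square_integrable f \<Longrightarrow> (norm (l2_of f))\<^sup>2 = (LINT x|lborel. (norm (f x))\<^sup>2)"
  by (simp add: power2_norm_eq_inner inner_l2_of)

lemma nn_integral_norm_l2_of: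
  assumes "square_integrable f"
  shows "(\<integral>\<^sup>+x. ennreal ((norm (f x))\<^sup>2) \<partial>lborel) = ennreal ((norm (l2_of f))\<^sup>2)"
  using assms by (subst nn_integral_eq_integral) (auto simp: norm_l2_of square_integrable_def)

lemma square_integrableI_bounded:
  assumes [measurable]: "f \<in> borel_measurable lborel"
    and "(\<integral>\<^sup>+x. ennreal ((norm (f x))\<^sup>2) \<partial>lborel) \<le> ennreal C"
  shows "square_integrable f"
proof -
  have "integrable lborel (\<lambda>x. (norm (f x))\<^sup>2)"
    using assms(2) by (intro integrableI_nonneg) (auto simp: less_top[symmetric] top_unique intro: le_less_trans)
  then show ?thesis by (simp add: square_integrable_def)
qed

lemma square_integrable_bound:
  assumes "square_integrable g" "f \<in> borel_measurable lborel" "AE x in lborel. norm (f x) \<le> C * norm (g x)"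
  shows "square_integrable f"
proof -
  have "integrable lborel (\<lambda>x. C\<^sup>2 * (norm (g x))\<^sup>2)"
    using assms(1) by (simp add: square_integrable_def)
  then have "integrable lborel (\<lambda>x. (norm (f x))\<^sup>2)"
    apply (rule Bochner_Integration.integrable_bound)
    using assms(2) apply simp
    using assms(3)
    by (auto elim!: eventually_mono simp flip: power_mult_distrib intro!: power_mono)
  then show ?thesis using assms(2) by (simp add: square_integrable_def)
qed

lemma norm_l2_of_le:
  assumes "square_integrable g" "f \<in> borel_measurable lborel" "0 \<le> C"
    "AE x in lborel. norm (f x) \<le> C * norm (g x)"
  shows "norm (l2_of f) \<le> C * norm (l2_of g)"
proof -
  have f: "square_integrable f" using square_integrable_bound assms by blast
  have "(norm (l2_of f))\<^sup>2 \<le> (LINT x|lborel. C\<^sup>2 * (norm (g x))\<^sup>2)"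
    unfolding norm_l2_of[OF f]
  proof (rule integral_mono_AE)
    show "AE x in lborel. (norm (f x))\<^sup>2 \<le> C\<^sup>2 * (norm (g x))\<^sup>2"
      using assms(4) by (auto elim!: eventually_mono simp flip: power_mult_distrib intro!: power_mono)
  qed (use f assms in \<open>auto simp: square_integrable_def\<close>)
  also have "\<dots> = (C * norm (l2_of g))\<^sup>2"
    using assms(1) by (simp add: norm_l2_of power_mult_distrib)
  finally show ?thesis using assms(3) by (simp add: power2_le_iff_abs_le)
qed

lemma norm_scaleC_l2: "norm (scaleC_l2 a f) = norm a * norm f"
proof -
  have "(norm (l2_of (\<lambda>x. a * rep_l2 f x)))\<^sup>2 = (norm a * norm (l2_of (rep_l2 f)))\<^sup>2"
    by (simp only: norm_l2_of square_integrable_scale square_integrable_rep power_mult_distrib norm_mult) simp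
  then show ?thesis by (simp add: l2_of_scale)
qed

lemma scaleR_l2_conv: "r *\<^sub>R f = scaleC_l2 (of_real r) f"
  by (simp add: scaleR_l2_def)

text \<open>Fatou's lemma applied to the squared moduli. It supplies the limit both in the proof of
  completeness and in the characterization of $H^1$ by difference quotients.\<close>

lemma l2_fatou:
  assumes f: "\<And>n. square_integrable (f n)" and [measurable]: "g \<in> borel_measurable lborel"
    and lim: "AE x in lborel. (\<lambda>n. f n x) \<longlonglongrightarrow> g x"
    and b: "\<forall>\<^sub>F n in sequentially. norm (l2_of (f n)) \<le> C"
  shows "square_integrable g" "norm (l2_of g) \<le> C"
proof -
  have C: "0 \<le> C" using eventually_happens'[OF _ b] norm_ge_zero order_trans by (metis sequentially_bot)
  have [measurable]: "f n \<in> borel_measurable lborel" for n using f square_integrable_measurable by blast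
  have "(\<integral>\<^sup>+x. ennreal ((norm (g x))\<^sup>2) \<partial>lborel) = (\<integral>\<^sup>+x. liminf (\<lambda>n. ennreal ((norm (f n x))\<^sup>2)) \<partial>lborel)"
  proof (intro nn_integral_cong_AE)
    show "AE x in lborel. ennreal ((norm (g x))\<^sup>2) = liminf (\<lambda>n. ennreal ((norm (f n x))\<^sup>2))"
      using lim
    proof eventually_elim
      case (elim x)
      then have "(\<lambda>n. ennreal ((norm (f n x))\<^sup>2)) \<longlonglongrightarrow> ennreal ((norm (g x))\<^sup>2)"
        by (intro tendsto_intros)
      then show ?case by (intro lim_imp_Liminf[symmetric]) simp_all
    qed
  qed
  also have "\<dots> \<le> liminf (\<lambda>n. \<integral>\<^sup>+x. ennreal ((norm (f n x))\<^sup>2) \<partial>lborel)"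
    by (intro nn_integral_liminf) auto
  also have "\<dots> = liminf (\<lambda>n. ennreal ((norm (l2_of (f n)))\<^sup>2))"
    using f by (simp add: nn_integral_norm_l2_of)
  also have "\<dots> \<le> liminf (\<lambda>n::nat. ennreal (C\<^sup>2))"
    by (intro Liminf_mono eventually_mono[OF b]) (auto intro!: ennreal_leI power_mono)
  also have "\<dots> = ennreal (C\<^sup>2)"
    by (simp add: Liminf_const)
  finally have *: "(\<integral>\<^sup>+x. ennreal ((norm (g x))\<^sup>2) \<partial>lborel) \<le> ennreal (C\<^sup>2)" .
  show g: "square_integrable g" using square_integrableI_bounded[OF _ *] by simp
  have "(norm (l2_of g))\<^sup>2 \<le> C\<^sup>2"
    using * by (simp add: nn_integral_norm_l2_of[OF g])
  then show "norm (l2_of g) \<le> C" using C power2_le_imp_le by blast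
qed

text \<open>Riesz--Fischer: along a fast subsequence with increments \<open>d k\<close>, the sum
  \<open>\<Sum>k. 2 ^ k * \<bar>d k\<bar>\<^sup>2\<close> is integrable, so the increments are summable almost everywhere.\<close>

lemma Cauchy_l2_convergent:
  fixes X :: "nat \<Rightarrow> l2"
  assumes "Cauchy X"
  shows "convergent X"
proof -
  have "\<exists>N. \<forall>m\<ge>N. \<forall>n\<ge>N. norm (X m - X n) < (1/2)^k" for k :: nat
    by (rule CauchyD[OF assms]) simp
  then obtain N where N: "\<And>k m n. m \<ge> N k \<Longrightarrow> n \<ge> N k \<Longrightarrow> norm (X m - X n) < (1/2)^k"
    by metis
  \<comment> \<open>The sum makes \<open>r j\<close> dominate every \<open>N k\<close> with
    \<open>k \<le> j\<close>, although \<open>N\<close> need not be monotone.\<close>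
  define r where "r k = (\<Sum>i\<le>k. N i) + k" for k
  have rN: "N k \<le> r j" if "k \<le> j" for k j
    unfolding r_def using that by (meson atMost_iff finite_atMost member_le_sum trans_le_add1 zero_le)
  define g where "g k = rep_l2 (X (r k))" for k
  have [simp]: "square_integrable (g k)" "l2_of (g k) = X (r k)" for k by (auto simp: g_def)
  have [measurable]: "g k \<in> borel_measurable lborel" for k by (simp add: g_def)
  define d where "d k x = g (Suc k) x - g k x" for k x
  have d [simp]: "square_integrable (d k)" for k unfolding d_def by (intro square_integrable_diff) auto
  have nd: "norm (l2_of (d k)) \<le> (1/2)^k" for k
    unfolding d_def using N[of k "r (Suc k)" "r k"] rN by (simp add: l2_of_diff)
  have "(\<integral>\<^sup>+x. (\<Sum>k. ennreal (2^k * (norm (d k x))\<^sup>2)) \<partial>lborel)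
      = (\<Sum>k. \<integral>\<^sup>+x. ennreal (2^k * (norm (d k x))\<^sup>2) \<partial>lborel)"
    by (intro nn_integral_suminf) (auto simp: d_def)
  also have "\<dots> = (\<Sum>k. ennreal (2^k * (norm (l2_of (d k)))\<^sup>2))"
    by (intro arg_cong[where f=suminf] ext, subst ennreal_mult, simp, simp, subst nn_integral_cmult)
       (simp_all add: nn_integral_norm_l2_of ennreal_mult, simp add: d_def)
  also have "\<dots> \<le> (\<Sum>k. ennreal ((1/2)^k))"
  proof (intro suminf_le ennreal_leI)
    fix k
    have "(norm (l2_of (d k)))\<^sup>2 \<le> ((1/2)^k)\<^sup>2" using nd by (intro power_mono) auto
    then have "2^k * (norm (l2_of (d k)))\<^sup>2 \<le> 2^k * ((1/2)^k)\<^sup>2" by simp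
    also have "\<dots> = (1/2)^k" by (simp add: power2_eq_square power_one_over)
    finally show "2^k * (norm (l2_of (d k)))\<^sup>2 \<le> (1/2)^k" .
  qed auto
  also have "\<dots> < \<infinity>"
    by (subst suminf_ennreal2) (auto intro!: summable_geometric)
  finally have "AE x in lborel. (\<Sum>k. ennreal (2^k * (norm (d k x))\<^sup>2)) \<noteq> \<infinity>"
    by (intro nn_integral_PInf_AE) (auto simp: d_def)
  then have conv: "AE x in lborel. (\<lambda>k. g k x) \<longlonglongrightarrow> lim (\<lambda>k. g k x)"
  proof eventually_elim
    case (elim x)
    then have s: "summable (\<lambda>k. 2^k * (norm (d k x))\<^sup>2)"
      by (intro summable_suminf_not_top) auto
    \<comment> \<open>A single term \<open>2^k * (norm (d k x))\<^sup>2\<close> is at most the total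
      \<open>T\<close>, which forces geometric decay of \<open>d k x\<close> with ratio
      \<open>sqrt (1/2)\<close>.\<close>
    define T where "T = (\<Sum>k. 2^k * (norm (d k x))\<^sup>2)"
    have dT: "norm (d k x) \<le> sqrt T * (sqrt (1/2))^k" for k
    proof -
      have "2^k * (norm (d k x))\<^sup>2 \<le> T"
        unfolding T_def using s sum_le_suminf[of _ "{k}"] by (force simp del: power2_eq_square)
      then have "(norm (d k x))\<^sup>2 \<le> T * (1/2)^k" by (simp add: field_simps power_one_over)
      then have "sqrt ((norm (d k x))\<^sup>2) \<le> sqrt (T * (1/2)^k)" by (rule real_sqrt_le_mono)
      then show ?thesis by (simp add: real_sqrt_mult real_sqrt_power)
    qed
    have "summable (\<lambda>k. sqrt T * (sqrt (1/2))^k)"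
      by (intro summable_mult summable_geometric) (simp add: real_sqrt_divide)
    then have "summable (\<lambda>k. d k x)"
      by (rule summable_comparison_test'[where N=0]) (rule dT)
    then have "convergent (\<lambda>n. \<Sum>k<n. d k x)" by (simp add: summable_iff_convergent)
    moreover have "(\<Sum>k<n. d k x) = g n x - g 0 x" for n
      unfolding d_def by (rule sum_lessThan_telescope)
    ultimately have "convergent (\<lambda>n. g n x)"
      using convergent_diff_const_right_iff[of "\<lambda>n. g n x" "g 0 x"]
      by (simp)
    then show ?case by (simp add: convergent_LIMSEQ_iff)
  qed
  define h where "h x = lim (\<lambda>k. g k x)" for x
  have [measurable]: "h \<in> borel_measurable lborel"
    unfolding h_def by (intro borel_measurable_lim_metric) auto
  \<comment> \<open>Letting \<open>n\<close> tend to infinity in the bound for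
    \<open>g n - g k\<close>, Fatou passes the Cauchy estimate on to the limit.\<close>
  have key: "square_integrable (\<lambda>x. h x - g k x) \<and> norm (l2_of (\<lambda>x. h x - g k x)) \<le> (1/2)^k" for k
  proof -
    have "AE x in lborel. (\<lambda>n. g n x - g k x) \<longlonglongrightarrow> h x - g k x"
      using conv unfolding h_def by eventually_elim (intro tendsto_intros)
    moreover have "\<forall>\<^sub>F n in sequentially. norm (l2_of (\<lambda>x. g n x - g k x)) \<le> (1/2)^k"
      using eventually_ge_at_top[of k]
      by eventually_elim (use N[of k] rN in \<open>auto simp: l2_of_diff intro!: less_imp_le\<close>)
    ultimately show ?thesis
      using l2_fatou[of "\<lambda>n x. g n x - g k x" "\<lambda>x. h x - g k x" "(1/2)^k"]
      by (simp add: square_integrable_diff)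
  qed
  have h: "square_integrable h"
    using square_integrable_add[of "\<lambda>x. h x - g 0 x" "g 0"] key by simp
  have "norm (X n - l2_of h) \<le> 2 * (1/2)^k" if "n \<ge> r k" for n k
  proof -
    have "norm (X n - l2_of h) = norm ((X n - X (r k)) - l2_of (\<lambda>x. h x - g k x))"
      by (simp add: l2_of_diff h)
    also have "\<dots> \<le> norm (X n - X (r k)) + norm (l2_of (\<lambda>x. h x - g k x))"
      by (rule norm_triangle_ineq4)
    also have "\<dots> \<le> (1/2)^k + (1/2)^k"
      using N[of k n "r k"] rN[of k k] that key[of k] by (intro add_mono) auto
    finally show ?thesis by simp
  qed
  moreover have "\<exists>k. 2 * (1/2)^k < e" if "e > 0" for e :: real
    using real_arch_pow_inv[of "e/2" "1/2"] that by (auto simp: field_simps)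
  ultimately have "X \<longlonglongrightarrow> l2_of h"
    by (intro LIMSEQ_I) (meson le_less_trans)
  then show ?thesis by (auto simp: convergent_def)
qed

instance l2 :: banach
  by standard (rule Cauchy_l2_convergent)

subsection \<open>The Fourier integral and the regularized Parseval identity\<close>

lemma borel_measurable_cis [measurable (raw)]:
  "f \<in> borel_measurable M \<Longrightarrow> (\<lambda>x. cis (f x)) \<in> borel_measurable M"
  by (rule borel_measurable_continuous_on[where f=cis]) (auto intro!: continuous_intros)

text \<open>One bounded kernel \<open>h\<close> covers both characters and normal densities. The two
  measures stay general because Fubini is later applied with a product measure as the first
  factor.\<close>

lemma integrable_pair_mult:
  fixes f :: "'a \<Rightarrow> complex" and g :: "'b \<Rightarrow> complex"
  assumes ps: "pair_sigma_finite M1 M2" and f: "integrable M1 f" and g: "integrable M2 g"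
    and [measurable]: "h \<in> borel_measurable (M1 \<Otimes>\<^sub>M M2)" and B: "\<And>p. norm (h p) \<le> B"
  shows "integrable (M1 \<Otimes>\<^sub>M M2) (\<lambda>p. f (fst p) * g (snd p) * h p)"
proof -
  interpret pair_sigma_finite M1 M2 by fact
  have [measurable]: "f \<in> borel_measurable M1" "g \<in> borel_measurable M2"
    using f g by auto
  have "integrable (M1 \<Otimes>\<^sub>M M2) (\<lambda>p. B * (norm (f (fst p)) * norm (g (snd p))))"
  proof (intro integrable_mult_right Fubini_integrable)
    show "AE x in M1. integrable M2 (\<lambda>y. norm (f (fst (x, y))) * norm (g (snd (x, y))))"
      using g by simp
    show "integrable M1 (\<lambda>x. LINT y|M2. norm (norm (f (fst (x, y))) * norm (g (snd (x, y)))))"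
      using f by (simp add: abs_mult)
  qed simp
  then show ?thesis
  proof (rule Bochner_Integration.integrable_bound)
    show "AE p in M1 \<Otimes>\<^sub>M M2. norm (f (fst p) * g (snd p) * h p) \<le> norm (B * (norm (f (fst p)) * norm (g (snd p))))"
    proof (rule AE_I2)
      fix p
      have "norm (h p) * (norm (f (fst p)) * norm (g (snd p))) \<le> \<bar>B\<bar> * (norm (f (fst p)) * norm (g (snd p)))"
        using B[of p] by (intro mult_right_mono) auto
      then show "norm (f (fst p) * g (snd p) * h p) \<le> norm (B * (norm (f (fst p)) * norm (g (snd p))))"
        by (simp add: norm_mult abs_mult mult.commute mult.left_commute)
    qed
  qed simp
qed

lemma integral_pair_mult:
  fixes f :: "'a \<Rightarrow> complex" and g :: "'b \<Rightarrow> complex"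
  assumes ps: "pair_sigma_finite M1 M2" and f: "integrable M1 f" and g: "integrable M2 g"
    and h: "h \<in> borel_measurable (M1 \<Otimes>\<^sub>M M2)" and B: "\<And>p. norm (h p) \<le> B"
  shows "(LINT p|(M1 \<Otimes>\<^sub>M M2). f (fst p) * g (snd p) * h p) = (LINT x|M1. f x * (LINT y|M2. g y * h (x, y)))"
    and "(LINT p|(M1 \<Otimes>\<^sub>M M2). f (fst p) * g (snd p) * h p) = (LINT y|M2. g y * (LINT x|M1. f x * h (x, y)))"
proof -
  interpret pair_sigma_finite M1 M2 by fact
  note i = integrable_pair_mult[OF assms]
  have "(LINT p|(M1 \<Otimes>\<^sub>M M2). f (fst p) * g (snd p) * h p) = (LINT x|M1. LINT y|M2. f x * g y * h (x, y))"
    using integral_fst'[OF i] by simp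
  also have "\<dots> = (LINT x|M1. f x * (LINT y|M2. g y * h (x, y)))"
    by (simp add: mult.assoc)
  finally show "(LINT p|(M1 \<Otimes>\<^sub>M M2). f (fst p) * g (snd p) * h p) = (LINT x|M1. f x * (LINT y|M2. g y * h (x, y)))" .
  have "(LINT p|(M1 \<Otimes>\<^sub>M M2). f (fst p) * g (snd p) * h p) = (LINT y|M2. LINT x|M1. f x * g y * h (x, y))"
    using integral_snd[of "\<lambda>x y. f x * g y * h (x, y)"] i by (simp add: case_prod_unfold)
  also have "\<dots> = (LINT y|M2. g y * (LINT x|M1. f x * h (x, y)))"
    by (simp add: mult.assoc mult.left_commute[of "f _"])
  finally show "(LINT p|(M1 \<Otimes>\<^sub>M M2). f (fst p) * g (snd p) * h p) = (LINT y|M2. g y * (LINT x|M1. f x * h (x, y)))" .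
qed

lemma pair_sigma_finite_lborel: "pair_sigma_finite (lborel :: real measure) (lborel :: real measure)"
  by (rule lborel_pair.pair_sigma_finite_axioms)

text \<open>Both signs of the exponent are treated at once: \<open>\<sigma> = -1\<close> is the Fourier transform and
  \<open>\<sigma> = 1\<close> is, up to the factor \<open>2 * pi\<close>, its inverse.\<close>

definition fourier_integral :: "real \<Rightarrow> (real \<Rightarrow> complex) \<Rightarrow> real \<Rightarrow> complex" where
  "fourier_integral \<sigma> f \<eta> = (LINT x|lborel. f x * cis (\<sigma> * \<eta> * x))"

lemma measurable_fourier_integral [measurable]:
  assumes "f \<in> borel_measurable borel"
  shows "fourier_integral \<sigma> f \<in> borel_measurable borel"
proof -
  have [measurable]: "f \<in> borel_measurable borel" by fact
  show ?thesis unfolding fourier_integral_def[abs_def] by measurable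
qed

lemma norm_fourier_integral_le:
  assumes "integrable lborel f"
  shows "norm (fourier_integral \<sigma> f \<eta>) \<le> (LINT x|lborel. norm (f x))"
proof -
  have "norm (fourier_integral \<sigma> f \<eta>) \<le> (LINT x|lborel. norm (f x * cis (\<sigma> * \<eta> * x)))"
    unfolding fourier_integral_def by (rule integral_norm_bound)
  then show ?thesis by (simp add: norm_mult)
qed

lemma integrable_mult_cis:
  fixes f :: "real \<Rightarrow> complex"
  assumes "integrable lborel f"
  shows "integrable lborel (\<lambda>x. f x * cis (a * x))"
  by (rule Bochner_Integration.integrable_bound[OF assms]) (use assms in \<open>auto simp: norm_mult\<close>)

text \<open>After the substitution \<open>\<eta> = n s\<close> this is the characteristic function
  of the standard normal distribution. Written as a density of deviation \<open>1 / n\<close>, the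
  result is visibly an approximate identity in \<open>d\<close>.\<close>

lemma gaussian_fourier:
  assumes "0 < n"
  shows "(LINT \<eta>|lborel. of_real (exp (- (\<eta> / n)\<^sup>2 / 2)) * cis (d * \<eta>))
    = of_real (2 * pi * normal_density 0 (1 / n) d)"
proof -
  have "(LINT \<eta>|lborel. of_real (exp (- (\<eta> / n)\<^sup>2 / 2)) * cis (d * \<eta>))
      = n *\<^sub>R (LINT s|lborel. of_real (exp (- s\<^sup>2 / 2)) * cis (d * n * s))"
    using assms by (subst lborel_integral_real_affine[where c=n and t=0]) (simp_all add: mult.assoc)
  also have "(LINT s|lborel. of_real (exp (- s\<^sup>2 / 2)) * cis (d * n * s))
      = (LINT s|lborel. of_real (sqrt (2 * pi)) * (std_normal_density s *\<^sub>R cis (d * n * s)))"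
    by (intro Bochner_Integration.integral_cong) (auto simp: std_normal_density_def scaleR_conv_of_real)
  also have "\<dots> = of_real (sqrt (2 * pi)) * (LINT s|lborel. std_normal_density s *\<^sub>R cis (d * n * s))"
    by (rule integral_mult_right_zero)
  also have "\<dots> = of_real (sqrt (2 * pi)) * char std_normal_distribution (d * n)"
    unfolding char_def by (subst integral_density) (auto simp: cis_conv_exp)
  also have "\<dots> = of_real (sqrt (2 * pi) * exp (- (d * n)\<^sup>2 / 2))"
    by (simp add: char_std_normal_distribution)
  also have "n *\<^sub>R (of_real (sqrt (2 * pi) * exp (- (d * n)\<^sup>2 / 2)) :: complex)
      = of_real (n * sqrt (2 * pi) * exp (- (d * n)\<^sup>2 / 2))"
    by (simp add: scaleR_conv_of_real)
  also have "n * sqrt (2 * pi) * exp (- (d * n)\<^sup>2 / 2) = 2 * pi * normal_density 0 (1 / n) d"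
  proof -
    have "sqrt (2 * pi * (1 / n)\<^sup>2) = sqrt (2 * pi) / n"
      using assms by (simp add: real_sqrt_mult real_sqrt_divide power_divide)
    moreover have "2 * pi * (1 / (sqrt (2 * pi) / n)) = n * sqrt (2 * pi)"
    proof -
      have "2 * pi * (1 / (sqrt (2 * pi) / n)) = n * (sqrt (2 * pi) * sqrt (2 * pi)) / sqrt (2 * pi)" by simp
      also have "\<dots> = n * sqrt (2 * pi)" by (subst times_divide_eq_right[symmetric], subst nonzero_mult_div_cancel_right) auto
      finally show ?thesis .
    qed
    moreover have "- (d - 0)\<^sup>2 / (2 * (1 / n)\<^sup>2) = - (d * n)\<^sup>2 / 2"
      using assms by (simp add: power_divide power_mult_distrib)
    ultimately show ?thesis
      unfolding normal_density_def by (metis mult.assoc)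
  qed
  finally show ?thesis .
qed

lemma integrable_gaussian:
  assumes "0 < n"
  shows "integrable lborel (\<lambda>\<eta>. exp (- (\<eta> / n)\<^sup>2 / 2) :: real)"
proof -
  have "integrable lborel (\<lambda>\<eta>. (sqrt (2 * pi) * n) * normal_density 0 n \<eta>)"
    using assms by (intro integrable_mult_right) simp
  moreover have "(sqrt (2 * pi) * n) * normal_density 0 n \<eta> = exp (- (\<eta> / n)\<^sup>2 / 2)" for \<eta>
    using assms by (simp add: normal_density_def real_sqrt_mult power_divide)
  ultimately show ?thesis by simp
qed

lemma normal_density_shift: "normal_density 0 s (x - y) = normal_density x s y"
  by (simp add: normal_density_def power2_commute)

lemma normal_density_le: "0 < s \<Longrightarrow> normal_density m s x \<le> 1 / sqrt (2 * pi * s\<^sup>2)"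
  unfolding normal_density_def by (intro mult_right_le_one_le) (auto simp: zero_le_mult_iff)

lemma integrable_of_real_complex:
  "integrable M f \<Longrightarrow> integrable M (\<lambda>x. complex_of_real (f x))"
  by (rule integrable_of_real)

text \<open>For integrable \<open>f\<close> and \<open>g\<close> the product of the transforms need
  not be integrable. The Gaussian weight makes the triple integral absolutely convergent; Fubini
  then integrates over \<open>\<eta>\<close> first and leaves a normal density in the difference of
  the two space variables.\<close>

lemma regularized_parseval:
  assumes f: "integrable lborel f" and g: "integrable lborel g" and n: "0 < n" and \<sigma>: "\<bar>\<sigma>\<bar> = 1"
  shows "(LINT \<eta>|lborel. of_real (exp (- (\<eta> / n)\<^sup>2 / 2)) * (fourier_integral \<sigma> f \<eta> * cnj (fourier_integral \<sigma> g \<eta>)))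
    = 2 * pi * (LINT p|(lborel \<Otimes>\<^sub>M lborel). f (fst p) * cnj (g (snd p)) * of_real (normal_density (fst p) (1 / n) (snd p)))"
proof -
  let ?P = "lborel \<Otimes>\<^sub>M lborel :: (real \<times> real) measure"
  define w where "w \<eta> = complex_of_real (exp (- (\<eta> / n)\<^sup>2 / 2))" for \<eta>
  define F where "F p = f (fst p) * cnj (g (snd p))" for p
  have [measurable]: "f \<in> borel_measurable borel" "g \<in> borel_measurable borel"
    using f g by auto
  have gc: "integrable lborel (\<lambda>y. cnj (g y))" using g by simp
  have F: "integrable ?P F"
    using integrable_pair_mult[OF pair_sigma_finite_lborel f gc, of "\<lambda>_. 1" 1] by (simp add: F_def[abs_def])
  have w: "integrable lborel w"
    unfolding w_def[abs_def] by (intro integrable_of_real_complex integrable_gaussian n)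
  have prod: "fourier_integral \<sigma> f \<eta> * cnj (fourier_integral \<sigma> g \<eta>)
      = (LINT p|?P. F p * cis (\<sigma> * \<eta> * (fst p - snd p)))" for \<eta>
  proof -
    have "(LINT p|?P. F p * cis (\<sigma> * \<eta> * (fst p - snd p)))
       = (LINT p|?P. f (fst p) * cnj (g (snd p)) * (cis (\<sigma> * \<eta> * (fst p - snd p))))"
      by (simp add: F_def)
    also have "\<dots> = (LINT x|lborel. f x * (LINT y|lborel. cnj (g y) * cis (\<sigma> * \<eta> * (x - y))))"
      by (subst integral_pair_mult(1)[OF pair_sigma_finite_lborel f gc, where B=1]) auto
    also have "\<dots> = (LINT x|lborel. f x * (LINT y|lborel. cis (\<sigma> * \<eta> * x) * cnj (g y * cis (\<sigma> * \<eta> * y))))"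
    proof -
      have eq: "cnj (g y) * cis (\<sigma> * \<eta> * (x - y)) = cis (\<sigma> * \<eta> * x) * cnj (g y * cis (\<sigma> * \<eta> * y))" for x y
        by (simp add: cis_cnj cis_mult right_diff_distrib mult.left_commute[of "cis (\<sigma> * \<eta> * x)"])
      show ?thesis by (simp only: eq)
    qed
    also have "\<dots> = (LINT x|lborel. (f x * cis (\<sigma> * \<eta> * x)) * cnj (fourier_integral \<sigma> g \<eta>))"
      unfolding fourier_integral_def by (simp only: integral_mult_right_zero Bochner_Integration.integral_cnj mult.assoc)
    also have "\<dots> = fourier_integral \<sigma> f \<eta> * cnj (fourier_integral \<sigma> g \<eta>)"
      unfolding fourier_integral_def by simp
    finally show ?thesis by simp
  qed
  interpret P: pair_sigma_finite ?P "lborel :: real measure"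
    by (intro pair_sigma_finite.intro sigma_finite_pair_measure lborel.sigma_finite_measure_axioms)
  have ps: "pair_sigma_finite ?P (lborel :: real measure)" ..
  let ?h = "\<lambda>q::(real \<times> real) \<times> real. cis (\<sigma> * snd q * (fst (fst q) - snd (fst q)))"
  have "(LINT \<eta>|lborel. w \<eta> * (fourier_integral \<sigma> f \<eta> * cnj (fourier_integral \<sigma> g \<eta>)))
      = (LINT \<eta>|lborel. w \<eta> * (LINT p|?P. F p * ?h (p, \<eta>)))"
    by (simp add: prod)
  also have "\<dots> = (LINT p|?P. F p * (LINT \<eta>|lborel. w \<eta> * ?h (p, \<eta>)))"
    using integral_pair_mult[OF ps F w, where h = ?h and B = 1] by simp
  also have "(\<lambda>p. LINT \<eta>|lborel. w \<eta> * ?h (p, \<eta>)) = (\<lambda>p. of_real (2 * pi * normal_density (fst p) (1 / n) (snd p)))"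
  proof
    fix p :: "real \<times> real"
    have "(LINT \<eta>|lborel. w \<eta> * ?h (p, \<eta>)) = (LINT \<eta>|lborel. w \<eta> * cis (\<sigma> * (fst p - snd p) * \<eta>))"
      by (simp add: mult_ac)
    also have "\<dots> = of_real (2 * pi * normal_density 0 (1 / n) (\<sigma> * (fst p - snd p)))"
      unfolding w_def by (rule gaussian_fourier[OF n])
    \<comment> \<open>The sign \<open>\<sigma>\<close> drops out because the density centred at 0 is
      even.\<close>
    also have "normal_density 0 (1 / n) (\<sigma> * (fst p - snd p)) = normal_density 0 (1 / n) (fst p - snd p)"
      using \<sigma> by (auto simp: normal_density_def power_mult_distrib abs_if split: if_splits)
    finally show "(LINT \<eta>|lborel. w \<eta> * ?h (p, \<eta>)) = of_real (2 * pi * normal_density (fst p) (1 / n) (snd p))"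
      by (simp add: normal_density_shift)
  qed
  also have "(LINT p|?P. F p * of_real (2 * pi * normal_density (fst p) (1 / n) (snd p)))
      = (LINT p|?P. 2 * pi * (f (fst p) * cnj (g (snd p)) * of_real (normal_density (fst p) (1 / n) (snd p))))"
    by (intro Bochner_Integration.integral_cong) (auto simp: F_def)
  also have "\<dots> = 2 * pi * (LINT p|?P. f (fst p) * cnj (g (snd p)) * of_real (normal_density (fst p) (1 / n) (snd p)))"
    by (rule integral_mult_right_zero)
  finally show ?thesis unfolding w_def .
qed

lemma nn_integral_normal_density:
  assumes "0 < s" shows "(\<integral>\<^sup>+y. ennreal (normal_density m s y) \<partial>lborel) = 1"
  using assms by (subst nn_integral_eq_integral) auto

text \<open>Only the inequality half of Plancherel, enough to extend the transform continuously;
  equality follows later from inversion. The normal kernel has mass 1 in each variable, so the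
  regularized integral is bounded uniformly in \<open>n\<close>, and Fatou removes the
  weight.\<close>

lemma fourier_integral_bound:
  assumes f: "integrable lborel f" and f2: "square_integrable f" and \<sigma>: "\<bar>\<sigma>\<bar> = 1"
  shows "square_integrable (fourier_integral \<sigma> f)"
    and "(norm (l2_of (fourier_integral \<sigma> f)))\<^sup>2 \<le> 2 * pi * (norm (l2_of f))\<^sup>2"
proof -
  let ?P = "lborel \<Otimes>\<^sub>M lborel :: (real \<times> real) measure"
  let ?F = "fourier_integral \<sigma> f"
  define C where "C = 2 * pi * (norm (l2_of f))\<^sup>2"
  have [measurable]: "f \<in> borel_measurable borel" using f by auto
  have ineq: "(\<integral>\<^sup>+\<eta>. ennreal (exp (- (\<eta> / n)\<^sup>2 / 2) * (norm (?F \<eta>))\<^sup>2) \<partial>lborel) \<le> ennreal C" if n: "0 < n" for n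
  proof -
    define K where "K p = normal_density (fst p) (1 / n) (snd p)" for p
    have K: "0 \<le> K p" for p by (simp add: K_def)
    have [measurable]: "K \<in> borel_measurable ?P" unfolding K_def[abs_def] normal_density_def by measurable
    define B where "B = (LINT x|lborel. norm (f x))"
    have int: "integrable lborel (\<lambda>\<eta>. exp (- (\<eta> / n)\<^sup>2 / 2) * (norm (?F \<eta>))\<^sup>2)"
    proof (rule Bochner_Integration.integrable_bound)
      show "integrable lborel (\<lambda>\<eta>. B\<^sup>2 * exp (- (\<eta> / n)\<^sup>2 / 2))"
        by (intro integrable_mult_right integrable_gaussian n)
      have "(norm (?F \<eta>))\<^sup>2 \<le> B\<^sup>2" for \<eta>
        unfolding B_def by (intro power_mono norm_fourier_integral_le f) auto
      then show "AE \<eta> in lborel. norm (exp (- (\<eta> / n)\<^sup>2 / 2) * (norm (?F \<eta>))\<^sup>2) \<le> norm (B\<^sup>2 * exp (- (\<eta> / n)\<^sup>2 / 2))"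
        by (intro AE_I2) (simp add: mult.commute)
    qed measurable
    have "complex_of_real (LINT \<eta>|lborel. exp (- (\<eta> / n)\<^sup>2 / 2) * (norm (?F \<eta>))\<^sup>2)
        = (LINT \<eta>|lborel. of_real (exp (- (\<eta> / n)\<^sup>2 / 2)) * (?F \<eta> * cnj (?F \<eta>)))"
      by (subst integral_complex_of_real[symmetric]) (simp add: complex_norm_square[symmetric])
    also have "\<dots> = 2 * pi * (LINT p|?P. f (fst p) * cnj (f (snd p)) * of_real (K p))"
      unfolding K_def by (rule regularized_parseval[OF f f n \<sigma>])
    finally have "norm (complex_of_real (LINT \<eta>|lborel. exp (- (\<eta> / n)\<^sup>2 / 2) * (norm (?F \<eta>))\<^sup>2))
        = 2 * pi * norm (LINT p|?P. f (fst p) * cnj (f (snd p)) * of_real (K p))"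
      by (simp add: norm_mult)
    moreover have "0 \<le> (LINT \<eta>|lborel. exp (- (\<eta> / n)\<^sup>2 / 2) * (norm (?F \<eta>))\<^sup>2)"
      by (intro integral_nonneg_AE) auto
    ultimately have eq: "(LINT \<eta>|lborel. exp (- (\<eta> / n)\<^sup>2 / 2) * (norm (?F \<eta>))\<^sup>2)
        = 2 * pi * norm (LINT p|?P. f (fst p) * cnj (f (snd p)) * of_real (K p))"
      by (simp del: of_real_mult)
    have k1: "(\<integral>\<^sup>+p. ennreal ((norm (f (fst p)))\<^sup>2) * ennreal (K p) \<partial>?P) = ennreal ((norm (l2_of f))\<^sup>2)"
    proof -
      have "(\<integral>\<^sup>+p. ennreal ((norm (f (fst p)))\<^sup>2) * ennreal (K p) \<partial>?P)
          = (\<integral>\<^sup>+x. \<integral>\<^sup>+y. ennreal ((norm (f x))\<^sup>2) * ennreal (K (x, y)) \<partial>lborel \<partial>lborel)"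
        by (subst lborel.nn_integral_fst[symmetric]) auto
      also have "\<dots> = (\<integral>\<^sup>+x. ennreal ((norm (f x))\<^sup>2) \<partial>lborel)"
        using n by (subst nn_integral_cmult) (auto simp: K_def nn_integral_normal_density)
      finally show ?thesis by (simp add: nn_integral_norm_l2_of f2)
    qed
    have k2: "(\<integral>\<^sup>+p. ennreal ((norm (f (snd p)))\<^sup>2) * ennreal (K p) \<partial>?P) = ennreal ((norm (l2_of f))\<^sup>2)"
    proof -
      have "(\<integral>\<^sup>+p. ennreal ((norm (f (snd p)))\<^sup>2) * ennreal (K p) \<partial>?P)
          = (\<integral>\<^sup>+y. \<integral>\<^sup>+x. ennreal ((norm (f y))\<^sup>2) * ennreal (K (x, y)) \<partial>lborel \<partial>lborel)"
        by (subst lborel_pair.nn_integral_snd[symmetric]) auto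
      also have "(\<lambda>y. \<integral>\<^sup>+x. ennreal ((norm (f y))\<^sup>2) * ennreal (K (x, y)) \<partial>lborel)
          = (\<lambda>y. \<integral>\<^sup>+x. ennreal ((norm (f y))\<^sup>2) * ennreal (normal_density y (1 / n) x) \<partial>lborel)"
        by (simp add: K_def normal_density_def power2_commute)
      also have "(\<integral>\<^sup>+y. \<integral>\<^sup>+x. ennreal ((norm (f y))\<^sup>2) * ennreal (normal_density y (1 / n) x) \<partial>lborel \<partial>lborel)
          = (\<integral>\<^sup>+x. ennreal ((norm (f x))\<^sup>2) \<partial>lborel)"
        using n by (subst nn_integral_cmult) (auto simp: nn_integral_normal_density)
      finally show ?thesis by (simp add: nn_integral_norm_l2_of f2)
    qed
    have "ennreal (norm (LINT p|?P. f (fst p) * cnj (f (snd p)) * of_real (K p)))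
        \<le> (\<integral>\<^sup>+p. ennreal (norm (f (fst p) * cnj (f (snd p)) * of_real (K p))) \<partial>?P)"
    proof (rule integral_norm_bound_ennreal)
      have "K p \<le> 1 / sqrt (2 * pi * (1 / n)\<^sup>2)" for p
        unfolding K_def by (rule normal_density_le) (use n in simp)
      then have "norm (complex_of_real (K p)) \<le> 1 / sqrt (2 * pi * (1 / n)\<^sup>2)" for p
        using K[of p] by simp
      then show "integrable ?P (\<lambda>p. f (fst p) * cnj (f (snd p)) * of_real (K p))"
        using f by (intro integrable_pair_mult[OF pair_sigma_finite_lborel]) auto
    qed
    \<comment> \<open>The inequality \<open>a b \<le> (a\<^sup>2 + b\<^sup>2) / 2\<close> separates
      the two variables, so that each summand only sees one marginal of the kernel.\<close>
    also have "\<dots> \<le> (\<integral>\<^sup>+p. ennreal (1/2) * (ennreal ((norm (f (fst p)))\<^sup>2) * ennreal (K p) + ennreal ((norm (f (snd p)))\<^sup>2) * ennreal (K p)) \<partial>?P)"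
    proof (rule nn_integral_mono)
      fix p
      have "norm (f (fst p)) * norm (f (snd p)) \<le> 1/2 * ((norm (f (fst p)))\<^sup>2 + (norm (f (snd p)))\<^sup>2)"
        using sum_squares_bound[of "norm (f (fst p))" "norm (f (snd p))"] by simp
      then have "norm (f (fst p)) * norm (f (snd p)) * K p \<le> 1/2 * ((norm (f (fst p)))\<^sup>2 + (norm (f (snd p)))\<^sup>2) * K p"
        by (rule mult_right_mono) (rule K)
      then have "norm (f (fst p) * cnj (f (snd p)) * of_real (K p)) \<le> 1/2 * ((norm (f (fst p)))\<^sup>2 * K p + (norm (f (snd p)))\<^sup>2 * K p)"
        using K[of p] by (simp add: norm_mult algebra_simps)
      then have "ennreal (norm (f (fst p) * cnj (f (snd p)) * of_real (K p))) \<le> ennreal (1/2 * ((norm (f (fst p)))\<^sup>2 * K p + (norm (f (snd p)))\<^sup>2 * K p))"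
        by (rule ennreal_leI)
      also have "\<dots> = ennreal (1/2) * (ennreal ((norm (f (fst p)))\<^sup>2) * ennreal (K p) + ennreal ((norm (f (snd p)))\<^sup>2) * ennreal (K p))"
        using K[of p] by (subst ennreal_mult) (auto simp: ennreal_plus ennreal_mult simp del: ennreal_half)
      finally show "ennreal (norm (f (fst p) * cnj (f (snd p)) * of_real (K p))) \<le> \<dots>" .
    qed
    also have "\<dots> = ennreal (1/2) * (ennreal ((norm (l2_of f))\<^sup>2) + ennreal ((norm (l2_of f))\<^sup>2))"
      by (subst nn_integral_cmult, measurable, subst nn_integral_add) (auto simp: k1 k2)
    also have "\<dots> = ennreal ((norm (l2_of f))\<^sup>2)"
      by (simp flip: ennreal_plus ennreal_mult del: ennreal_half)
    finally have "norm (LINT p|?P. f (fst p) * cnj (f (snd p)) * of_real (K p)) \<le> (norm (l2_of f))\<^sup>2"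
      by simp
    then have "(LINT \<eta>|lborel. exp (- (\<eta> / n)\<^sup>2 / 2) * (norm (?F \<eta>))\<^sup>2) \<le> C"
      unfolding eq C_def by simp
    then show ?thesis
      using int by (subst nn_integral_eq_integral) (auto intro: ennreal_leI)
  qed
  have "(\<integral>\<^sup>+\<eta>. ennreal ((norm (?F \<eta>))\<^sup>2) \<partial>lborel)
      = (\<integral>\<^sup>+\<eta>. liminf (\<lambda>n. ennreal (exp (- (\<eta> / real (Suc n))\<^sup>2 / 2) * (norm (?F \<eta>))\<^sup>2)) \<partial>lborel)"
  proof (intro nn_integral_cong)
    fix \<eta> :: real
    have "(\<lambda>n. \<eta> / real (Suc n)) \<longlonglongrightarrow> 0"
      by (rule LIMSEQ_Suc[OF lim_const_over_n])
    then have "(\<lambda>n. ennreal (exp (- (\<eta> / real (Suc n))\<^sup>2 / 2) * (norm (?F \<eta>))\<^sup>2)) \<longlonglongrightarrow> ennreal (exp (- 0\<^sup>2 / 2) * (norm (?F \<eta>))\<^sup>2)"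
      by (intro tendsto_intros) auto
    then show "ennreal ((norm (?F \<eta>))\<^sup>2) = liminf (\<lambda>n. ennreal (exp (- (\<eta> / real (Suc n))\<^sup>2 / 2) * (norm (?F \<eta>))\<^sup>2))"
      by (intro lim_imp_Liminf[symmetric]) auto
  qed
  also have "\<dots> \<le> liminf (\<lambda>n. \<integral>\<^sup>+\<eta>. ennreal (exp (- (\<eta> / real (Suc n))\<^sup>2 / 2) * (norm (?F \<eta>))\<^sup>2) \<partial>lborel)"
    by (intro nn_integral_liminf) measurable
  also have "\<dots> \<le> liminf (\<lambda>n::nat. ennreal C)"
    by (intro Liminf_mono always_eventually allI ineq) simp
  also have "\<dots> = ennreal C"
    by (simp add: Liminf_const)
  finally have *: "(\<integral>\<^sup>+\<eta>. ennreal ((norm (?F \<eta>))\<^sup>2) \<partial>lborel) \<le> ennreal C" .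
  show F2: "square_integrable ?F" using square_integrableI_bounded[OF _ *] by simp
  show "(norm (l2_of ?F))\<^sup>2 \<le> 2 * pi * (norm (l2_of f))\<^sup>2"
    using * by (simp add: nn_integral_norm_l2_of[OF F2] C_def)
qed

lemma integrable_mult_square_integrable:
  assumes "square_integrable f" "square_integrable g"
  shows "integrable lborel (\<lambda>x. f x * g x)"
proof -
  have [measurable]: "f \<in> borel_measurable lborel" "g \<in> borel_measurable lborel"
    using assms by (auto simp: square_integrable_def)
  have "integrable lborel (\<lambda>x. (norm (f x))\<^sup>2 + (norm (g x))\<^sup>2)"
    using assms by (simp add: square_integrable_def)
  then show ?thesis
  proof (rule Bochner_Integration.integrable_bound)
    have "norm (f x * g x) \<le> (norm (f x))\<^sup>2 + (norm (g x))\<^sup>2" for x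
      using sum_squares_bound[of "norm (f x)" "norm (g x)"] mult_nonneg_nonneg[OF norm_ge_zero norm_ge_zero, of "f x" "g x"]
      unfolding norm_mult by linarith
    then show "AE x in lborel. norm (f x * g x) \<le> norm ((norm (f x))\<^sup>2 + (norm (g x))\<^sup>2)"
      by simp
  qed simp
qed

lemma borel_measurable_cnj [measurable (raw)]:
  "f \<in> borel_measurable M \<Longrightarrow> (\<lambda>x. cnj (f x)) \<in> borel_measurable M"
  by (rule borel_measurable_continuous_on[where f=cnj]) (auto intro!: continuous_intros)

lemma square_integrable_cnj: "square_integrable f \<Longrightarrow> square_integrable (\<lambda>x. cnj (f x))"
  by (auto simp: square_integrable_def)

lemma integrable_indicator_Icc: "integrable lborel (indicator {a..b::real} :: _ \<Rightarrow> real)"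
  by (intro integrable_real_indicator) (auto simp: emeasure_lborel_Icc_eq)

lemma square_integrable_indicator:
  "square_integrable (indicator {a..b})"
proof -
  have "(\<lambda>x. (norm (indicator {a..b} x :: complex))\<^sup>2) = indicator {a..b}"
    by (auto simp: indicator_def)
  then show ?thesis by (simp add: square_integrable_def integrable_indicator_Icc)
qed

lemma integrable_indicator_complex: "integrable lborel (indicator {a..b::real} :: _ \<Rightarrow> complex)"
proof -
  have "(indicator {a..b} :: real \<Rightarrow> complex) = (\<lambda>x. of_real (indicator {a..b} x))"
    by (auto simp: indicator_def)
  then show ?thesis using integrable_of_real_complex[OF integrable_indicator_Icc] by simp
qed

text \<open>With \<open>y = x + s / (n + 1)\<close> the density becomes a fixed one and the
  indicator is eventually constant for each \<open>s\<close>. The endpoints are excluded: mass of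
  the kernel escapes the interval there.\<close>

lemma normal_average_interval:
  assumes "x \<noteq> a" "x \<noteq> b"
  shows "(\<lambda>n. LINT y|lborel. indicator {a..b} y * complex_of_real (normal_density x (1 / real (Suc n)) y)) \<longlonglongrightarrow> indicator {a..b} x"
proof -
  have eq: "(LINT y|lborel. indicator {a..b} y * complex_of_real (normal_density x (1 / real (Suc n)) y))
     = (LINT s|lborel. indicator {a..b} (x + s / real (Suc n)) * complex_of_real (std_normal_density s))" for n
  proof -
    have 1: "normal_density x (1 / real (Suc n)) (x + s / real (Suc n)) = real (Suc n) * std_normal_density s" for s
      by (simp add: normal_density_def real_sqrt_mult real_sqrt_divide power_divide del: of_nat_Suc)
    have "(LINT y|lborel. indicator {a..b} y * complex_of_real (normal_density x (1 / real (Suc n)) y))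
      = (1 / real (Suc n)) *\<^sub>R (LINT s|lborel. indicator {a..b} (x + s / real (Suc n)) * complex_of_real (normal_density x (1 / real (Suc n)) (x + s / real (Suc n))))"
      by (subst lborel_integral_real_affine[where c="1 / real (Suc n)" and t=x]) (simp_all del: of_nat_Suc)
    also have "\<dots> = (1 / real (Suc n)) *\<^sub>R (LINT s|lborel. of_real (real (Suc n)) * (indicator {a..b} (x + s / real (Suc n)) * complex_of_real (std_normal_density s)))"
      by (simp only: 1 of_real_mult mult.left_commute)
    also have "\<dots> = (LINT s|lborel. indicator {a..b} (x + s / real (Suc n)) * complex_of_real (std_normal_density s))"
      by (simp only: integral_mult_right_zero) (simp add: scaleR_conv_of_real del: of_nat_Suc)
    finally show ?thesis .
  qed
  have "(\<lambda>n. LINT s|lborel. indicator {a..b} (x + s / real (Suc n)) * complex_of_real (std_normal_density s))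
     \<longlonglongrightarrow> (LINT s|lborel. indicator {a..b} x * complex_of_real (std_normal_density s))"
  proof (rule integral_dominated_convergence)
    show "integrable lborel std_normal_density" by simp
    show "AE s in lborel. (\<lambda>n. indicator {a..b} (x + s / real (Suc n)) * complex_of_real (std_normal_density s))
        \<longlonglongrightarrow> indicator {a..b} x * complex_of_real (std_normal_density s)"
    proof (intro AE_I2 tendsto_mult tendsto_const)
      fix s :: real
      have "(\<lambda>n. x + s / real (Suc n)) \<longlonglongrightarrow> x + 0"
        by (intro tendsto_add tendsto_const LIMSEQ_Suc[OF lim_const_over_n])
      then have l: "(\<lambda>n. x + s / real (Suc n)) \<longlonglongrightarrow> x" by simp
      have "\<forall>\<^sub>F n in sequentially. indicator {a..b} (x + s / real (Suc n)) = (indicator {a..b} x :: complex)"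
      proof (cases "x \<in> {a..b}")
        case True
        then have "a < x" and "x < b" using assms by auto
        show ?thesis
          using order_tendstoD(1)[OF l \<open>a < x\<close>] order_tendstoD(2)[OF l \<open>x < b\<close>]
          by eventually_elim (use True in \<open>simp add: indicator_def\<close>)
      next
        case False
        then consider "x < a" | "b < x" by force
        then show ?thesis
        proof cases
          case 1
          with order_tendstoD(2)[OF l, of a] show ?thesis
            by (auto simp: indicator_def elim!: eventually_mono)
        next
          case 2
          with order_tendstoD(1)[OF l, of b] show ?thesis
            by (auto simp: indicator_def elim!: eventually_mono)
        qed
      qed
      then show "(\<lambda>n. indicator {a..b} (x + s / real (Suc n)) :: complex) \<longlonglongrightarrow> indicator {a..b} x"
        by (rule tendsto_eventually)
    qed
    show "AE s in lborel. norm (indicator {a..b} (x + s / real (Suc n)) * complex_of_real (std_normal_density s))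
        \<le> std_normal_density s" for n
      by (intro AE_I2) (auto simp: indicator_def)
  qed measurable
  moreover have "(LINT s|lborel. indicator {a..b} x * complex_of_real (std_normal_density s)) = indicator {a..b} x"
    by (simp only: integral_mult_right_zero integral_complex_of_real) simp
  ultimately show ?thesis unfolding eq by simp
qed

text \<open>Indicators of intervals are enough as test functions. Dominated convergence applies on
  both sides: on the left since a product of two $L^2$ functions is integrable, on the right since
  averages of an indicator are bounded by 1.\<close>

lemma parseval_interval:
  fixes f :: "real \<Rightarrow> complex"
  assumes f: "integrable lborel f" and f2: "square_integrable f" and \<sigma>: "\<bar>\<sigma>\<bar> = 1"
  shows "(LINT \<eta>|lborel. fourier_integral \<sigma> f \<eta> * cnj (fourier_integral \<sigma> (indicator {a..b}) \<eta>))
    = 2 * pi * (LINT x|lborel. f x * indicator {a..b} x)"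
proof -
  let ?I = "indicator {a..b} :: real \<Rightarrow> complex"
  let ?F = "\<lambda>\<eta>. fourier_integral \<sigma> f \<eta> * cnj (fourier_integral \<sigma> ?I \<eta>)"
  have [measurable]: "f \<in> borel_measurable borel" using f by auto
  have F: "integrable lborel ?F"
    by (intro integrable_mult_square_integrable square_integrable_cnj fourier_integral_bound f f2 \<sigma>
      square_integrable_indicator integrable_indicator_complex)
  have A: "(\<lambda>n. LINT \<eta>|lborel. of_real (exp (- (\<eta> / real (Suc n))\<^sup>2 / 2)) * ?F \<eta>) \<longlonglongrightarrow> (LINT \<eta>|lborel. ?F \<eta>)"
  proof (rule integral_dominated_convergence)
    show "integrable lborel (\<lambda>\<eta>. norm (?F \<eta>))" using F by (rule integrable_norm)
    show "AE \<eta> in lborel. (\<lambda>n. of_real (exp (- (\<eta> / real (Suc n))\<^sup>2 / 2)) * ?F \<eta>) \<longlonglongrightarrow> ?F \<eta>"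
    proof (rule AE_I2)
      fix \<eta> :: real
      have "(\<lambda>n. \<eta> / real (Suc n)) \<longlonglongrightarrow> 0"
        by (rule LIMSEQ_Suc[OF lim_const_over_n])
      then have "(\<lambda>n. of_real (exp (- (\<eta> / real (Suc n))\<^sup>2 / 2)) * ?F \<eta>) \<longlonglongrightarrow> of_real (exp (- 0\<^sup>2 / 2)) * ?F \<eta>"
        by (intro tendsto_intros) auto
      then show "(\<lambda>n. of_real (exp (- (\<eta> / real (Suc n))\<^sup>2 / 2)) * ?F \<eta>) \<longlonglongrightarrow> ?F \<eta>" by simp
    qed
    show "AE \<eta> in lborel. norm (of_real (exp (- (\<eta> / real (Suc n))\<^sup>2 / 2)) * ?F \<eta>) \<le> norm (?F \<eta>)" for n
      by (intro AE_I2) (simp add: norm_mult mult_left_le_one_le del: of_nat_Suc)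
  qed measurable
  have eq: "(LINT \<eta>|lborel. of_real (exp (- (\<eta> / real (Suc n))\<^sup>2 / 2)) * ?F \<eta>)
     = 2 * pi * (LINT x|lborel. f x * (LINT y|lborel. ?I y * complex_of_real (normal_density x (1 / real (Suc n)) y)))" for n
  proof -
    let ?n = "real (Suc n)"
    have [measurable]: "(\<lambda>p. normal_density (fst p) (1 / ?n) (snd p)) \<in> borel_measurable (lborel \<Otimes>\<^sub>M lborel)"
      unfolding normal_density_def by measurable
    have cI: "cnj (?I y) = ?I y" for y by (simp add: indicator_def)
    have "norm (complex_of_real (normal_density (fst p) (1 / ?n) (snd p))) \<le> 1 / sqrt (2 * pi * (1 / ?n)\<^sup>2)" for p
      using normal_density_le[of "1 / ?n" "fst p" "snd p"] by simp
    note ip = integral_pair_mult(1)[OF pair_sigma_finite_lborel f integrable_indicator_complex _ this]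
    have "(LINT \<eta>|lborel. of_real (exp (- (\<eta> / ?n)\<^sup>2 / 2)) * ?F \<eta>)
        = 2 * pi * (LINT p|(lborel \<Otimes>\<^sub>M lborel). f (fst p) * cnj (?I (snd p)) * of_real (normal_density (fst p) (1 / ?n) (snd p)))"
      by (rule regularized_parseval[OF f integrable_indicator_complex _ \<sigma>]) simp
    also have "\<dots> = 2 * pi * (LINT x|lborel. f x * (LINT y|lborel. ?I y * complex_of_real (normal_density x (1 / ?n) y)))"
      unfolding cI by (subst ip) (auto simp del: of_nat_Suc)
    finally show ?thesis .
  qed
  have B: "(\<lambda>n. 2 * pi * (LINT x|lborel. f x * (LINT y|lborel. ?I y * complex_of_real (normal_density x (1 / real (Suc n)) y))))
     \<longlonglongrightarrow> 2 * pi * (LINT x|lborel. f x * ?I x)"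
  proof (intro tendsto_mult tendsto_const integral_dominated_convergence)
    show "integrable lborel (\<lambda>x. norm (f x))" using f by (rule integrable_norm)
    have "AE x in lborel. x \<noteq> a" "AE x in lborel. x \<noteq> b" by (auto intro: AE_lborel_singleton)
    then show "AE x in lborel. (\<lambda>n. f x * (LINT y|lborel. ?I y * complex_of_real (normal_density x (1 / real (Suc n)) y))) \<longlonglongrightarrow> f x * ?I x"
      by eventually_elim (intro tendsto_mult tendsto_const normal_average_interval)
    fix n
    have "norm (LINT y|lborel. ?I y * complex_of_real (normal_density x (1 / real (Suc n)) y)) \<le> (LINT y|lborel. normal_density x (1 / real (Suc n)) y)" for x
    proof (rule Bochner_Integration.integral_norm_bound_integral)
      show int: "integrable lborel (normal_density x (1 / real (Suc n)))" by simp
      show le: "norm (?I y * complex_of_real (normal_density x (1 / real (Suc n)) y)) \<le> normal_density x (1 / real (Suc n)) y" for y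
        by (auto simp: indicator_def)
      show "integrable lborel (\<lambda>y. ?I y * complex_of_real (normal_density x (1 / real (Suc n)) y))"
        by (rule Bochner_Integration.integrable_bound[OF int]) (use le in auto)
    qed
    then show "AE x in lborel. norm (f x * (LINT y|lborel. ?I y * complex_of_real (normal_density x (1 / real (Suc n)) y))) \<le> norm (f x)"
      by (intro AE_I2) (simp add: norm_mult mult_left_le)
  qed (auto simp: normal_density_def)
  show ?thesis
    by (rule LIMSEQ_unique[OF A[unfolded eq] B])
qed

subsection \<open>The Fourier transform on $L^2$\<close>

text \<open>The sets over which \<open>f\<close> integrates to 0 contain the intervals and are
  closed under complements and disjoint countable unions, hence include all Borel sets.\<close>

lemma AE_zero_if_interval_integrals_zero:
  fixes f :: "real \<Rightarrow> complex"
  assumes f: "integrable lborel f" and z: "\<And>a b. a \<le> b \<Longrightarrow> (LINT x|lborel. f x * indicator {a..b} x) = 0"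
  shows "AE x in lborel. f x = 0"
proof (rule sigma_finite_measure.density_zero[OF lborel.sigma_finite_measure_axioms f])
  have [measurable]: "f \<in> borel_measurable borel" using f by auto
  have si: "set_integrable lborel A f" if "A \<in> sets borel" for A
    unfolding set_integrable_def using integrable_mult_indicator[of A lborel f] that f by simp
  have z': "set_lebesgue_integral lborel {a..b} f = 0" if "a \<le> b" for a b
  proof -
    have "indicat_real {a..b} x *\<^sub>R f x = f x * indicator {a..b} x" for x
      by (simp add: indicator_def)
    then show ?thesis using z[OF that] by (simp add: set_lebesgue_integral_def)
  qed
  \<comment> \<open>The complement step needs the integral over the whole line, which is the limit
    of the integrals over \<open>{- n..n}\<close>.\<close>
  have U: "set_lebesgue_integral lborel UNIV f = 0"
  proof -
    have "(\<lambda>n. LINT x|lborel. indicat_real {- real n..real n} x *\<^sub>R f x) \<longlonglongrightarrow> (LINT x|lborel. f x)"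
    proof (rule integral_dominated_convergence[where w="\<lambda>x. norm (f x)"])
      show "integrable lborel (\<lambda>x. norm (f x))" using f by (rule integrable_norm)
      show "AE x in lborel. (\<lambda>n. indicat_real {- real n..real n} x *\<^sub>R f x) \<longlonglongrightarrow> f x"
      proof (rule AE_I2, rule tendsto_eventually)
        fix x
        show "\<forall>\<^sub>F n in sequentially. indicat_real {- real n..real n} x *\<^sub>R f x = f x"
          using eventually_ge_at_top[of "nat \<lceil>\<bar>x\<bar>\<rceil>"] by eventually_elim (auto simp: indicator_def nat_le_iff ceiling_le_iff abs_le_iff)
      qed
    qed (auto simp: indicator_def)
    moreover have "(LINT x|lborel. indicat_real {- real n..real n} x *\<^sub>R f x) = 0" for n
      using z'[of "- real n" "real n"] by (simp add: set_lebesgue_integral_def)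
    ultimately show ?thesis by (simp add: set_lebesgue_integral_def LIMSEQ_const_iff)
  qed
  fix A :: "real set" assume "A \<in> sets lborel"
  then have "A \<in> sets borel" by simp
  then show "set_lebesgue_integral lborel A f = 0"
  proof (induction A rule: borel_set_induct)
    case empty
    show ?case by (simp add: set_lebesgue_integral_def)
  next
    case (interval a b)
    then show ?case by (rule z')
  next
    case (compl A)
    have "set_lebesgue_integral lborel (A \<union> - A) f = set_lebesgue_integral lborel A f + set_lebesgue_integral lborel (- A) f"
      using compl(1) by (intro set_integral_Un si) auto
    then show ?case using compl U by (simp add: Compl_partition)
  next
    case (union A)
    have "set_lebesgue_integral lborel (\<Union>i. A i) f = (\<Sum>i. set_lebesgue_integral lborel (A i) f)"
      using union(1,2) by (intro lebesgue_integral_countable_add si) (auto simp: disjoint_family_on_def)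
    then show ?case using union(3) by simp
  qed
qed

definition truncate :: "nat \<Rightarrow> (real \<Rightarrow> complex) \<Rightarrow> real \<Rightarrow> complex" where
  "truncate n f x = indicator {- real n..real n} x * f x"

text \<open>The common domain on which the Fourier integral converges pointwise and also lands in
  $L^2$; the truncations make it dense.\<close>

definition integrable_L12 :: "(real \<Rightarrow> complex) \<Rightarrow> bool" where
  "integrable_L12 f \<longleftrightarrow> integrable lborel f \<and> square_integrable f"

lemma square_integrable_truncate:
  assumes "square_integrable f" shows "square_integrable (truncate n f)"
  using assms unfolding truncate_def[abs_def]
  by (intro square_integrable_bound[OF assms, where C=1]) (auto simp: indicator_def square_integrable_def)

lemma integrable_L12_truncate:
  assumes "square_integrable f" shows "integrable_L12 (truncate n f)"
  unfolding integrable_L12_def using assms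
  by (auto intro: square_integrable_truncate)
     (simp add: truncate_def[abs_def] integrable_mult_square_integrable square_integrable_indicator)

lemma eventually_truncate_eq: "\<forall>\<^sub>F n in sequentially. truncate n f x = f x"
  using eventually_ge_at_top[of "nat \<lceil>\<bar>x\<bar>\<rceil>"]
  by eventually_elim (auto simp: truncate_def indicator_def nat_le_iff ceiling_le_iff abs_le_iff)

lemma tendsto_norm_l2_zeroI:
  assumes f: "\<And>n. square_integrable (f n)" and g: "square_integrable g"
    and b: "\<And>n x. norm (f n x) \<le> norm (g x)"
    and lim: "AE x in lborel. (\<lambda>n. f n x) \<longlonglongrightarrow> 0"
  shows "(\<lambda>n. norm (l2_of (f n))) \<longlonglongrightarrow> 0"
proof -
  have [measurable]: "f n \<in> borel_measurable borel" for n
    using f[of n] by (simp add: square_integrable_def)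
  have "(\<lambda>n. LINT x|lborel. (norm (f n x))\<^sup>2) \<longlonglongrightarrow> integral\<^sup>L (lborel :: real measure) (\<lambda>_. 0::real)"
  proof (rule integral_dominated_convergence[where w="\<lambda>x. (norm (g x))\<^sup>2" and f="\<lambda>_. 0::real"])
    show "integrable lborel (\<lambda>x. (norm (g x))\<^sup>2)" using g by (simp add: square_integrable_def)
    show "AE x in lborel. (\<lambda>n. (norm (f n x))\<^sup>2) \<longlonglongrightarrow> 0"
      using lim by eventually_elim (auto intro!: tendsto_eq_intros)
    show "AE x in lborel. norm ((norm (f n x))\<^sup>2) \<le> (norm (g x))\<^sup>2" for n
      using b by (auto intro!: power_mono)
  qed measurable
  then have "(\<lambda>n. (norm (l2_of (f n)))\<^sup>2) \<longlonglongrightarrow> 0" by (simp add: norm_l2_of f)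
  then have "(\<lambda>n. sqrt ((norm (l2_of (f n)))\<^sup>2)) \<longlonglongrightarrow> sqrt 0" by (rule tendsto_real_sqrt)
  then show ?thesis by simp
qed

lemma truncate_tendsto:
  assumes "square_integrable f" shows "(\<lambda>n. l2_of (truncate n f)) \<longlonglongrightarrow> l2_of f"
proof -
  have "(\<lambda>n. norm (l2_of (\<lambda>x. truncate n f x - f x))) \<longlonglongrightarrow> 0"
  proof (rule tendsto_norm_l2_zeroI)
    show "square_integrable (\<lambda>x. truncate n f x - f x)" for n
      by (intro square_integrable_diff square_integrable_truncate assms)
    show "AE x in lborel. (\<lambda>n. truncate n f x - f x) \<longlonglongrightarrow> 0"
    proof (rule AE_I2)
      fix x
      show "(\<lambda>n. truncate n f x - f x) \<longlonglongrightarrow> 0"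
        by (rule tendsto_eventually, rule eventually_mono[OF eventually_truncate_eq[of f x]]) simp
    qed
    show "norm (truncate n f x - f x) \<le> norm (f x)" for n x
      by (simp add: truncate_def indicator_def)
  qed fact
  then show ?thesis
    by (simp add: l2_of_diff assms square_integrable_truncate tendsto_norm_zero_iff LIM_zero_iff)
qed

lemma fourier_integral_add:
  "integrable lborel f \<Longrightarrow> integrable lborel g \<Longrightarrow>
    fourier_integral \<sigma> (\<lambda>x. f x + g x) \<eta> = fourier_integral \<sigma> f \<eta> + fourier_integral \<sigma> g \<eta>"
  unfolding fourier_integral_def by (simp add: distrib_right integrable_mult_cis)

lemma fourier_integral_diff:
  "integrable lborel f \<Longrightarrow> integrable lborel g \<Longrightarrow>
    fourier_integral \<sigma> (\<lambda>x. f x - g x) \<eta> = fourier_integral \<sigma> f \<eta> - fourier_integral \<sigma> g \<eta>"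
  unfolding fourier_integral_def by (simp add: left_diff_distrib integrable_mult_cis)

lemma fourier_integral_scale:
  "fourier_integral \<sigma> (\<lambda>x. a * f x) \<eta> = a * fourier_integral \<sigma> f \<eta>"
  unfolding fourier_integral_def by (simp add: mult.assoc)

lemma square_integrable_fourier:
  "integrable_L12 f \<Longrightarrow> \<bar>\<sigma>\<bar> = 1 \<Longrightarrow> square_integrable (fourier_integral \<sigma> f)"
  unfolding integrable_L12_def by (blast intro: fourier_integral_bound)

lemma norm_fourier_diff_le:
  assumes "integrable_L12 f" "integrable_L12 g" "\<bar>\<sigma>\<bar> = 1"
  shows "norm (l2_of (fourier_integral \<sigma> f) - l2_of (fourier_integral \<sigma> g)) \<le> sqrt (2 * pi) * norm (l2_of f - l2_of g)"
proof -
  let ?h = "\<lambda>x. f x - g x"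
  have h: "integrable lborel ?h" "square_integrable ?h"
    using assms by (auto simp: integrable_L12_def square_integrable_diff)
  have "l2_of (fourier_integral \<sigma> f) - l2_of (fourier_integral \<sigma> g) = l2_of (fourier_integral \<sigma> ?h)"
    using assms by (simp add: l2_of_diff[symmetric] square_integrable_fourier)
      (simp add: fourier_integral_diff[symmetric] integrable_L12_def)
  moreover have "l2_of f - l2_of g = l2_of ?h"
    using assms by (simp add: l2_of_diff integrable_L12_def)
  moreover have "(norm (l2_of (fourier_integral \<sigma> ?h)))\<^sup>2 \<le> (sqrt (2 * pi) * norm (l2_of ?h))\<^sup>2"
    using fourier_integral_bound(2)[OF h assms(3)] by (simp add: power_mult_distrib)
  ultimately show ?thesis
    using power2_le_imp_le[of "norm (l2_of (fourier_integral \<sigma> ?h))" "sqrt (2 * pi) * norm (l2_of ?h)"] by simp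
qed

definition fourier_op :: "real \<Rightarrow> l2 \<Rightarrow> l2" where
  "fourier_op \<sigma> f = lim (\<lambda>n. l2_of (fourier_integral \<sigma> (truncate n (rep_l2 f))))"

lemma fourier_l2_eq: "fourier_l2 = fourier_op (-1)"
proof -
  have "(LINT x:{- real n..real n}|lborel. exp (- (\<i> * of_real \<eta> * of_real x)) * rep_l2 f x)
      = fourier_integral (-1) (truncate n (rep_l2 f)) \<eta>" for n f \<eta>
    unfolding set_lebesgue_integral_def fourier_integral_def truncate_def
    by (intro Bochner_Integration.integral_cong)
      (auto simp: cis_conv_exp indicator_def mult_ac)
  then show ?thesis
    unfolding fourier_l2_def fourier_op_def by (intro ext) simp
qed

lemma fourier_op_tendsto_truncate:
  assumes \<sigma>: "\<bar>\<sigma>\<bar> = 1"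
  shows "(\<lambda>n. l2_of (fourier_integral \<sigma> (truncate n (rep_l2 f)))) \<longlonglongrightarrow> fourier_op \<sigma> f"
proof -
  have c: "Cauchy (\<lambda>n. l2_of (truncate n (rep_l2 f)))"
    using truncate_tendsto[of "rep_l2 f"] by (intro LIMSEQ_imp_Cauchy) auto
  have "Cauchy (\<lambda>n. l2_of (fourier_integral \<sigma> (truncate n (rep_l2 f))))"
  proof (rule CauchyI)
    fix e :: real assume "0 < e"
    then have "0 < e / sqrt (2 * pi)" by simp
    from CauchyD[OF c this] obtain M where
      M: "\<And>m n. m \<ge> M \<Longrightarrow> n \<ge> M \<Longrightarrow> norm (l2_of (truncate m (rep_l2 f)) - l2_of (truncate n (rep_l2 f))) < e / sqrt (2 * pi)"
      by blast
    have "norm (l2_of (fourier_integral \<sigma> (truncate m (rep_l2 f))) - l2_of (fourier_integral \<sigma> (truncate n (rep_l2 f)))) < e"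
      if "m \<ge> M" "n \<ge> M" for m n
    proof -
      have "norm (l2_of (fourier_integral \<sigma> (truncate m (rep_l2 f))) - l2_of (fourier_integral \<sigma> (truncate n (rep_l2 f))))
        \<le> sqrt (2 * pi) * norm (l2_of (truncate m (rep_l2 f)) - l2_of (truncate n (rep_l2 f)))"
        by (intro norm_fourier_diff_le integrable_L12_truncate \<sigma>) auto
      also have "\<dots> < sqrt (2 * pi) * (e / sqrt (2 * pi))"
        by (intro mult_strict_left_mono M that) simp
      finally show ?thesis by simp
    qed
    then show "\<exists>M. \<forall>m\<ge>M. \<forall>n\<ge>M. norm (l2_of (fourier_integral \<sigma> (truncate m (rep_l2 f))) - l2_of (fourier_integral \<sigma> (truncate n (rep_l2 f)))) < e"
      by blast
  qed
  then show ?thesis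
    unfolding fourier_op_def by (simp add: Cauchy_convergent_iff convergent_LIMSEQ_iff)
qed

text \<open>The limit does not depend on the approximating sequence. This freedom is needed for
  linearity, because a chosen representative of \<open>f + g\<close> agrees with the sum of the
  chosen representatives only almost everywhere.\<close>

lemma fourier_op_tendsto:
  assumes \<sigma>: "\<bar>\<sigma>\<bar> = 1" and h: "\<And>n. integrable_L12 (h n)" and lim: "(\<lambda>n. l2_of (h n)) \<longlonglongrightarrow> f"
  shows "(\<lambda>n. l2_of (fourier_integral \<sigma> (h n))) \<longlonglongrightarrow> fourier_op \<sigma> f"
proof -
  let ?t = "\<lambda>n. truncate n (rep_l2 f)"
  have "(\<lambda>n. l2_of (h n) - l2_of (?t n)) \<longlonglongrightarrow> f - f"
    using truncate_tendsto[of "rep_l2 f"] by (intro tendsto_diff lim) simp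
  then have "(\<lambda>n. sqrt (2 * pi) * norm (l2_of (h n) - l2_of (?t n))) \<longlonglongrightarrow> sqrt (2 * pi) * norm (f - f)"
    by (intro tendsto_mult tendsto_const tendsto_norm)
  then have "(\<lambda>n. sqrt (2 * pi) * norm (l2_of (h n) - l2_of (?t n))) \<longlonglongrightarrow> 0" by simp
  then have "(\<lambda>n. l2_of (fourier_integral \<sigma> (h n)) - l2_of (fourier_integral \<sigma> (?t n))) \<longlonglongrightarrow> 0"
    by (rule Lim_null_comparison[rotated]) (intro always_eventually allI norm_fourier_diff_le h integrable_L12_truncate \<sigma>, simp)
  from tendsto_add[OF this fourier_op_tendsto_truncate[OF \<sigma>, of f]] show ?thesis by simp
qed

lemma fourier_op_l2_of:
  assumes "\<bar>\<sigma>\<bar> = 1" "integrable_L12 f"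
  shows "fourier_op \<sigma> (l2_of f) = l2_of (fourier_integral \<sigma> f)"
  using fourier_op_tendsto[OF assms(1), of "\<lambda>_. f" "l2_of f"] assms(2) by (simp add: LIMSEQ_const_iff)

lemma norm_fourier_op_le:
  assumes \<sigma>: "\<bar>\<sigma>\<bar> = 1"
  shows "norm (fourier_op \<sigma> f) \<le> sqrt (2 * pi) * norm f"
proof (rule LIMSEQ_le)
  show "(\<lambda>n. norm (l2_of (fourier_integral \<sigma> (truncate n (rep_l2 f))))) \<longlonglongrightarrow> norm (fourier_op \<sigma> f)"
    by (intro tendsto_norm fourier_op_tendsto_truncate \<sigma>)
  show "(\<lambda>n. sqrt (2 * pi) * norm (l2_of (truncate n (rep_l2 f)))) \<longlonglongrightarrow> sqrt (2 * pi) * norm f"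
    using truncate_tendsto[of "rep_l2 f"] by (intro tendsto_intros) simp
  have "norm (l2_of (fourier_integral \<sigma> h)) \<le> sqrt (2 * pi) * norm (l2_of h)" if "integrable_L12 h" for h
    using norm_fourier_diff_le[OF that _ \<sigma>, of "\<lambda>_. 0"]
    by (simp add: integrable_L12_def square_integrable_zero l2_of_zero fourier_integral_def[abs_def])
  then show "\<exists>N. \<forall>n\<ge>N. norm (l2_of (fourier_integral \<sigma> (truncate n (rep_l2 f)))) \<le> sqrt (2 * pi) * norm (l2_of (truncate n (rep_l2 f)))"
    by (simp add: integrable_L12_truncate)
qed

lemma tendsto_scaleC_l2:
  assumes "X \<longlonglongrightarrow> f" shows "(\<lambda>n. scaleC_l2 a (X n)) \<longlonglongrightarrow> scaleC_l2 a f"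
proof -
  have "(\<lambda>n. norm (scaleC_l2 a (X n - f))) \<longlonglongrightarrow> norm a * norm (f - f)"
    unfolding norm_scaleC_l2 by (intro tendsto_intros assms)
  then show ?thesis
    by (simp add: l2.scale_right_diff_distrib tendsto_norm_zero_iff LIM_zero_iff)
qed

lemma fourier_op_add:
  assumes \<sigma>: "\<bar>\<sigma>\<bar> = 1"
  shows "fourier_op \<sigma> (f + g) = fourier_op \<sigma> f + fourier_op \<sigma> g"
proof -
  let ?f = "\<lambda>n. truncate n (rep_l2 f)" and ?g = "\<lambda>n. truncate n (rep_l2 g)"
  have L: "integrable_L12 (?f n)" "integrable_L12 (?g n)" for n by (auto intro: integrable_L12_truncate)
  have "(\<lambda>n. l2_of (?f n) + l2_of (?g n)) \<longlonglongrightarrow> f + g"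
    using truncate_tendsto[of "rep_l2 f"] truncate_tendsto[of "rep_l2 g"] by (intro tendsto_intros) auto
  then have "(\<lambda>n. l2_of (\<lambda>x. ?f n x + ?g n x)) \<longlonglongrightarrow> f + g"
    using L by (simp add: l2_of_add integrable_L12_def)
  then have "(\<lambda>n. l2_of (fourier_integral \<sigma> (\<lambda>x. ?f n x + ?g n x))) \<longlonglongrightarrow> fourier_op \<sigma> (f + g)"
    using L by (intro fourier_op_tendsto \<sigma>) (auto simp: integrable_L12_def square_integrable_add)
  moreover have "l2_of (fourier_integral \<sigma> (\<lambda>x. ?f n x + ?g n x)) = l2_of (fourier_integral \<sigma> (?f n)) + l2_of (fourier_integral \<sigma> (?g n))" for n
    using L[of n] \<sigma> by (subst l2_of_add[symmetric]) (auto simp: square_integrable_fourier integrable_L12_def intro!: arg_cong[where f=l2_of] fourier_integral_add)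
  ultimately have "(\<lambda>n. l2_of (fourier_integral \<sigma> (?f n)) + l2_of (fourier_integral \<sigma> (?g n))) \<longlonglongrightarrow> fourier_op \<sigma> (f + g)"
    by simp
  moreover have "(\<lambda>n. l2_of (fourier_integral \<sigma> (?f n)) + l2_of (fourier_integral \<sigma> (?g n))) \<longlonglongrightarrow> fourier_op \<sigma> f + fourier_op \<sigma> g"
    by (intro tendsto_add fourier_op_tendsto_truncate \<sigma>)
  ultimately show ?thesis by (rule LIMSEQ_unique)
qed

lemma fourier_op_scale:
  assumes \<sigma>: "\<bar>\<sigma>\<bar> = 1"
  shows "fourier_op \<sigma> (scaleC_l2 a f) = scaleC_l2 a (fourier_op \<sigma> f)"
proof -
  let ?f = "\<lambda>n. truncate n (rep_l2 f)"
  have L: "integrable_L12 (?f n)" for n by (auto intro: integrable_L12_truncate)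
  have "(\<lambda>n. scaleC_l2 a (l2_of (?f n))) \<longlonglongrightarrow> scaleC_l2 a f"
    using truncate_tendsto[of "rep_l2 f"] by (intro tendsto_scaleC_l2) auto
  then have "(\<lambda>n. l2_of (\<lambda>x. a * ?f n x)) \<longlonglongrightarrow> scaleC_l2 a f"
    using L by (simp add: l2_of_scale integrable_L12_def)
  then have "(\<lambda>n. l2_of (fourier_integral \<sigma> (\<lambda>x. a * ?f n x))) \<longlonglongrightarrow> fourier_op \<sigma> (scaleC_l2 a f)"
    using L by (intro fourier_op_tendsto \<sigma>) (auto simp: integrable_L12_def square_integrable_scale)
  moreover have "l2_of (fourier_integral \<sigma> (\<lambda>x. a * ?f n x)) = scaleC_l2 a (l2_of (fourier_integral \<sigma> (?f n)))" for n
    using L[of n] \<sigma> by (subst l2_of_scale[symmetric]) (auto simp: square_integrable_fourier intro!: arg_cong[where f=l2_of] fourier_integral_scale)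
  ultimately have "(\<lambda>n. scaleC_l2 a (l2_of (fourier_integral \<sigma> (?f n)))) \<longlonglongrightarrow> fourier_op \<sigma> (scaleC_l2 a f)"
    by simp
  moreover have "(\<lambda>n. scaleC_l2 a (l2_of (fourier_integral \<sigma> (?f n)))) \<longlonglongrightarrow> scaleC_l2 a (fourier_op \<sigma> f)"
    by (intro tendsto_scaleC_l2 fourier_op_tendsto_truncate \<sigma>)
  ultimately show ?thesis by (rule LIMSEQ_unique)
qed

section \<open>Adjoint, inversion formula and Plancherel identity\<close>

lemma inner_l2_of_Re:
  assumes "square_integrable f" "square_integrable g"
  shows "inner (l2_of f) (l2_of g) = Re (LINT x|lborel. f x * cnj (g x))"
proof -
  have "inner (l2_of f) (l2_of g) = (LINT x|lborel. Re (f x * cnj (g x)))"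
    using assms by (simp add: inner_l2_of inner_complex_def)
  also have "\<dots> = Re (LINT x|lborel. f x * cnj (g x))"
    using assms by (intro integral_Re integrable_mult_square_integrable square_integrable_cnj)
  finally show ?thesis .
qed

text \<open>Fubini, with conjugation reversing the sign in the exponent; hence the transforms for
  \<open>\<sigma>\<close> and \<open>- \<sigma>\<close> are adjoint to each other.\<close>

lemma fourier_integral_adjoint:
  assumes f: "integrable lborel f" and g: "integrable lborel g"
  shows "(LINT \<eta>|lborel. fourier_integral \<sigma> f \<eta> * cnj (g \<eta>)) = (LINT x|lborel. f x * cnj (fourier_integral (- \<sigma>) g x))"
proof -
  have gc: "integrable lborel (\<lambda>y. cnj (g y))" using g by simp
  let ?h = "\<lambda>p::real \<times> real. cis (\<sigma> * snd p * fst p)"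
  have "cnj (fourier_integral (- \<sigma>) g x) = (LINT y|lborel. cnj (g y) * ?h (x, y))" for x
    unfolding fourier_integral_def by (simp add: cis_cnj mult_ac flip: Bochner_Integration.integral_cnj)
  moreover have "(LINT \<eta>|lborel. fourier_integral \<sigma> f \<eta> * cnj (g \<eta>)) = (LINT \<eta>|lborel. cnj (g \<eta>) * (LINT x|lborel. f x * ?h (x, \<eta>)))"
    unfolding fourier_integral_def by (simp add: mult.commute)
  ultimately show ?thesis
    using integral_pair_mult[OF pair_sigma_finite_lborel f gc, where h="?h" and B=1] by simp
qed

lemma fourier_op_adjoint:
  assumes \<sigma>: "\<bar>\<sigma>\<bar> = 1"
  shows "inner (fourier_op \<sigma> f) g = inner f (fourier_op (- \<sigma>) g)"
proof -
  let ?f = "\<lambda>n. truncate n (rep_l2 f)" and ?g = "\<lambda>n. truncate n (rep_l2 g)"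
  have L: "integrable_L12 (?f n)" "integrable_L12 (?g n)" for n by (auto intro: integrable_L12_truncate)
  have \<sigma>': "\<bar>- \<sigma>\<bar> = 1" using \<sigma> by simp
  have lim: "(\<lambda>n. l2_of (?f n)) \<longlonglongrightarrow> f" "(\<lambda>n. l2_of (?g n)) \<longlonglongrightarrow> g"
    using truncate_tendsto[of "rep_l2 f"] truncate_tendsto[of "rep_l2 g"] by auto
  have "(\<lambda>n. inner (l2_of (fourier_integral \<sigma> (?f n))) (l2_of (?g n))) \<longlonglongrightarrow> inner (fourier_op \<sigma> f) g"
    by (intro tendsto_inner fourier_op_tendsto_truncate \<sigma> lim)
  moreover have "(\<lambda>n. inner (l2_of (?f n)) (l2_of (fourier_integral (- \<sigma>) (?g n)))) \<longlonglongrightarrow> inner f (fourier_op (- \<sigma>) g)"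
    by (intro tendsto_inner fourier_op_tendsto_truncate \<sigma>' lim)
  moreover have "inner (l2_of (fourier_integral \<sigma> (?f n))) (l2_of (?g n)) = inner (l2_of (?f n)) (l2_of (fourier_integral (- \<sigma>) (?g n)))" for n
    using L[of n] square_integrable_fourier[OF L(1) \<sigma>, of n] square_integrable_fourier[OF L(2) \<sigma>', of n]
    by (simp add: inner_l2_of_Re integrable_L12_def fourier_integral_adjoint)
  ultimately show ?thesis by (simp add: LIMSEQ_unique)
qed

lemma bounded_linear_fourier_op:
  assumes \<sigma>: "\<bar>\<sigma>\<bar> = 1" shows "bounded_linear (fourier_op \<sigma>)"
proof (rule bounded_linear_intro[where K="sqrt (2 * pi)"])
  show "norm (fourier_op \<sigma> x) \<le> norm x * sqrt (2 * pi)" for x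
    using norm_fourier_op_le[OF \<sigma>, of x] by (simp only: mult.commute)
qed (simp_all add: fourier_op_add fourier_op_scale \<sigma> scaleR_l2_conv)

lemma l2_eq_zero_if_orthogonal_intervals:
  assumes "\<And>a b z. a \<le> b \<Longrightarrow> inner h (scaleC_l2 z (l2_of (indicator {a..b}))) = 0"
  shows "h = 0"
proof -
  have z: "(LINT x|lborel. rep_l2 h x * indicator {a..b} x) = 0" if "a \<le> b" for a b
  proof -
    \<comment> \<open>The inner product of \<open>l2\<close> only sees real parts. Testing with the
      multiple \<open>w\<close> of the indicator, \<open>w\<close> being the integral in question,
      turns that real part into \<open>(norm w)\<^sup>2\<close>.\<close>
    define w where "w = (LINT x|lborel. rep_l2 h x * indicator {a..b} x)"
    have "inner (l2_of (rep_l2 h)) (l2_of (\<lambda>x. w * indicator {a..b} x))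
        = Re (LINT x|lborel. rep_l2 h x * cnj (w * indicator {a..b} x))"
      by (intro inner_l2_of_Re square_integrable_scale square_integrable_indicator square_integrable_rep)
    also have "(LINT x|lborel. rep_l2 h x * cnj (w * indicator {a..b} x)) = (LINT x|lborel. cnj w * (rep_l2 h x * indicator {a..b} x))"
      by (intro Bochner_Integration.integral_cong) (auto simp: indicator_def)
    also have "\<dots> = cnj w * w" by (simp add: w_def)
    also have "Re \<dots> = (norm w)\<^sup>2" by (simp only: cmod_power2) (simp add: power2_eq_square)
    finally show ?thesis
      using assms[OF that, of w] by (simp add: l2_of_scale square_integrable_indicator w_def)
  qed
  have "AE x in lborel. truncate n (rep_l2 h) x = 0" for n
  proof (rule AE_zero_if_interval_integrals_zero)
    show "integrable lborel (truncate n (rep_l2 h))"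
      using integrable_L12_truncate[of "rep_l2 h" n] by (simp add: integrable_L12_def)
    fix a b :: real assume "a \<le> b"
    let ?a = "max a (- real n)" and ?b = "min b (real n)"
    have "truncate n (rep_l2 h) x * indicator {a..b} x = rep_l2 h x * indicator {?a..?b} x" for x
      by (auto simp: truncate_def indicator_def)
    moreover have "(LINT x|lborel. rep_l2 h x * indicator {?a..?b} x) = 0"
    proof (cases "?a \<le> ?b")
      case True then show ?thesis by (rule z)
    next
      case False
      then have e: "{?a..?b} = {}" by (simp only: atLeastatMost_empty_iff not_False_eq_True)
      show ?thesis unfolding e by simp
    qed
    ultimately show "(LINT x|lborel. truncate n (rep_l2 h) x * indicator {a..b} x) = 0" by simp
  qed
  then have "AE x in lborel. \<forall>n. truncate n (rep_l2 h) x = 0" by (simp add: AE_all_countable)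
  then have "AE x in lborel. rep_l2 h x = 0"
  proof eventually_elim
    case (elim x)
    then show ?case using eventually_happens'[OF _ eventually_truncate_eq[of "rep_l2 h" x]] by auto
  qed
  then have "l2_of (rep_l2 h) = l2_of (\<lambda>_. 0)"
    by (subst l2_of_eq_iff) (auto simp: square_integrable_zero)
  then show ?thesis by (simp add: l2_of_zero)
qed

text \<open>Paired with an interval, the double transform becomes by adjointness the pairing of two
  transforms, which \<open>parseval_interval\<close> evaluates. The general case follows by
  continuity along the truncations.\<close>

lemma fourier_op_inverse:
  assumes \<sigma>: "\<bar>\<sigma>\<bar> = 1"
  shows "fourier_op (- \<sigma>) (fourier_op \<sigma> f) = (2 * pi) *\<^sub>R f"
proof -
  have \<sigma>': "\<bar>- \<sigma>\<bar> = 1" using \<sigma> by simp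
  have L12: "fourier_op (- \<sigma>) (fourier_op \<sigma> (l2_of f)) = (2 * pi) *\<^sub>R l2_of f" if f: "integrable_L12 f" for f
  proof -
    have fi: "integrable lborel f" "square_integrable f" using f by (auto simp: integrable_L12_def)
    have "inner (fourier_op (- \<sigma>) (fourier_op \<sigma> (l2_of f)) - (2 * pi) *\<^sub>R l2_of f) (scaleC_l2 z (l2_of (indicator {a..b}))) = 0" for a b z
    proof -
      let ?I = "indicator {a..b} :: real \<Rightarrow> complex"
      have I: "integrable_L12 ?I" "integrable_L12 (\<lambda>x. z * ?I x)"
        by (auto simp: integrable_L12_def integrable_indicator_complex square_integrable_indicator square_integrable_scale)
      have "inner (fourier_op (- \<sigma>) (fourier_op \<sigma> (l2_of f))) (l2_of (\<lambda>x. z * ?I x))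
          = inner (l2_of (fourier_integral \<sigma> f)) (l2_of (fourier_integral \<sigma> (\<lambda>x. z * ?I x)))"
        by (simp add: fourier_op_adjoint \<sigma>' fourier_op_l2_of I f \<sigma>)
      also have "\<dots> = Re (LINT \<eta>|lborel. fourier_integral \<sigma> f \<eta> * cnj (fourier_integral \<sigma> (\<lambda>x. z * ?I x) \<eta>))"
        by (intro inner_l2_of_Re square_integrable_fourier I f \<sigma>)
      also have "(LINT \<eta>|lborel. fourier_integral \<sigma> f \<eta> * cnj (fourier_integral \<sigma> (\<lambda>x. z * ?I x) \<eta>))
          = (LINT \<eta>|lborel. cnj z * (fourier_integral \<sigma> f \<eta> * cnj (fourier_integral \<sigma> ?I \<eta>)))"
        by (simp add: fourier_integral_scale mult_ac)
      also have "\<dots> = cnj z * (2 * pi * (LINT x|lborel. f x * ?I x))"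
        by (simp add: parseval_interval[OF fi \<sigma>])
      also have "\<dots> = 2 * pi * (LINT x|lborel. cnj z * (f x * ?I x))"
        by simp
      also have "(LINT x|lborel. cnj z * (f x * ?I x)) = (LINT x|lborel. f x * cnj (z * ?I x))"
        by (intro Bochner_Integration.integral_cong) (auto simp: indicator_def)
      also have "Re (2 * pi * (LINT x|lborel. f x * cnj (z * ?I x))) = 2 * pi * inner (l2_of f) (l2_of (\<lambda>x. z * ?I x))"
        using I(2) fi by (simp add: inner_l2_of_Re integrable_L12_def)
      finally show ?thesis
        by (simp add: inner_diff_left l2_of_scale square_integrable_indicator)
    qed
    then show ?thesis
      using l2_eq_zero_if_orthogonal_intervals by (metis eq_iff_diff_eq_0)
  qed
  let ?f = "\<lambda>n. l2_of (truncate n (rep_l2 f))"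
  have lim: "?f \<longlonglongrightarrow> f" using truncate_tendsto[of "rep_l2 f"] by simp
  have "(\<lambda>n. fourier_op (- \<sigma>) (fourier_op \<sigma> (?f n))) \<longlonglongrightarrow> fourier_op (- \<sigma>) (fourier_op \<sigma> f)"
    by (intro bounded_linear.tendsto[OF bounded_linear_fourier_op] \<sigma> \<sigma>' lim)
  moreover have "(\<lambda>n. (2 * pi) *\<^sub>R ?f n) \<longlonglongrightarrow> (2 * pi) *\<^sub>R f"
    by (intro tendsto_intros lim)
  ultimately show ?thesis
    by (simp add: L12 integrable_L12_truncate LIMSEQ_unique)
qed

definition inverse_fourier_l2 :: "l2 \<Rightarrow> l2" where
  "inverse_fourier_l2 f = (1 / (2 * pi)) *\<^sub>R fourier_op 1 f"

lemma bounded_linear_fourier: "bounded_linear fourier_l2"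
  by (simp add: fourier_l2_eq bounded_linear_fourier_op)

lemma inverse_fourier_fourier [simp]: "inverse_fourier_l2 (fourier_l2 f) = f"
  using fourier_op_inverse[of "-1" f] by (simp add: inverse_fourier_l2_def fourier_l2_eq)

lemma fourier_inverse_fourier [simp]: "fourier_l2 (inverse_fourier_l2 f) = f"
proof -
  have "fourier_l2 (inverse_fourier_l2 f) = (1 / (2 * pi)) *\<^sub>R fourier_l2 (fourier_op 1 f)"
    unfolding inverse_fourier_l2_def
    by (rule linear_cmul[OF bounded_linear.linear[OF bounded_linear_fourier]])
  then show ?thesis using fourier_op_inverse[of 1 f] by (simp add: fourier_l2_eq)
qed

lemma inv_fourier_l2: "inv fourier_l2 = inverse_fourier_l2"
  by (rule inv_equality) simp_all

lemma norm_fourier: "norm (fourier_l2 f) = sqrt (2 * pi) * norm f"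
proof -
  have "(norm (fourier_l2 f))\<^sup>2 = (sqrt (2 * pi) * norm f)\<^sup>2"
    using fourier_op_inverse[of "-1" f]
    by (simp add: power2_norm_eq_inner fourier_l2_eq fourier_op_adjoint power_mult_distrib)
  then show ?thesis by (rule power2_eq_imp_eq) auto
qed

lemma norm_inverse_fourier: "norm (inverse_fourier_l2 f) = norm f / sqrt (2 * pi)"
  using norm_fourier[of "inverse_fourier_l2 f"] by simp

text \<open>Dimensions and codimensions in the Fredholm notions are complex, while limits and
  completeness use the real normed structure; complex linear maps are therefore tracked separately
  from \<open>bounded_linear\<close>.\<close>

abbreviation clinear :: "(l2 \<Rightarrow> l2) \<Rightarrow> bool" where
  "clinear \<equiv> Vector_Spaces.linear scaleC_l2 scaleC_l2"

interpretation l2_pair: vector_space_pair scaleC_l2 scaleC_l2 ..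

lemma clinearI:
  "(\<And>x y. f (x + y) = f x + f y) \<Longrightarrow> (\<And>a x. f (scaleC_l2 a x) = scaleC_l2 a (f x)) \<Longrightarrow> clinear f"
  by unfold_locales

lemma clinear_add: "clinear f \<Longrightarrow> f (x + y) = f x + f y"
  by (rule l2_pair.linear_add)
lemma clinear_diff: "clinear f \<Longrightarrow> f (x - y) = f x - f y"
  by (rule l2_pair.linear_diff)
lemma clinear_scale: "clinear f \<Longrightarrow> f (scaleC_l2 a x) = scaleC_l2 a (f x)"
  by (rule l2_pair.linear_scale)

lemma clinear_fourier: "clinear fourier_l2"
  by (intro clinearI) (simp_all add: fourier_l2_eq fourier_op_add fourier_op_scale)

lemma clinear_inverse_fourier: "clinear inverse_fourier_l2"
  by (intro clinearI)
    (simp_all add: inverse_fourier_l2_def fourier_op_add fourier_op_scale scaleR_l2_conv mult.commute l2.scale_right_distrib)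

subsection \<open>Multiplication operators\<close>

text \<open>For unbounded \<open>m\<close> the value defaults to 0 when the product leaves $L^2$,
  which destroys linearity. Hence the versions below that ask for square integrability of the
  products.\<close>

definition mult_op :: "(real \<Rightarrow> complex) \<Rightarrow> l2 \<Rightarrow> l2" where
  "mult_op m f = l2_of (\<lambda>x. m x * rep_l2 f x)"

definition bounded_symbol :: "(real \<Rightarrow> complex) \<Rightarrow> bool" where
  "bounded_symbol m \<longleftrightarrow> m \<in> borel_measurable borel \<and> (\<exists>C. \<forall>x. norm (m x) \<le> C)"

lemma square_integrable_bounded_symbol:
  assumes "bounded_symbol m" "square_integrable f"
  shows "square_integrable (\<lambda>x. m x * f x)"
proof -
  obtain C where C: "\<And>x. norm (m x) \<le> C" using assms(1) by (auto simp: bounded_symbol_def)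
  have [measurable]: "m \<in> borel_measurable borel" "f \<in> borel_measurable borel"
    using assms by (auto simp: bounded_symbol_def square_integrable_def)
  show ?thesis
    by (rule square_integrable_bound[OF assms(2), where C=C]) (auto simp: norm_mult intro!: mult_right_mono C)
qed

lemma mult_op_l2_of:
  assumes "m \<in> borel_measurable borel" "square_integrable f"
  shows "mult_op m (l2_of f) = l2_of (\<lambda>x. m x * f x)"
proof -
  have [measurable]: "m \<in> borel_measurable borel" "f \<in> borel_measurable borel"
    using assms by (auto simp: square_integrable_def)
  show ?thesis
    unfolding mult_op_def using rep_l2_of[OF assms(2)]
    by (intro l2_of_cong_AE) auto
qed

lemma mult_op_domain_add:
  assumes m: "m \<in> borel_measurable borel"
    and s: "square_integrable (\<lambda>x. m x * rep_l2 f x)" "square_integrable (\<lambda>x. m x * rep_l2 g x)"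
  shows "mult_op m (f + g) = mult_op m f + mult_op m g"
proof -
  have "mult_op m (f + g) = mult_op m (l2_of (\<lambda>x. rep_l2 f x + rep_l2 g x))"
    by (simp add: l2_of_add)
  also have "\<dots> = l2_of (\<lambda>x. m x * rep_l2 f x + m x * rep_l2 g x)"
    by (simp add: mult_op_l2_of m square_integrable_add distrib_left)
  finally show ?thesis by (simp add: l2_of_add s mult_op_def)
qed

lemma mult_op_domain_scale:
  assumes m: "m \<in> borel_measurable borel" and s: "square_integrable (\<lambda>x. m x * rep_l2 f x)"
  shows "mult_op m (scaleC_l2 a f) = scaleC_l2 a (mult_op m f)"
proof -
  have "mult_op m (scaleC_l2 a f) = mult_op m (l2_of (\<lambda>x. a * rep_l2 f x))"
    by (simp add: l2_of_scale)
  also have "\<dots> = l2_of (\<lambda>x. a * (m x * rep_l2 f x))"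
    by (simp add: mult_op_l2_of m square_integrable_scale mult.left_commute)
  finally show ?thesis by (simp add: l2_of_scale s mult_op_def)
qed

lemma clinear_mult_op:
  assumes m: "bounded_symbol m"
  shows "clinear (mult_op m)"
proof -
  note s = square_integrable_bounded_symbol[OF m square_integrable_rep]
  have "m \<in> borel_measurable borel" using m by (simp add: bounded_symbol_def)
  then show ?thesis
    by (intro clinearI mult_op_domain_add mult_op_domain_scale s)
qed

lemma norm_mult_op_le:
  assumes "m \<in> borel_measurable borel" "\<And>x. norm (m x) \<le> C"
  shows "norm (mult_op m f) \<le> C * norm f"
proof -
  have "0 \<le> C" using assms(2)[of 0] norm_ge_zero order_trans by blast
  then show ?thesis
    using norm_l2_of_le[of "rep_l2 f" "\<lambda>x. m x * rep_l2 f x" C] assms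
    by (auto simp: mult_op_def norm_mult mult_right_mono)
qed

lemma mult_op_mult:
  assumes "m \<in> borel_measurable borel" "square_integrable (\<lambda>x. n x * rep_l2 f x)"
  shows "mult_op m (mult_op n f) = mult_op (\<lambda>x. m x * n x) f"
  unfolding mult_op_def[of n] mult_op_l2_of[OF assms] by (simp add: mult_op_def mult.assoc)

lemma mult_op_one [simp]: "mult_op (\<lambda>_. 1) f = f"
  by (simp add: mult_op_def)

lemma mult_op_plus:
  assumes "square_integrable (\<lambda>x. m x * rep_l2 f x)" "square_integrable (\<lambda>x. n x * rep_l2 f x)"
  shows "mult_op (\<lambda>x. m x + n x) f = mult_op m f + mult_op n f"
  using l2_of_add[OF assms] by (simp add: mult_op_def distrib_right)

lemma mult_op_minus:
  assumes "square_integrable (\<lambda>x. m x * rep_l2 f x)" "square_integrable (\<lambda>x. n x * rep_l2 f x)"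
  shows "mult_op (\<lambda>x. m x - n x) f = mult_op m f - mult_op n f"
  using l2_of_diff[OF assms] by (simp add: mult_op_def left_diff_distrib)

lemma mult_op_cmult:
  assumes "square_integrable (\<lambda>x. m x * rep_l2 f x)"
  shows "mult_op (\<lambda>x. a * m x) f = scaleC_l2 a (mult_op m f)"
  using l2_of_scale[OF assms, of a] by (simp add: mult_op_def mult.assoc)

lemma fourier_multiplier_eq: "fourier_multiplier m f = inverse_fourier_l2 (mult_op m (fourier_l2 f))"
  by (simp add: fourier_multiplier_def inv_fourier_l2 mult_op_def)

lemma multiply_l2_eq: "multiply_l2 u = mult_op (\<lambda>x. of_real (u x))"
  by (intro ext) (simp add: multiply_l2_def mult_op_def)

lemma clinear_fourier_multiplier:
  assumes "bounded_symbol m" shows "clinear (fourier_multiplier m)"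
proof -
  have "fourier_multiplier m = inverse_fourier_l2 \<circ> (mult_op m \<circ> fourier_l2)"
    by (auto simp: fourier_multiplier_eq)
  then show ?thesis
    using clinear_fourier clinear_inverse_fourier clinear_mult_op[OF assms]
    by (auto intro!: Vector_Spaces.linear_compose)
qed

lemma norm_fourier_multiplier_le:
  assumes "m \<in> borel_measurable borel" "\<And>x. norm (m x) \<le> C"
  shows "norm (fourier_multiplier m f) \<le> C * norm f"
  using norm_mult_op_le[OF assms, of "fourier_l2 f"]
  by (simp add: fourier_multiplier_eq norm_inverse_fourier norm_fourier pos_divide_le_eq mult.assoc mult.commute[of "sqrt (2 * pi)"])

subsection \<open>Translations and $H^1$\<close>

lemma integral_lborel_shift:
  fixes f :: "real \<Rightarrow> 'a::{banach, second_countable_topology}"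
  shows "(LINT x|lborel. f (x + t)) = (LINT x|lborel. f x)"
  using lborel_integral_real_affine[of 1 f t] by (simp add: add.commute)

lemma integrable_lborel_shift:
  fixes f :: "real \<Rightarrow> 'a::{banach, second_countable_topology}"
  shows "integrable lborel f \<Longrightarrow> integrable lborel (\<lambda>x. f (x + t))"
  using lborel_integrable_real_affine[of f 1 t] by (simp add: add.commute)

lemma square_integrable_shift:
  assumes "square_integrable f" shows "square_integrable (\<lambda>x. f (x + t))"
proof -
  have [measurable]: "f \<in> borel_measurable borel" using assms by (simp add: square_integrable_def)
  show ?thesis
    using assms integrable_lborel_shift[of "\<lambda>x. (norm (f x))\<^sup>2" t] by (simp add: square_integrable_def)
qed

lemma norm_l2_of_shift:
  assumes "square_integrable f" shows "norm (l2_of (\<lambda>x. f (x + t))) = norm (l2_of f)"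
proof -
  have "(norm (l2_of (\<lambda>x. f (x + t))))\<^sup>2 = (norm (l2_of f))\<^sup>2"
    using integral_lborel_shift[of "\<lambda>x. (norm (f x))\<^sup>2" t]
    by (simp add: norm_l2_of assms square_integrable_shift)
  then show ?thesis by (rule power2_eq_imp_eq) auto
qed

definition translate :: "real \<Rightarrow> l2 \<Rightarrow> l2" where
  "translate t f = l2_of (\<lambda>x. rep_l2 f (x + t))"

lemma norm_translate_diff: "norm (translate t f - translate t g) = norm (f - g)"
proof -
  have "norm (translate t f - translate t g) = norm (l2_of (\<lambda>x. rep_l2 f (x + t) - rep_l2 g (x + t)))"
    by (simp add: translate_def l2_of_diff square_integrable_shift)
  also have "\<dots> = norm (l2_of (\<lambda>x. rep_l2 f x - rep_l2 g x))"
    by (rule norm_l2_of_shift[of "\<lambda>x. rep_l2 f x - rep_l2 g x"]) (simp add: square_integrable_diff)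
  finally show ?thesis by (simp add: l2_of_diff)
qed

lemma translate_l2_of:
  assumes f: "square_integrable f"
  shows "translate t (l2_of f) = l2_of (\<lambda>x. f (x + t))"
proof -
  let ?g = "rep_l2 (l2_of f)"
  have "norm (translate t (l2_of f) - l2_of (\<lambda>x. f (x + t))) = norm (l2_of (\<lambda>x. ?g (x + t) - f (x + t)))"
    by (simp add: translate_def l2_of_diff square_integrable_shift f)
  also have "\<dots> = norm (l2_of (\<lambda>x. ?g x - f x))"
    by (rule norm_l2_of_shift[of "\<lambda>x. ?g x - f x"]) (simp add: square_integrable_diff f)
  also have "\<dots> = 0" by (simp add: l2_of_diff f)
  finally show ?thesis by simp
qed

lemma fourier_translate:
  "fourier_l2 (translate t f) = mult_op (\<lambda>\<eta>. cis (\<eta> * t)) (fourier_l2 f)"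
proof -
  have m: "(\<lambda>\<eta>. cis (\<eta> * t)) \<in> borel_measurable borel" by measurable
  have nb: "norm (cis (\<eta> * t)) \<le> 1" for \<eta> by simp
  have bs: "bounded_symbol (\<lambda>\<eta>. cis (\<eta> * t))"
    using m nb unfolding bounded_symbol_def by blast
  have L12: "fourier_l2 (translate t (l2_of f)) = mult_op (\<lambda>\<eta>. cis (\<eta> * t)) (fourier_l2 (l2_of f))"
    if f: "integrable_L12 f" for f
  proof -
    have ft: "integrable_L12 (\<lambda>x. f (x + t))"
      using f by (simp add: integrable_L12_def integrable_lborel_shift square_integrable_shift)
    have "fourier_integral (-1) (\<lambda>x. f (x + t)) \<eta> = cis (\<eta> * t) * fourier_integral (-1) f \<eta>" for \<eta>
    proof -
      have "fourier_integral (-1) (\<lambda>x. f (x + t)) \<eta> = (LINT x|lborel. f (x + t) * cis (- \<eta> * (x + t - t)))"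
        by (simp add: fourier_integral_def)
      also have "\<dots> = (LINT x|lborel. f x * cis (- \<eta> * (x - t)))"
        by (rule integral_lborel_shift[of "\<lambda>x. f x * cis (- \<eta> * (x - t))"])
      also have "\<dots> = (LINT x|lborel. cis (\<eta> * t) * (f x * cis (-1 * \<eta> * x)))"
        by (simp add: cis_mult algebra_simps)
      finally show ?thesis by (simp add: fourier_integral_def)
    qed
    then have eq: "fourier_integral (-1) (\<lambda>x. f (x + t)) = (\<lambda>\<eta>. cis (\<eta> * t) * fourier_integral (-1) f \<eta>)"
      by (rule ext)
    show ?thesis
      using f ft by (simp add: eq fourier_l2_eq translate_l2_of fourier_op_l2_of mult_op_l2_of m square_integrable_fourier integrable_L12_def)
  qed
  let ?f = "\<lambda>n. l2_of (truncate n (rep_l2 f))"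
  have lim: "?f \<longlonglongrightarrow> f" using truncate_tendsto[of "rep_l2 f"] by simp
  have "(\<lambda>n. translate t (?f n)) \<longlonglongrightarrow> translate t f"
    using lim by (subst (asm) tendsto_dist_iff, subst tendsto_dist_iff) (simp add: dist_norm norm_translate_diff)
  then have "(\<lambda>n. fourier_l2 (translate t (?f n))) \<longlonglongrightarrow> fourier_l2 (translate t f)"
    by (rule bounded_linear.tendsto[OF bounded_linear_fourier])
  moreover have "(\<lambda>n. mult_op (\<lambda>\<eta>. cis (\<eta> * t)) (fourier_l2 (?f n))) \<longlonglongrightarrow> mult_op (\<lambda>\<eta>. cis (\<eta> * t)) (fourier_l2 f)"
  proof -
    have "(\<lambda>n. fourier_l2 (?f n)) \<longlonglongrightarrow> fourier_l2 f"
      by (rule bounded_linear.tendsto[OF bounded_linear_fourier lim])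
    then have a: "(\<lambda>n. norm (fourier_l2 (?f n) - fourier_l2 f)) \<longlonglongrightarrow> 0"
      by (intro tendsto_norm_zero LIM_zero)
    have b: "norm (mult_op (\<lambda>\<eta>. cis (\<eta> * t)) a - mult_op (\<lambda>\<eta>. cis (\<eta> * t)) b) \<le> norm (a - b)" for a b
      using norm_mult_op_le[OF m nb, of "a - b"] by (simp add: clinear_diff[OF clinear_mult_op[OF bs]])
    have "(\<lambda>n. mult_op (\<lambda>\<eta>. cis (\<eta> * t)) (fourier_l2 (?f n)) - mult_op (\<lambda>\<eta>. cis (\<eta> * t)) (fourier_l2 f)) \<longlonglongrightarrow> 0"
      by (rule Lim_null_comparison[OF _ a]) (intro always_eventually allI b)
    then show ?thesis by (rule LIM_zero_cancel)
  qed
  ultimately show ?thesis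
    by (simp add: L12 integrable_L12_truncate LIMSEQ_unique)
qed

lemma norm_cis_minus_1_le: "norm (cis x - 1) \<le> \<bar>x\<bar>"
  using iexp_approx1[of x 0] by (simp add: cis_conv_exp)

lemma sobolev_H1_iff:
  "f \<in> sobolev_H1 \<longleftrightarrow> square_integrable (\<lambda>\<eta>. of_real \<eta> * rep_l2 (fourier_l2 f) \<eta>)"
proof -
  let ?g = "rep_l2 (fourier_l2 f)"
  have [measurable]: "?g \<in> borel_measurable borel" using measurable_rep_l2 by simp
  have g: "integrable lborel (\<lambda>\<eta>. (norm (?g \<eta>))\<^sup>2)"
    using square_integrable_rep[of "fourier_l2 f"] by (simp add: square_integrable_def)
  have eq: "(norm (of_real (sqrt (1 + \<eta>\<^sup>2)) * ?g \<eta>))\<^sup>2 = (norm (?g \<eta>))\<^sup>2 + (norm (of_real \<eta> * ?g \<eta>))\<^sup>2" for \<eta>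
    by (simp add: norm_mult power_mult_distrib algebra_simps)
  have "integrable lborel (\<lambda>\<eta>. (norm (?g \<eta>))\<^sup>2 + (norm (of_real \<eta> * ?g \<eta>))\<^sup>2) \<longleftrightarrow> integrable lborel (\<lambda>\<eta>. (norm (of_real \<eta> * ?g \<eta>))\<^sup>2)"
  proof
    assume "integrable lborel (\<lambda>\<eta>. (norm (?g \<eta>))\<^sup>2 + (norm (of_real \<eta> * ?g \<eta>))\<^sup>2)"
    from Bochner_Integration.integrable_diff[OF this g] show "integrable lborel (\<lambda>\<eta>. (norm (of_real \<eta> * ?g \<eta>))\<^sup>2)"
      by simp
  qed (rule Bochner_Integration.integrable_add[OF g])
  then show ?thesis
    unfolding sobolev_H1_def square_integrable_def mem_Collect_eq eq by simp
qed

lemma fourier_translate_diff: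
  "fourier_l2 (translate t f - f) = l2_of (\<lambda>\<eta>. (cis (\<eta> * t) - 1) * rep_l2 (fourier_l2 f) \<eta>)"
proof -
  have "bounded_symbol (\<lambda>\<eta>. cis (\<eta> * t))"
    unfolding bounded_symbol_def by (auto intro!: exI[of _ 1])
  then have "square_integrable (\<lambda>\<eta>. cis (\<eta> * t) * rep_l2 (fourier_l2 f) \<eta>)"
    by (rule square_integrable_bounded_symbol) simp
  then show ?thesis
    by (simp add: clinear_diff[OF clinear_fourier] fourier_translate mult_op_def left_diff_distrib l2_of_diff)
qed

text \<open>Replaces weak derivatives by finite differences, which can be handled on the space side
  as well as on the Fourier side. One direction is
  \<open>norm (cis (\<eta> * t) - 1) \<le> \<bar>\<eta> * t\<bar>\<close>; the other is
  Fatou.\<close>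

lemma sobolev_H1_iff_lipschitz_translate:
  "f \<in> sobolev_H1 \<longleftrightarrow> (\<exists>C. \<forall>t. norm (translate t f - f) \<le> C * \<bar>t\<bar>)"
proof
  let ?g = "rep_l2 (fourier_l2 f)"
  have [measurable]: "?g \<in> borel_measurable borel" using measurable_rep_l2 by simp
  {
    assume "f \<in> sobolev_H1"
    then have s: "square_integrable (\<lambda>\<eta>. of_real \<eta> * ?g \<eta>)" by (simp add: sobolev_H1_iff)
    let ?N = "norm (l2_of (\<lambda>\<eta>. of_real \<eta> * ?g \<eta>))"
    have "norm (translate t f - f) \<le> ?N / sqrt (2 * pi) * \<bar>t\<bar>" for t
    proof -
      have "norm (cis (\<eta> * t) - 1) * norm (?g \<eta>) \<le> \<bar>\<eta> * t\<bar> * norm (?g \<eta>)" for \<eta>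
        by (intro mult_right_mono norm_cis_minus_1_le) simp
      then have "norm (fourier_l2 (translate t f - f)) \<le> \<bar>t\<bar> * ?N"
        unfolding fourier_translate_diff
        by (intro norm_l2_of_le s) (auto simp: norm_mult abs_mult mult_ac)
      then show ?thesis by (simp add: norm_fourier field_simps)
    qed
    then show "\<exists>C. \<forall>t. norm (translate t f - f) \<le> C * \<bar>t\<bar>" by blast
  next
    assume "\<exists>C. \<forall>t. norm (translate t f - f) \<le> C * \<bar>t\<bar>"
    then obtain C where C: "\<And>t. norm (translate t f - f) \<le> C * \<bar>t\<bar>" by blast
    \<comment> \<open>Transforms of the difference quotients with step \<open>1 / (n + 1)\<close>:
      bounded in $L^2$ by the Lipschitz hypothesis and pointwise convergent to the transform of the
      derivative.\<close>
    let ?q = "\<lambda>n \<eta>. of_real (real (Suc n)) * ((cis (\<eta> * (1 / real (Suc n))) - 1) * ?g \<eta>)"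
    have bs: "bounded_symbol (\<lambda>\<eta>. cis (\<eta> * t) - 1)" for t
      unfolding bounded_symbol_def
      by (auto intro!: exI[of _ 2] order_trans[OF norm_triangle_ineq4])
    have q: "square_integrable (?q n)" for n
      by (intro square_integrable_scale square_integrable_bounded_symbol[OF bs]) simp
    have qC: "norm (l2_of (?q n)) \<le> sqrt (2 * pi) * C" for n
    proof -
      have "norm (l2_of (?q n)) = real (Suc n) * norm (fourier_l2 (translate (1 / real (Suc n)) f - f))"
        using square_integrable_bounded_symbol[OF bs square_integrable_rep]
        by (subst l2_of_scale) (simp_all only: norm_scaleC_l2 fourier_translate_diff norm_of_real abs_of_nat)
      also have "\<dots> \<le> real (Suc n) * (sqrt (2 * pi) * (C * (1 / real (Suc n))))"
        using C[of "1 / real (Suc n)"] unfolding norm_fourier by (intro mult_left_mono) auto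
      finally show ?thesis by (simp del: of_nat_Suc)
    qed
    have qlim: "(\<lambda>n. ?q n \<eta>) \<longlonglongrightarrow> \<i> * of_real \<eta> * ?g \<eta>" for \<eta>
    proof (cases "\<eta> = 0")
      case False
      let ?z = "\<lambda>n. \<i> * of_real (\<eta> / real (Suc n))"
      have "?z \<longlonglongrightarrow> \<i> * of_real 0"
        by (intro tendsto_intros LIMSEQ_Suc[OF lim_const_over_n])
      then have "filterlim ?z (at 0) sequentially"
        using False by (auto simp: filterlim_at simp del: of_nat_Suc)
      from filterlim_compose[OF lim_exp_minus_1 this]
      have "(\<lambda>n. \<i> * of_real \<eta> * ((exp (?z n) - 1) / ?z n) * ?g \<eta>) \<longlonglongrightarrow> \<i> * of_real \<eta> * 1 * ?g \<eta>"
        by (intro tendsto_intros)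
      moreover have eq: "\<i> * of_real \<eta> * ((exp (?z n) - 1) / ?z n) * ?g \<eta> = ?q n \<eta>" for n
        using False by (simp add: cis_conv_exp field_simps del: of_nat_Suc)
      ultimately show ?thesis by (simp only: eq mult_1_right)
    qed simp
    have "square_integrable (\<lambda>\<eta>. \<i> * of_real \<eta> * ?g \<eta>)"
      by (rule l2_fatou(1)[OF q _ AE_I2[OF qlim] always_eventually[OF allI[OF qC]]]) measurable
    from square_integrable_scale[OF this, of "-\<i>"] show "f \<in> sobolev_H1"
      by (simp add: sobolev_H1_iff mult.assoc[symmetric])
  }
qed

text \<open>The discrete product rule: a difference of \<open>u f\<close> is the shifted
  \<open>u\<close> times a difference of \<open>f\<close>, plus a difference of \<open>u\<close>
  times \<open>f\<close>. Boundedness of \<open>u\<close> controls the first term and its Lipschitz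
  constant the second.\<close>

lemma sobolev_H1_multiply:
  assumes f: "f \<in> sobolev_H1" and B: "\<And>x. \<bar>u x\<bar> \<le> B" and L: "\<And>x y. \<bar>u x - u y\<bar> \<le> L * \<bar>x - y\<bar>"
    and [measurable]: "u \<in> borel_measurable borel"
  shows "multiply_l2 u f \<in> sobolev_H1"
proof -
  let ?g = "rep_l2 f"
  have L0: "0 \<le> L" using L[of 1 0] abs_ge_zero order_trans by fastforce
  have B0: "0 \<le> B" using B[of 0] by linarith
  have mg[measurable]: "?g \<in> borel_measurable borel" using measurable_rep_l2 by simp
  obtain C where C: "\<And>t. norm (translate t f - f) \<le> C * \<bar>t\<bar>"
    using f by (auto simp: sobolev_H1_iff_lipschitz_translate)
  have bs: "bounded_symbol (\<lambda>x. of_real (u (x + t)))" for t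
    unfolding bounded_symbol_def using B by auto
  have "norm (translate t (multiply_l2 u f) - multiply_l2 u f) \<le> (B * C + L * norm f) * \<bar>t\<bar>" for t
  proof -
    have s: "square_integrable (\<lambda>x. of_real (u x) * ?g x)"
      using square_integrable_bounded_symbol[OF bs[of 0] square_integrable_rep[of f]] by simp
    have d: "square_integrable (\<lambda>x. ?g (x + t) - ?g x)"
      by (intro square_integrable_diff square_integrable_shift square_integrable_rep)
    have s1: "square_integrable (\<lambda>x. of_real (u (x + t)) * (?g (x + t) - ?g x))"
      by (rule square_integrable_bounded_symbol[OF bs d])
    have ub: "norm (of_real (u (x + t) - u x) * ?g x) \<le> (L * \<bar>t\<bar>) * norm (?g x)" for x
    proof -
      have "\<bar>u (x + t) - u x\<bar> * norm (?g x) \<le> (L * \<bar>t\<bar>) * norm (?g x)"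
        using L[of "x + t" x] by (intro mult_right_mono) auto
      then show ?thesis by (simp add: norm_mult del: of_real_diff)
    qed
    have s2: "square_integrable (\<lambda>x. of_real (u (x + t) - u x) * ?g x)"
      by (rule square_integrable_bound[OF square_integrable_rep[of f], where C="L * \<bar>t\<bar>"]) (simp, simp only: ub, simp)
    have "translate t (multiply_l2 u f) - multiply_l2 u f
        = l2_of (\<lambda>x. of_real (u (x + t)) * ?g (x + t) - of_real (u x) * ?g x)"
      using square_integrable_shift[OF s, of t] s by (simp add: multiply_l2_def translate_l2_of l2_of_diff)
    also have "\<dots> = l2_of (\<lambda>x. of_real (u (x + t)) * (?g (x + t) - ?g x) + of_real (u (x + t) - u x) * ?g x)"
      by (simp add: algebra_simps)
    also have "\<dots> = l2_of (\<lambda>x. of_real (u (x + t)) * (?g (x + t) - ?g x)) + l2_of (\<lambda>x. of_real (u (x + t) - u x) * ?g x)"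
      by (rule l2_of_add[OF s1 s2])
    finally have "norm (translate t (multiply_l2 u f) - multiply_l2 u f)
        \<le> norm (l2_of (\<lambda>x. of_real (u (x + t)) * (?g (x + t) - ?g x))) + norm (l2_of (\<lambda>x. of_real (u (x + t) - u x) * ?g x))"
      by (simp only: norm_triangle_ineq)
    also have "\<dots> \<le> B * norm (l2_of (\<lambda>x. ?g (x + t) - ?g x)) + (L * \<bar>t\<bar>) * norm (l2_of ?g)"
      using B0 L0 by (intro add_mono norm_l2_of_le d square_integrable_rep AE_I2 ub) (auto simp: norm_mult B intro!: mult_right_mono)
    also have "l2_of (\<lambda>x. ?g (x + t) - ?g x) = translate t f - f"
      by (simp add: l2_of_diff square_integrable_shift translate_def)
    also have "B * norm (translate t f - f) + (L * \<bar>t\<bar>) * norm (l2_of ?g) \<le> B * (C * \<bar>t\<bar>) + (L * \<bar>t\<bar>) * norm f"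
      using C[of t] B0 by (intro add_mono mult_left_mono) (auto simp: L0)
    finally show ?thesis by (simp add: algebra_simps)
  qed
  then show ?thesis by (auto simp: sobolev_H1_iff_lipschitz_translate)
qed

subsection \<open>Finite rank approximation\<close>

definition finite_rank :: "(l2 \<Rightarrow> l2) \<Rightarrow> bool" where
  "finite_rank F \<longleftrightarrow> clinear F \<and> (\<exists>C. \<forall>f. norm (F f) \<le> C * norm f) \<and> (\<exists>B. finite B \<and> range F \<subseteq> l2.span B)"

text \<open>On a Hilbert space the bounded linear maps with this property are exactly the compact
  ones. This form hands the finite rank approximant directly to the Fredholm arguments.\<close>

definition approximable :: "(l2 \<Rightarrow> l2) \<Rightarrow> bool" where
  "approximable K \<longleftrightarrow> (\<forall>e>0. \<exists>F. finite_rank F \<and> (\<forall>f. norm (K f - F f) \<le> e * norm f))"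

text \<open>Bilinear, without a conjugate on \<open>w\<close>, so that it is a complex linear
  functional of \<open>f\<close>; the real inner product would not give one.\<close>

definition pairing :: "(real \<Rightarrow> complex) \<Rightarrow> l2 \<Rightarrow> complex" where
  "pairing w f = (LINT x|lborel. rep_l2 f x * w x)"

lemma integral_norm_mult_le:
  assumes "square_integrable f" "square_integrable g"
  shows "(LINT x|lborel. norm (f x) * norm (g x)) \<le> norm (l2_of f) * norm (l2_of g)"
proof -
  let ?n = "\<lambda>f x. complex_of_real (norm (f x))"
  have [measurable]: "f \<in> borel_measurable borel" "g \<in> borel_measurable borel"
    using assms by (auto simp: square_integrable_def)
  have s: "square_integrable (?n f)" "square_integrable (?n g)"
    using assms by (auto simp: square_integrable_def)
  have n: "norm (l2_of (?n h)) = norm (l2_of h)" if "square_integrable h" "square_integrable (?n h)" for h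
  proof -
    have "(norm (l2_of (?n h)))\<^sup>2 = (norm (l2_of h))\<^sup>2" using that by (simp add: norm_l2_of)
    then show ?thesis by (rule power2_eq_imp_eq) auto
  qed
  have "(LINT x|lborel. norm (f x) * norm (g x)) = inner (l2_of (?n f)) (l2_of (?n g))"
    using s by (simp add: inner_l2_of inner_complex_def)
  also have "\<dots> \<le> norm (l2_of (?n f)) * norm (l2_of (?n g))"
    by (rule norm_cauchy_schwarz)
  finally show ?thesis using assms s by (simp add: n)
qed

lemma norm_pairing_le:
  assumes "square_integrable w" shows "norm (pairing w f) \<le> norm (l2_of w) * norm f"
proof -
  have "norm (pairing w f) \<le> (LINT x|lborel. norm (rep_l2 f x * w x))"
    unfolding pairing_def by (rule integral_norm_bound)
  also have "\<dots> \<le> norm (l2_of (rep_l2 f)) * norm (l2_of w)"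
    using integral_norm_mult_le[OF square_integrable_rep[of f] assms] by (simp add: norm_mult)
  finally show ?thesis by (simp add: mult.commute)
qed

lemma pairing_l2_of:
  assumes "square_integrable w" "square_integrable f"
  shows "pairing w (l2_of f) = (LINT x|lborel. f x * w x)"
proof -
  have [measurable]: "f \<in> borel_measurable borel" "w \<in> borel_measurable borel"
    using assms by (auto simp: square_integrable_def)
  have [measurable]: "rep_l2 h \<in> borel_measurable borel" for h using measurable_rep_l2 by simp
  show ?thesis
    unfolding pairing_def using rep_l2_of[OF assms(2)]
    by (intro integral_cong_AE) auto
qed

lemma pairing_add:
  assumes w: "square_integrable w" shows "pairing w (f + g) = pairing w f + pairing w g"
proof -
  have "pairing w (f + g) = pairing w (l2_of (\<lambda>x. rep_l2 f x + rep_l2 g x))"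
    by (simp add: l2_of_add)
  also have "\<dots> = (LINT x|lborel. rep_l2 f x * w x + rep_l2 g x * w x)"
    by (subst pairing_l2_of) (simp_all add: w square_integrable_add distrib_right)
  also have "\<dots> = pairing w f + pairing w g"
    unfolding pairing_def by (intro Bochner_Integration.integral_add integrable_mult_square_integrable w square_integrable_rep)
  finally show ?thesis .
qed

lemma pairing_scale:
  assumes w: "square_integrable w" shows "pairing w (scaleC_l2 a f) = a * pairing w f"
proof -
  have "pairing w (scaleC_l2 a f) = pairing w (l2_of (\<lambda>x. a * rep_l2 f x))"
    by (simp add: l2_of_scale)
  also have "\<dots> = (LINT x|lborel. a * (rep_l2 f x * w x))"
    by (subst pairing_l2_of) (simp_all add: w square_integrable_scale mult.assoc)
  finally show ?thesis by (simp add: pairing_def)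
qed

lemma finite_rank_pairing:
  assumes "square_integrable w"
  shows "finite_rank (\<lambda>f. scaleC_l2 (pairing w f) v)"
  unfolding finite_rank_def
proof (intro conjI)
  show "clinear (\<lambda>f. scaleC_l2 (pairing w f) v)"
    by (rule clinearI) (simp_all add: pairing_add pairing_scale assms l2.scale_left_distrib)
  show "\<exists>C. \<forall>f. norm (scaleC_l2 (pairing w f) v) \<le> C * norm f"
  proof (intro exI allI)
    fix f
    show "norm (scaleC_l2 (pairing w f) v) \<le> (norm (l2_of w) * norm v) * norm f"
      using mult_right_mono[OF norm_pairing_le[OF assms, of f] norm_ge_zero[of v]]
      by (simp add: norm_scaleC_l2 mult_ac)
  qed
  show "\<exists>B. finite B \<and> range (\<lambda>f. scaleC_l2 (pairing w f) v) \<subseteq> l2.span B"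
    by (rule exI[of _ "{v}"]) (auto intro: l2.span_scale l2.span_base)
qed

lemma finite_rank_zero: "finite_rank (\<lambda>_. 0)"
  unfolding finite_rank_def
  by (auto intro!: clinearI exI[of _ "0::real"] exI[of _ "{}"])

lemma finite_rank_add:
  assumes "finite_rank F" "finite_rank G" shows "finite_rank (\<lambda>f. F f + G f)"
proof -
  from assms obtain C D A B where F: "clinear F" "\<And>f. norm (F f) \<le> C * norm f" "finite A" "range F \<subseteq> l2.span A"
    and G: "clinear G" "\<And>f. norm (G f) \<le> D * norm f" "finite B" "range G \<subseteq> l2.span B"
    unfolding finite_rank_def by blast
  show ?thesis
    unfolding finite_rank_def
  proof (intro conjI)
    show "clinear (\<lambda>f. F f + G f)"
      by (rule clinearI) (simp_all add: clinear_add[OF F(1)] clinear_add[OF G(1)] clinear_scale[OF F(1)] clinear_scale[OF G(1)] l2.scale_right_distrib)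
    have "norm (F f + G f) \<le> (C + D) * norm f" for f
      using norm_triangle_le[of "F f" "G f", OF add_mono[OF F(2) G(2)]] by (simp add: distrib_right)
    then show "\<exists>C. \<forall>f. norm (F f + G f) \<le> C * norm f" by blast
    have "F f + G f \<in> l2.span (A \<union> B)" for f
      using F(4) G(4) l2.span_mono[of A "A \<union> B"] l2.span_mono[of B "A \<union> B"]
      by (intro l2.span_add) blast+
    then show "\<exists>B. finite B \<and> range (\<lambda>f. F f + G f) \<subseteq> l2.span B"
      using F(3) G(3) by (intro exI[of _ "A \<union> B"]) auto
  qed
qed

lemma finite_rank_sum:
  "finite J \<Longrightarrow> (\<And>j. j \<in> J \<Longrightarrow> finite_rank (F j)) \<Longrightarrow> finite_rank (\<lambda>f. \<Sum>j\<in>J. F j f)"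
  by (induction J rule: finite_induct) (auto intro: finite_rank_zero finite_rank_add)

lemma finite_rank_compose_left:
  assumes F: "finite_rank F" and A: "clinear A" "\<And>f. norm (A f) \<le> D * norm f"
  shows "finite_rank (\<lambda>f. A (F f))"
proof -
  from F obtain C B where F: "clinear F" "\<And>f. norm (F f) \<le> C * norm f" "finite B" "range F \<subseteq> l2.span B"
    unfolding finite_rank_def by blast
  show ?thesis
    unfolding finite_rank_def
  proof (intro conjI)
    show "clinear (\<lambda>f. A (F f))"
      using Vector_Spaces.linear_compose[OF F(1) A(1)] by (simp add: o_def)
    have "norm (A (F f)) \<le> (\<bar>D\<bar> * C) * norm f" for f
    proof -
      have "norm (A (F f)) \<le> \<bar>D\<bar> * norm (F f)"
        using A(2)[of "F f"] abs_ge_self[of D] by (meson mult_right_mono norm_ge_zero order_trans)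
      also have "\<dots> \<le> \<bar>D\<bar> * (C * norm f)" by (intro mult_left_mono F) simp
      finally show ?thesis by (simp add: mult.assoc)
    qed
    then show "\<exists>C. \<forall>f. norm (A (F f)) \<le> C * norm f" by blast
    have "range (\<lambda>f. A (F f)) \<subseteq> l2.span (A ` B)"
      using F(4) l2_pair.linear_span_image[OF A(1), of B] by auto
    then show "\<exists>B. finite B \<and> range (\<lambda>f. A (F f)) \<subseteq> l2.span B"
      using F(3) by (intro exI[of _ "A ` B"]) auto
  qed
qed

lemma finite_rank_compose_right:
  assumes F: "finite_rank F" and A: "clinear A" "\<And>f. norm (A f) \<le> D * norm f"
  shows "finite_rank (\<lambda>f. F (A f))"
proof -
  from F obtain C B where F: "clinear F" "\<And>f. norm (F f) \<le> C * norm f" "finite B" "range F \<subseteq> l2.span B"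
    unfolding finite_rank_def by blast
  show ?thesis
    unfolding finite_rank_def
  proof (intro conjI)
    show "clinear (\<lambda>f. F (A f))"
      using Vector_Spaces.linear_compose[OF A(1) F(1)] by (simp add: o_def)
    have "norm (F (A f)) \<le> (\<bar>C\<bar> * D) * norm f" for f
    proof -
      have "norm (F (A f)) \<le> \<bar>C\<bar> * norm (A f)"
        using F(2)[of "A f"] abs_ge_self[of C] by (meson mult_right_mono norm_ge_zero order_trans)
      also have "\<dots> \<le> \<bar>C\<bar> * (D * norm f)" by (intro mult_left_mono A) simp
      finally show ?thesis by (simp add: mult.assoc)
    qed
    then show "\<exists>C. \<forall>f. norm (F (A f)) \<le> C * norm f" by blast
    show "\<exists>B. finite B \<and> range (\<lambda>f. F (A f)) \<subseteq> l2.span B"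
      using F(3,4) by (intro exI[of _ B]) auto
  qed
qed

section \<open>Norm limits of finite rank operators\<close>

lemma approximable_add:
  assumes "approximable K" "approximable L" shows "approximable (\<lambda>f. K f + L f)"
  unfolding approximable_def
proof (intro allI impI)
  fix e :: real assume "0 < e"
  then have "0 < e / 2" by simp
  then obtain F G where F: "finite_rank F" "\<And>f. norm (K f - F f) \<le> e / 2 * norm f"
    and G: "finite_rank G" "\<And>f. norm (L f - G f) \<le> e / 2 * norm f"
    using assms unfolding approximable_def by blast
  have "norm (K f + L f - (F f + G f)) \<le> e * norm f" for f
    using norm_triangle_le[of "K f - F f" "L f - G f", OF add_mono[OF F(2) G(2)]] by (simp add: algebra_simps)
  then show "\<exists>F. finite_rank F \<and> (\<forall>f. norm (K f + L f - F f) \<le> e * norm f)"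
    using finite_rank_add[OF F(1) G(1)] by blast
qed

lemma approximable_compose_left:
  assumes K: "approximable K" and A: "clinear A" "\<And>f. norm (A f) \<le> D * norm f"
  shows "approximable (\<lambda>f. A (K f))"
  unfolding approximable_def
proof (intro allI impI)
  fix e :: real assume "0 < e"
  then have "0 < e / (\<bar>D\<bar> + 1)" by (simp add: add_nonneg_pos)
  then obtain F where F: "finite_rank F" "\<And>f. norm (K f - F f) \<le> e / (\<bar>D\<bar> + 1) * norm f"
    using K unfolding approximable_def by blast
  have "norm (A (K f) - A (F f)) \<le> e * norm f" for f
  proof -
    have "D \<le> \<bar>D\<bar> + 1" by linarith
    then have "D * norm (K f - F f) \<le> (\<bar>D\<bar> + 1) * norm (K f - F f)"
      by (rule mult_right_mono) simp
    with A(2)[of "K f - F f"] have "norm (A (K f) - A (F f)) \<le> (\<bar>D\<bar> + 1) * norm (K f - F f)"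
      by (simp only: clinear_diff[OF A(1)])
    also have "\<dots> \<le> (\<bar>D\<bar> + 1) * (e / (\<bar>D\<bar> + 1) * norm f)" by (intro mult_left_mono F) simp
    also have "\<dots> = e * norm f" by (simp add: add_nonneg_eq_0_iff)
    finally show ?thesis .
  qed
  then show "\<exists>F. finite_rank F \<and> (\<forall>f. norm (A (K f) - F f) \<le> e * norm f)"
    using finite_rank_compose_left[OF F(1) A] by blast
qed

lemma approximable_scale:
  assumes "approximable K" shows "approximable (\<lambda>f. scaleC_l2 a (K f))"
  by (rule approximable_compose_left[OF assms, where D="norm a"])
    (auto intro!: clinearI simp: l2.scale_right_distrib norm_scaleC_l2 mult.commute)

lemma inverse_fourier_l2_of:
  assumes "integrable_L12 g"
  shows "inverse_fourier_l2 (l2_of g) = l2_of (\<lambda>x. of_real (1 / (2 * pi)) * fourier_integral 1 g x)"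
  using assms unfolding inverse_fourier_l2_def scaleR_l2_conv
  by (subst l2_of_scale) (simp_all add: fourier_op_l2_of square_integrable_fourier)

text \<open>If \<open>\<phi>\<close> and \<open>m\<close> have bounded support, expanding the kernel \<open>cis (\<eta> * x)\<close> of \<open>\<phi> \<circ> m(D)\<close> into its
  Taylor polynomial separates the variables \<open>\<eta>\<close> and \<open>x\<close>.\<close>

lemma approximable_mult_multiplier_cutoff:
  assumes \<phi>: "bounded_symbol \<phi>" "\<And>x. \<bar>x\<bar> > R \<Longrightarrow> \<phi> x = 0" and m: "bounded_symbol m" "\<And>x. \<bar>x\<bar> > R \<Longrightarrow> m x = 0" and R: "0 < R"
  shows "approximable (\<lambda>f. mult_op \<phi> (fourier_multiplier m f))"
  unfolding approximable_def
proof (intro allI impI)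
  fix e :: real assume e: "0 < e"
  have [measurable]: "\<phi> \<in> borel_measurable borel" "m \<in> borel_measurable borel"
    using \<phi>(1) m(1) by (auto simp: bounded_symbol_def)
  have [measurable]: "rep_l2 h \<in> borel_measurable borel" for h using measurable_rep_l2 by simp
  obtain C where C: "\<And>x. norm (\<phi> x) \<le> C" using \<phi>(1) by (auto simp: bounded_symbol_def)
  have C0: "0 \<le> C" using C[of 0] norm_ge_zero order_trans by blast
  obtain D where D: "\<And>x. norm (m x) \<le> D" using m(1) by (auto simp: bounded_symbol_def)
  have D0: "0 \<le> D" using D[of 0] norm_ge_zero order_trans by blast
  let ?I = "indicator {-R..R} :: real \<Rightarrow> complex"
  have \<phi>I: "\<phi> x = ?I x * \<phi> x" and mI: "m x = m x * ?I x" for x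
    using \<phi>(2)[of x] m(2)[of x] by (force simp: indicator_def)+
  have mpow: "square_integrable (\<lambda>\<eta>. m \<eta> * of_real (\<eta> ^ j))" for j
  proof (rule square_integrable_bound[OF square_integrable_indicator[of "-R" R], where C="D * R ^ j"])
    have "norm (m \<eta> * of_real (\<eta> ^ j)) \<le> D * R ^ j * norm (?I \<eta>)" for \<eta>
    proof (cases "\<bar>\<eta>\<bar> \<le> R")
      case True
      then have "norm (m \<eta>) * \<bar>\<eta>\<bar> ^ j \<le> D * R ^ j"
        using D0 by (intro mult_mono D power_mono) auto
      moreover have "?I \<eta> = 1" using True by (auto simp: indicator_def abs_le_iff)
      ultimately show ?thesis by (simp add: norm_mult norm_power)
    next
      case False
      then show ?thesis using m(2)[of \<eta>] D0 R by auto
    qed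
    then show "AE \<eta> in lborel. norm (m \<eta> * of_real (\<eta> ^ j)) \<le> D * R ^ j * norm (?I \<eta>)" by simp
  qed measurable
  have \<phi>pow: "square_integrable (\<lambda>x. \<phi> x * (of_real (1 / (2 * pi)) * ((\<i> * of_real x) ^ j / fact j)))" for j
  proof (rule square_integrable_bound[OF square_integrable_indicator[of "-R" R], where C="C * (1 / (2 * pi) * (R ^ j / fact j))"])
    have "norm (\<phi> x * (of_real (1 / (2 * pi)) * ((\<i> * of_real x) ^ j / fact j))) \<le> C * (1 / (2 * pi) * (R ^ j / fact j)) * norm (?I x)" for x
    proof (cases "\<bar>x\<bar> \<le> R")
      case True
      then have "norm (\<phi> x) * (1 / (2 * pi) * (\<bar>x\<bar> ^ j / fact j)) \<le> C * (1 / (2 * pi) * (R ^ j / fact j))"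
        using C0 by (intro mult_mono C power_mono divide_right_mono) auto
      moreover have "?I x = 1" using True by (auto simp: indicator_def abs_le_iff)
      ultimately show ?thesis by (simp add: norm_mult norm_divide norm_power)
    next
      case False
      then show ?thesis using \<phi>(2)[of x] C0 R by auto
    qed
    then show "AE x in lborel. norm (\<phi> x * (of_real (1 / (2 * pi)) * ((\<i> * of_real x) ^ j / fact j))) \<le> C * (1 / (2 * pi) * (R ^ j / fact j)) * norm (?I x)" by simp
  qed measurable
  let ?N = "norm (l2_of ?I)"
  \<comment> \<open>Gathers the factors of the final error: the bound of \<open>\<phi>\<close>, the
    constant of the inverse transform, the $L^1$ bound of \<open>g\<close> per unit of
    \<open>norm f\<close>, and the norm of the interval of \<open>x\<close>. Dividing by
    \<open>E + 1\<close> below avoids the case \<open>E = 0\<close>.\<close>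
  define E where "E = C * (1 / (2 * pi)) * (D * (sqrt (2 * pi) * ?N)) * ?N"
  have E0: "0 \<le> E" using C0 D0 by (auto simp: E_def)
  have "(\<lambda>n. (R * R) ^ n /\<^sub>R fact n) \<longlonglongrightarrow> 0"
    by (rule summable_LIMSEQ_zero) (rule summable_exp_generic)
  then have "(\<lambda>n. (R * R) ^ Suc n /\<^sub>R fact (Suc n)) \<longlonglongrightarrow> 0" by (rule LIMSEQ_Suc)
  then have "\<forall>\<^sub>F n in sequentially. (R * R) ^ Suc n /\<^sub>R fact (Suc n) < e / (E + 1)"
    by (rule order_tendstoD) (use e E0 in simp)
  then obtain n where n: "(R * R) ^ Suc n / fact (Suc n) < e / (E + 1)"
    by (auto simp: eventually_sequentially divide_inverse_commute simp del: power_Suc fact_Suc)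
  \<comment> \<open>The Taylor remainder after degree \<open>n\<close>, uniform because
    \<open>\<bar>\<eta> * x\<bar> \<le> R * R\<close> on the supports.\<close>
  define \<delta> where "\<delta> = (R * R) ^ Suc n / fact (Suc n)"
  have \<delta>0: "0 \<le> \<delta>" by (simp add: \<delta>_def)
  have E\<delta>: "E * \<delta> \<le> e"
  proof -
    have "E * \<delta> \<le> E * (e / (E + 1))" using n E0 by (intro mult_left_mono) (auto simp: \<delta>_def)
    also have "\<dots> \<le> e" using e E0 by (simp add: field_simps)
    finally show ?thesis .
  qed
  \<comment> \<open>The Taylor term of degree \<open>j\<close> splits into the function
    \<open>v j\<close> of \<open>x\<close> and a moment of order \<open>j\<close> in
    \<open>\<eta>\<close>; the approximant has rank at most \<open>n + 1\<close>.\<close>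
  define v where "v j = l2_of (\<lambda>x. \<phi> x * (of_real (1 / (2 * pi)) * ((\<i> * of_real x) ^ j / fact j)))" for j
  define F where "F f = (\<Sum>j\<le>n. scaleC_l2 (pairing (\<lambda>\<eta>. m \<eta> * of_real (\<eta> ^ j)) (fourier_l2 f)) (v j))" for f
  have "finite_rank F"
    unfolding F_def
  proof (rule finite_rank_sum)
    fix j
    show "finite_rank (\<lambda>f. scaleC_l2 (pairing (\<lambda>\<eta>. m \<eta> * of_real (\<eta> ^ j)) (fourier_l2 f)) (v j))"
      by (rule finite_rank_compose_right[OF finite_rank_pairing[OF mpow] clinear_fourier, where D="sqrt (2 * pi)"]) (simp add: norm_fourier)
  qed simp
  moreover have "norm (mult_op \<phi> (fourier_multiplier m f) - F f) \<le> e * norm f" for f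
  proof -
    define g where "g \<eta> = m \<eta> * rep_l2 (fourier_l2 f) \<eta>" for \<eta>
    have gs: "square_integrable g"
      unfolding g_def by (rule square_integrable_bounded_symbol[OF m(1)]) simp
    have [measurable]: "g \<in> borel_measurable borel" using gs by (simp add: square_integrable_def)
    have gI: "g \<eta> * ?I \<eta> = g \<eta>" for \<eta> unfolding g_def using mI[of \<eta>] by (metis mult.assoc mult.commute)
    have gint: "integrable lborel g"
      using integrable_mult_square_integrable[OF gs square_integrable_indicator[of "-R" R]] by (simp add: gI)
    have gL: "integrable_L12 g" using gs gint by (simp add: integrable_L12_def)
    have g1: "(LINT \<eta>|lborel. norm (g \<eta>)) \<le> D * (sqrt (2 * pi) * norm f) * ?N"
    proof -
      have "(LINT \<eta>|lborel. norm (g \<eta>)) = (LINT \<eta>|lborel. norm (g \<eta>) * norm (?I \<eta>))"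
        by (simp flip: norm_mult add: gI)
      also have "\<dots> \<le> norm (l2_of g) * ?N"
        by (rule integral_norm_mult_le[OF gs square_integrable_indicator])
      also have "\<dots> \<le> D * norm (fourier_l2 f) * ?N"
        using norm_mult_op_le[of m D "fourier_l2 f"] D
        by (intro mult_right_mono) (simp_all add: mult_op_def g_def[abs_def])
      finally show ?thesis by (simp add: norm_fourier)
    qed
    define P where "P x \<eta> = (\<Sum>j\<le>n. (\<i> * of_real (\<eta> * x)) ^ j / fact j)" for x \<eta>
    have gp: "integrable lborel (\<lambda>\<eta>. g \<eta> * of_real (\<eta> ^ j))" for j
      using integrable_mult_square_integrable[OF square_integrable_rep[of "fourier_l2 f"] mpow[of j]]
      by (simp add: g_def mult_ac)
    have pj: "pairing (\<lambda>\<eta>. m \<eta> * of_real (\<eta> ^ j)) (fourier_l2 f) = (LINT \<eta>|lborel. g \<eta> * of_real (\<eta> ^ j))" for j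
      unfolding pairing_def g_def by (simp add: mult_ac)
    have gPe: "g \<eta> * P x \<eta> = (\<Sum>j\<le>n. ((\<i> * of_real x) ^ j / fact j) * (g \<eta> * of_real (\<eta> ^ j)))" for x \<eta>
      unfolding P_def sum_distrib_left by (intro sum.cong) (auto simp: power_mult_distrib)
    have gPint: "integrable lborel (\<lambda>\<eta>. g \<eta> * P x \<eta>)" for x
      unfolding gPe by (intro Bochner_Integration.integrable_sum integrable_mult_right gp)
    have gP: "(LINT \<eta>|lborel. g \<eta> * P x \<eta>) = (\<Sum>j\<le>n. ((\<i> * of_real x) ^ j / fact j) * pairing (\<lambda>\<eta>. m \<eta> * of_real (\<eta> ^ j)) (fourier_l2 f))" for x
      unfolding gPe pj by (subst Bochner_Integration.integral_sum, rule integrable_mult_right, rule gp, simp only: integral_mult_right_zero)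
    let ?K = "\<lambda>x. \<phi> x * (of_real (1 / (2 * pi)) * fourier_integral 1 g x)"
    let ?T = "\<lambda>x. \<phi> x * (of_real (1 / (2 * pi)) * (LINT \<eta>|lborel. g \<eta> * P x \<eta>))"
    have Ks: "square_integrable ?K"
      by (intro square_integrable_bounded_symbol[OF \<phi>(1)] square_integrable_scale square_integrable_fourier gL) simp
    have Keq: "mult_op \<phi> (fourier_multiplier m f) = l2_of ?K"
      unfolding fourier_multiplier_eq mult_op_def[of m] g_def[symmetric, abs_def] inverse_fourier_l2_of[OF gL]
      by (rule mult_op_l2_of) (measurable, intro square_integrable_scale square_integrable_fourier gL, simp)
    have T: "square_integrable ?T \<and> F f = l2_of ?T"
    proof -
      have Tx: "?T = (\<lambda>x. \<Sum>j\<le>n. pairing (\<lambda>\<eta>. m \<eta> * of_real (\<eta> ^ j)) (fourier_l2 f) * (\<phi> x * (of_real (1 / (2 * pi)) * ((\<i> * of_real x) ^ j / fact j))))"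
        unfolding gP sum_distrib_left by (intro ext sum.cong) auto
      have "square_integrable (\<lambda>x. \<Sum>j\<in>J. a j * h j x) \<and> l2_of (\<lambda>x. \<Sum>j\<in>J. a j * h j x) = (\<Sum>j\<in>J. scaleC_l2 (a j) (l2_of (h j)))"
        if "finite J" "\<And>j. square_integrable (h j)" for J :: "nat set" and a h
        using that by (induction J rule: finite_induct)
          (auto simp: square_integrable_zero l2_of_zero square_integrable_add square_integrable_scale l2_of_add l2_of_scale)
      from this[of "{..n}" "\<lambda>j x. \<phi> x * (of_real (1 / (2 * pi)) * ((\<i> * of_real x) ^ j / fact j))", OF _ \<phi>pow]
      show ?thesis unfolding Tx F_def v_def by simp
    qed
    have "norm (?K x - ?T x) \<le> (C * (1 / (2 * pi)) * (\<delta> * (D * (sqrt (2 * pi) * norm f) * ?N))) * norm (?I x)" for x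
    proof (cases "\<bar>x\<bar> \<le> R")
      case True
      have "norm (fourier_integral 1 g x - (LINT \<eta>|lborel. g \<eta> * P x \<eta>)) = norm (LINT \<eta>|lborel. g \<eta> * (cis (x * \<eta>) - P x \<eta>))"
        unfolding fourier_integral_def
        by (subst Bochner_Integration.integral_diff[symmetric]) (auto intro: integrable_mult_cis gint gPint simp: right_diff_distrib)
      also have "\<dots> \<le> (LINT \<eta>|lborel. norm (g \<eta> * (cis (x * \<eta>) - P x \<eta>)))"
        by (rule integral_norm_bound)
      also have "\<dots> \<le> (LINT \<eta>|lborel. \<delta> * norm (g \<eta>))"
      proof (rule integral_mono)
        have "integrable lborel (\<lambda>\<eta>. g \<eta> * cis (x * \<eta>) - g \<eta> * P x \<eta>)"
          by (intro Bochner_Integration.integrable_diff integrable_mult_cis gint gPint)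
        then show "integrable lborel (\<lambda>\<eta>. norm (g \<eta> * (cis (x * \<eta>) - P x \<eta>)))"
          by (intro integrable_norm) (simp add: right_diff_distrib)
        show "integrable lborel (\<lambda>\<eta>. \<delta> * norm (g \<eta>))" using gint by simp
        fix \<eta>
        show "norm (g \<eta> * (cis (x * \<eta>) - P x \<eta>)) \<le> \<delta> * norm (g \<eta>)"
        proof (cases "\<bar>\<eta>\<bar> \<le> R")
          case \<eta>: True
          have "norm (cis (x * \<eta>) - P x \<eta>) \<le> \<bar>\<eta> * x\<bar> ^ Suc n / fact (Suc n)"
            using iexp_approx1[of "\<eta> * x" n] by (simp add: P_def cis_conv_exp mult.commute)
          also have "\<dots> \<le> \<delta>"
            unfolding \<delta>_def abs_mult using \<eta> True by (intro divide_right_mono power_mono mult_mono) auto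
          finally have "norm (cis (x * \<eta>) - P x \<eta>) * norm (g \<eta>) \<le> \<delta> * norm (g \<eta>)"
            by (rule mult_right_mono) simp
          then show ?thesis by (simp only: norm_mult mult.commute[of "norm (g \<eta>)"])
        next
          case False
          then have "g \<eta> = 0" using m(2)[of \<eta>] by (simp add: g_def)
          then show ?thesis by simp
        qed
      qed
      also have "\<dots> \<le> \<delta> * (D * (sqrt (2 * pi) * norm f) * ?N)"
        using g1 \<delta>0 by (simp add: mult_left_mono)
      finally have "norm (\<phi> x) * ((1 / (2 * pi)) * norm (fourier_integral 1 g x - (LINT \<eta>|lborel. g \<eta> * P x \<eta>)))
          \<le> C * ((1 / (2 * pi)) * (\<delta> * (D * (sqrt (2 * pi) * norm f) * ?N)))"
        using C0 by (intro mult_mono C mult_left_mono) auto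
      moreover have "?K x - ?T x = \<phi> x * (of_real (1 / (2 * pi)) * (fourier_integral 1 g x - (LINT \<eta>|lborel. g \<eta> * P x \<eta>)))"
        by (simp add: algebra_simps)
      ultimately show ?thesis
        using True by (simp add: norm_mult norm_divide indicator_def abs_le_iff mult.assoc)
    next
      case False
      then show ?thesis using \<phi>(2)[of x] by (auto simp: indicator_def)
    qed
    then have "norm (l2_of (\<lambda>x. ?K x - ?T x)) \<le> (C * (1 / (2 * pi)) * (\<delta> * (D * (sqrt (2 * pi) * norm f) * ?N))) * ?N"
      using Ks T C0 D0 \<delta>0 square_integrable_diff[of ?K ?T]
      by (intro norm_l2_of_le square_integrable_indicator) (auto simp: square_integrable_def)
    also have "\<dots> = E * \<delta> * norm f"
      by (simp add: E_def mult_ac)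
    also have "\<dots> \<le> e * norm f"
      by (intro mult_right_mono E\<delta>) simp
    finally show ?thesis
      using Ks T by (simp add: Keq l2_of_diff)
  qed
  ultimately show "\<exists>F. finite_rank F \<and> (\<forall>f. norm (mult_op \<phi> (fourier_multiplier m f) - F f) \<le> e * norm f)"
    by blast
qed

definition symbol_vanishing :: "(real \<Rightarrow> complex) \<Rightarrow> bool" where
  "symbol_vanishing m \<longleftrightarrow> bounded_symbol m \<and> (\<forall>e>0. \<exists>R. \<forall>x. \<bar>x\<bar> > R \<longrightarrow> norm (m x) \<le> e)"

lemma symbol_vanishing_cutoff:
  assumes m: "symbol_vanishing m" and e: "0 < e"
  obtains R where "0 < R" "\<And>r x. R \<le> r \<Longrightarrow> norm (m x - indicator {-r..r} x * m x) \<le> e"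
proof -
  obtain R where R: "\<And>x. \<bar>x\<bar> > R \<Longrightarrow> norm (m x) \<le> e"
    using m e unfolding symbol_vanishing_def by blast
  show thesis
  proof
    show "0 < \<bar>R\<bar> + 1" by simp
    show "norm (m x - indicator {-r..r} x * m x) \<le> e" if "\<bar>R\<bar> + 1 \<le> r" for r x
      using R[of x] that e by (auto simp: indicator_def abs_le_iff)
  qed
qed

lemma bounded_symbol_cutoff:
  assumes "bounded_symbol m" shows "bounded_symbol (\<lambda>x. indicator {-r..r} x * m x)"
proof -
  obtain C where C: "\<And>x. norm (m x) \<le> C" using assms by (auto simp: bounded_symbol_def)
  have [measurable]: "m \<in> borel_measurable borel" using assms by (auto simp: bounded_symbol_def)
  have "norm (indicator {-r..r} x * m x) \<le> C" for x
    using C[of x] norm_ge_zero[of "m x"] by (auto simp: indicator_def simp del: norm_ge_zero)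
  then show ?thesis unfolding bounded_symbol_def by auto
qed

lemma mult_op_symbol_diff:
  assumes "bounded_symbol m" "bounded_symbol n"
  shows "mult_op m f - mult_op n f = mult_op (\<lambda>x. m x - n x) f"
  using mult_op_minus[of m f n] square_integrable_bounded_symbol[OF _ square_integrable_rep[of f]] assms by simp

lemma fourier_multiplier_symbol_diff:
  assumes "bounded_symbol m" "bounded_symbol n"
  shows "fourier_multiplier m f - fourier_multiplier n f = fourier_multiplier (\<lambda>x. m x - n x) f"
  unfolding fourier_multiplier_eq by (simp add: clinear_diff[OF clinear_inverse_fourier, symmetric] mult_op_symbol_diff assms)

text \<open>Cutting both functions off outside a large interval changes the operator little in norm:
  one step replaces \<open>\<phi>\<close>, the next replaces \<open>m\<close>, and each is a small
  sup norm times a fixed bound.\<close>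

proposition approximable_mult_multiplier:
  assumes \<phi>: "symbol_vanishing \<phi>" and m: "symbol_vanishing m"
  shows "approximable (\<lambda>f. mult_op \<phi> (fourier_multiplier m f))"
  unfolding approximable_def
proof (intro allI impI)
  fix e :: real assume e: "0 < e"
  have bs: "bounded_symbol \<phi>" "bounded_symbol m" using \<phi> m by (auto simp: symbol_vanishing_def)
  have [measurable]: "\<phi> \<in> borel_measurable borel" "m \<in> borel_measurable borel"
    using bs by (auto simp: bounded_symbol_def)
  obtain C where C: "\<And>x. norm (\<phi> x) \<le> C" using bs(1) by (auto simp: bounded_symbol_def)
  have C0: "0 \<le> C" using C[of 0] norm_ge_zero order_trans by blast
  obtain D where D: "\<And>x. norm (m x) \<le> D" using bs(2) by (auto simp: bounded_symbol_def)
  have D0: "0 \<le> D" using D[of 0] norm_ge_zero order_trans by blast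
  \<comment> \<open>Chosen so that both \<open>C * d\<close> and \<open>d * D\<close> stay below
    \<open>e / 3\<close>; the last third goes to the finite rank approximation.\<close>
  define d where "d = e / 3 / (C + D + 1)"
  have d: "0 < d" using e C0 D0 by (simp add: d_def)
  have Cd: "C * d \<le> e / 3" and Dd: "d * D \<le> e / 3" using e C0 D0 by (simp_all add: d_def field_simps)
  obtain R1 where R1: "0 < R1" "\<And>r x. R1 \<le> r \<Longrightarrow> norm (\<phi> x - indicator {-r..r} x * \<phi> x) \<le> d"
    using symbol_vanishing_cutoff[OF \<phi> d] by metis
  obtain R2 where R2: "0 < R2" "\<And>r x. R2 \<le> r \<Longrightarrow> norm (m x - indicator {-r..r} x * m x) \<le> d"
    using symbol_vanishing_cutoff[OF m d] by metis
  define R where "R = max R1 R2"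
  let ?\<phi> = "\<lambda>x. indicator {-R..R} x * \<phi> x" and ?m = "\<lambda>x. indicator {-R..R} x * m x"
  have bs': "bounded_symbol ?\<phi>" "bounded_symbol ?m" using bs by (auto intro: bounded_symbol_cutoff)
  have "approximable (\<lambda>f. mult_op ?\<phi> (fourier_multiplier ?m f))"
    using R1(1) R2(1) by (intro approximable_mult_multiplier_cutoff[where R=R] bs') (auto simp: R_def indicator_def abs_le_iff)
  then obtain F where F: "finite_rank F" "\<And>f. norm (mult_op ?\<phi> (fourier_multiplier ?m f) - F f) \<le> e / 3 * norm f"
    using e unfolding approximable_def by (metis divide_pos_pos zero_less_numeral)
  have "norm (mult_op \<phi> (fourier_multiplier m f) - F f) \<le> e * norm f" for f
  proof -
    have 1: "norm (mult_op \<phi> (fourier_multiplier m f) - mult_op ?\<phi> (fourier_multiplier m f)) \<le> e / 3 * norm f"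
    proof -
      have "norm (mult_op \<phi> (fourier_multiplier m f) - mult_op ?\<phi> (fourier_multiplier m f)) \<le> d * norm (fourier_multiplier m f)"
        unfolding mult_op_symbol_diff[OF bs(1) bs'(1)] using R1(2)[of R]
        by (intro norm_mult_op_le) (auto simp: R_def)
      also have "\<dots> \<le> d * (D * norm f)"
        using d by (intro mult_left_mono norm_fourier_multiplier_le D) auto
      also have "\<dots> \<le> e / 3 * norm f"
        using mult_right_mono[OF Dd norm_ge_zero[of f]] by (simp add: mult.assoc)
      finally show ?thesis .
    qed
    have 2: "norm (mult_op ?\<phi> (fourier_multiplier m f) - mult_op ?\<phi> (fourier_multiplier ?m f)) \<le> e / 3 * norm f"
    proof -
      have "norm (?\<phi> x) \<le> C" for x using C[of x] C0 by (auto simp: indicator_def)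
      then have "norm (mult_op ?\<phi> (fourier_multiplier m f - fourier_multiplier ?m f)) \<le> C * norm (fourier_multiplier m f - fourier_multiplier ?m f)"
        by (intro norm_mult_op_le) auto
      also have "\<dots> \<le> C * (d * norm f)"
        unfolding fourier_multiplier_symbol_diff[OF bs(2) bs'(2)] using R2(2)[of R]
        by (intro mult_left_mono norm_fourier_multiplier_le C0) (auto simp: R_def)
      also have "\<dots> \<le> e / 3 * norm f"
        using mult_right_mono[OF Cd norm_ge_zero[of f]] by (simp add: mult.assoc)
      finally show ?thesis by (simp add: clinear_diff[OF clinear_mult_op[OF bs'(1)]])
    qed
    show ?thesis
      using norm_triangle_le[OF add_mono[OF norm_triangle_le[OF add_mono[OF 1 2]] F(2)[of f]]] by simp
  qed
  with F(1) show "\<exists>F. finite_rank F \<and> (\<forall>f. norm (mult_op \<phi> (fourier_multiplier m f) - F f) \<le> e * norm f)"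
    by blast
qed

subsection \<open>Fredholm operators of index zero\<close>

text \<open>A vector outside a closed subspace has positive distance \<open>d\<close> from it, so
  its coefficient \<open>e\<close> in a vector \<open>z\<close> satisfies
  \<open>norm e * d \<le> norm z\<close>. Along a convergent sequence the coefficients are then
  Cauchy, and the components in the subspace converge too.\<close>

lemma closed_span_insert:
  assumes cl: "closed (l2.span S)"
  shows "closed (l2.span (insert a S))"
proof (cases "a \<in> l2.span S")
  case True
  then show ?thesis using cl by (simp add: l2.span_redundant)
next
  case False
  have "open (- l2.span S)" using cl by (simp add: open_Compl)
  then obtain d where d: "0 < d" "ball a d \<subseteq> - l2.span S"
    using False openE[of "- l2.span S" a] by blast
  have lower: "norm e * d \<le> norm z" if z: "z - scaleC_l2 e a \<in> l2.span S" for e z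
  proof (cases "e = 0")
    case False
    define n where "n = scaleC_l2 (- 1 / e) (z - scaleC_l2 e a)"
    have n: "n \<in> l2.span S" unfolding n_def by (intro l2.span_scale z)
    have "n \<notin> ball a d" using d(2) n by blast
    then have "d \<le> norm (a - n)" by (simp add: dist_norm not_less)
    moreover have "a - n = scaleC_l2 (1 / e) z"
      using False by (simp add: n_def l2.scale_right_diff_distrib l2.scale_minus_left)
    ultimately have "d \<le> norm z / norm e" by (simp add: norm_scaleC_l2 norm_divide)
    then show ?thesis using False by (simp add: pos_le_divide_eq mult.commute)
  qed simp
  show ?thesis
    unfolding closed_sequential_limits
  proof (intro allI impI)
    fix y l assume "(\<forall>n. y n \<in> l2.span (insert a S)) \<and> y \<longlonglongrightarrow> l"
    then have y: "\<And>n. y n \<in> l2.span (insert a S)" and l: "y \<longlonglongrightarrow> l" by auto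
    from y have "\<forall>n. \<exists>c. y n - scaleC_l2 c a \<in> l2.span S" by (simp add: l2.span_insert)
    then obtain c where c: "\<And>n. y n - scaleC_l2 (c n) a \<in> l2.span S" by metis
    have cd: "norm (c m - c n) * d \<le> norm (y m - y n)" for m n
    proof (rule lower)
      have eq: "y m - y n - scaleC_l2 (c m - c n) a = (y m - scaleC_l2 (c m) a) - (y n - scaleC_l2 (c n) a)"
        by (simp add: l2.scale_left_diff_distrib)
      show "y m - y n - scaleC_l2 (c m - c n) a \<in> l2.span S"
        unfolding eq by (rule l2.span_diff[OF c c])
    qed
    have "Cauchy c"
    proof (rule CauchyI)
      fix e :: real assume "0 < e"
      then have "0 < e * d" using d(1) by simp
      from CauchyD[OF LIMSEQ_imp_Cauchy[OF l] this] obtain M where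
        M: "\<And>m n. M \<le> m \<Longrightarrow> M \<le> n \<Longrightarrow> norm (y m - y n) < e * d" by blast
      have "norm (c m - c n) < e" if "M \<le> m" "M \<le> n" for m n
      proof -
        have "norm (c m - c n) * d < e * d" using cd[of m n] M[OF that] by linarith
        then show ?thesis using d(1) by simp
      qed
      then show "\<exists>M. \<forall>m\<ge>M. \<forall>n\<ge>M. norm (c m - c n) < e" by blast
    qed
    then obtain c0 where c0: "c \<longlonglongrightarrow> c0" by (auto simp: Cauchy_convergent_iff convergent_def)
    have "(\<lambda>n. scaleC_l2 (c n) a) \<longlonglongrightarrow> scaleC_l2 c0 a"
    proof -
      have "(\<lambda>n. norm (scaleC_l2 (c n) a - scaleC_l2 c0 a)) \<longlonglongrightarrow> norm (c0 - c0) * norm a"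
        unfolding l2.scale_left_diff_distrib[symmetric] norm_scaleC_l2 by (intro tendsto_intros c0)
      then have "(\<lambda>n. norm (scaleC_l2 (c n) a - scaleC_l2 c0 a)) \<longlonglongrightarrow> 0"
        by (simp only: diff_self norm_zero mult_zero_left)
      then have "(\<lambda>n. scaleC_l2 (c n) a - scaleC_l2 c0 a) \<longlonglongrightarrow> 0"
        by (rule tendsto_norm_zero_cancel)
      then show ?thesis by (rule LIM_zero_cancel)
    qed
    from tendsto_diff[OF l this] have "l - scaleC_l2 c0 a \<in> l2.span S"
      using closed_sequentially[OF cl, of "\<lambda>n. y n - scaleC_l2 (c n) a"] c by simp
    then show "l \<in> l2.span (insert a S)" by (auto simp: l2.span_insert)
  qed
qed

lemma closed_span_Un_finite:
  assumes "finite B" "closed (l2.span W)" shows "closed (l2.span (W \<union> B))"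
  using assms by (induction B rule: finite_induct) (simp_all add: closed_span_insert)

lemma clinear_kernel_subspace: "clinear F \<Longrightarrow> l2.subspace {f. F f = 0}"
  by (rule l2_pair.linear_subspace_kernel)

lemma clinear_bounded_linear:
  assumes "clinear F" "\<And>f. norm (F f) \<le> C * norm f" shows "bounded_linear F"
  by (rule bounded_linear_intro[where K=C])
    (use assms in \<open>simp_all add: clinear_add scaleR_l2_conv clinear_scale mult.commute\<close>)

lemma finite_rank_preimage_basis:
  assumes F: "finite_rank F" and U: "l2.subspace U"
  obtains C where "finite C" "C \<subseteq> U" "F ` U \<subseteq> l2.span (F ` C)"
proof -
  from F obtain B where B: "finite B" "range F \<subseteq> l2.span B" unfolding finite_rank_def by blast
  obtain D where D: "D \<subseteq> F ` U" "l2.independent D" "F ` U \<subseteq> l2.span D"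
    using l2.maximal_independent_subset by metis
  have "finite D"
    using l2.independent_span_bound[OF B(1) D(2)] D(1) B(2) by blast
  moreover obtain C where "C \<subseteq> U" "finite C" "D = F ` C"
    using finite_subset_image[OF \<open>finite D\<close> D(1)] by blast
  ultimately show thesis using that D(3) by blast
qed

lemma finite_rank_decompose:
  assumes F: "finite_rank F" and U: "l2.subspace U" and C: "C \<subseteq> U" "F ` U \<subseteq> l2.span (F ` C)" and x: "x \<in> U"
  obtains c where "c \<in> l2.span C" "c \<in> U" "x - c \<in> U" "F (x - c) = 0"
proof -
  have lin: "clinear F" using F by (simp add: finite_rank_def)
  have "F x \<in> F ` l2.span C"
    using C(2) x by (auto simp: l2_pair.linear_span_image[OF lin])
  then obtain c where c: "c \<in> l2.span C" "F x = F c" by auto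
  have "c \<in> U" using c(1) l2.span_minimal[OF C(1) U] by blast
  moreover have "x - c \<in> U" using l2.subspace_diff[OF U x \<open>c \<in> U\<close>] .
  ultimately show thesis using that c by (simp add: clinear_diff[OF lin])
qed

text \<open>On the closed, finite-codimensional kernel of \<open>F\<close> the map is the identity.
  Its range is therefore that kernel plus the span of finitely many images.\<close>

lemma closed_range_id_plus_finite_rank:
  assumes F: "finite_rank F"
  shows "closed (range (\<lambda>f. f + F f))"
proof -
  have lin: "clinear F" using F by (simp add: finite_rank_def)
  have linS: "clinear (\<lambda>f. f + F f)"
    by (rule clinearI) (simp_all add: clinear_add[OF lin] clinear_scale[OF lin] l2.scale_right_distrib)
  let ?W = "{f. F f = 0}"
  obtain C where C: "finite C" "C \<subseteq> UNIV" "range F \<subseteq> l2.span (F ` C)"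
    by (rule finite_rank_preimage_basis[OF F l2.subspace_UNIV])
  have W: "l2.subspace ?W" by (rule clinear_kernel_subspace[OF lin])
  have cl: "closed ?W"
  proof -
    obtain K where "\<And>f. norm (F f) \<le> K * norm f" using F unfolding finite_rank_def by blast
    then have "continuous_on UNIV F"
      using clinear_bounded_linear[OF lin] linear_continuous_on by blast
    then show ?thesis
      using closed_vimage[of "{0}" F] by (simp add: vimage_def)
  qed
  have U: "l2.span (?W \<union> C) = UNIV"
  proof (intro equalityI subset_UNIV subsetI)
    fix x
    obtain c where c: "c \<in> l2.span C" "F (x - c) = 0"
      using finite_rank_decompose[OF F l2.subspace_UNIV C(2,3), of x] by auto
    have "x - c \<in> l2.span (?W \<union> C)" using c(2) by (intro l2.span_base) auto
    moreover have "c \<in> l2.span (?W \<union> C)" using c(1) l2.span_mono[of C "?W \<union> C"] by blast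
    ultimately show "x \<in> l2.span (?W \<union> C)" using l2.span_add by fastforce
  qed
  have "range (\<lambda>f. f + F f) = l2.span ((\<lambda>f. f + F f) ` (?W \<union> C))"
    unfolding l2_pair.linear_span_image[OF linS] U ..
  also have "(\<lambda>f. f + F f) ` (?W \<union> C) = ?W \<union> (\<lambda>f. f + F f) ` C"
    by (auto simp: image_Un image_iff)
  also have "closed (l2.span (?W \<union> (\<lambda>f. f + F f) ` C))"
    using C(1) cl by (intro closed_span_Un_finite) (simp_all add: l2.span_eq_iff[THEN iffD2, OF W])
  finally show ?thesis .
qed

lemma l2_basis_extension_card:
  assumes "finite B" "N \<subseteq> V" "l2.independent N" "V \<subseteq> l2.span B"
  obtains C where "finite C" "C \<inter> N = {}" "C \<subseteq> V" "l2.independent (N \<union> C)" "V \<subseteq> l2.span (N \<union> C)"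
    "card N + card C = l2.dim V"
proof -
  obtain D where D: "N \<subseteq> D" "D \<subseteq> V" "l2.independent D" "V \<subseteq> l2.span D"
    using l2.maximal_independent_subset_extend[OF assms(2,3)] by metis
  have fin: "finite D" using l2.independent_span_bound[OF assms(1) D(3)] D(2) assms(4) by blast
  have "card D = l2.dim V" using l2.basis_card_eq_dim D by blast
  moreover have "card D = card N + card (D - N)"
    using fin D(1) by (metis card_Diff_subset card_mono finite_subset le_add_diff_inverse)
  moreover have "N \<union> (D - N) = D" using D(1) by blast
  ultimately show thesis using that[of "D - N"] fin D by auto
qed

text \<open>The index count: inside the finite-dimensional space \<open>V = span B\<close> containing the range of \<open>F\<close>,
  rank-nullity gives a complement \<open>C\<close> of the range of \<open>I + F\<close> with as many elements as a basis of the kernel;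
  \<open>q = - g \<circ> F\<close> vanishes on that range and fixes \<open>C\<close>, so no smaller complement exists.\<close>

lemma index_id_plus_finite_rank:
  assumes F: "finite_rank F"
  defines "S \<equiv> \<lambda>f. f + F f"
  shows "\<exists>C. finite C \<and> l2.span (range S \<union> C) = UNIV"
    and "\<exists>B. finite B \<and> l2.span B = {f. S f = 0}"
    and "codim (range S) = l2.dim {f. S f = 0}"
proof -
  from F obtain B where lin: "clinear F" and B: "finite B" "range F \<subseteq> l2.span B"
    unfolding finite_rank_def by blast
  define V where "V = l2.span B"
  define N where "N = {f. S f = 0}"
  have V: "l2.subspace V" "range F \<subseteq> V" "V \<subseteq> l2.span B" using B by (auto simp: V_def)
  have linS: "clinear S"
    unfolding S_def by (rule clinearI) (simp_all add: clinear_add[OF lin] clinear_scale[OF lin] l2.scale_right_distrib)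
  have NV: "N \<subseteq> V"
  proof
    fix x assume "x \<in> N"
    then have "x = - F x" by (simp add: N_def S_def eq_neg_iff_add_eq_0)
    then show "x \<in> V" using V(2) l2.subspace_neg[OF V(1), of "F x"] by auto
  qed
  have SV: "S x \<in> V" if "x \<in> V" for x
    unfolding S_def using that V(1,2) by (auto intro: l2.subspace_add)
  have SF: "F (S y) = S (F y)" for y by (simp add: S_def clinear_add[OF lin])
  have Nsub: "l2.subspace N" unfolding N_def by (rule clinear_kernel_subspace[OF linS])
  obtain N0 where N0: "N0 \<subseteq> N" "l2.independent N0" "N \<subseteq> l2.span N0" "card N0 = l2.dim N"
    using l2.basis_exists by blast
  have N0V: "N0 \<subseteq> V" using N0(1) NV by blast
  have finN0: "finite N0"
    using l2.independent_span_bound[OF B(1) N0(2)] N0V V(3) by blast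
  have spanN0: "l2.span N0 = N" using N0(1,3) l2.span_minimal[OF N0(1) Nsub] by blast
  show "\<exists>B. finite B \<and> l2.span B = {f. S f = 0}" using finN0 spanN0 by (auto simp: N_def)
  obtain C1 where C1: "finite C1" "C1 \<inter> N0 = {}" "C1 \<subseteq> V" "l2.independent (N0 \<union> C1)" "V \<subseteq> l2.span (N0 \<union> C1)"
    "card N0 + card C1 = l2.dim V"
    by (rule l2_basis_extension_card[OF B(1) N0V N0(2) V(3)])
  have SVC: "S x \<in> l2.span (S ` C1)" if "x \<in> V" for x
  proof -
    have "S x \<in> l2.span (S ` (N0 \<union> C1))"
      unfolding l2_pair.linear_span_image[OF linS] using that C1(5) by blast
    moreover have "S ` N0 \<subseteq> {0}" using N0(1) by (auto simp: N_def)
    then have "l2.span (S ` (N0 \<union> C1)) \<subseteq> l2.span (insert 0 (S ` C1))"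
      by (intro l2.span_mono) auto
    ultimately show ?thesis by (auto simp: l2.span_insert_0)
  qed
  \<comment> \<open>\<open>g\<close> projects along \<open>C1\<close> onto the kernel: it kills
    \<open>span C1\<close> and fixes \<open>span N0\<close>, so the two meet only in 0.\<close>
  have inj: "inj_on S (l2.span C1)"
  proof -
    obtain g where g: "clinear g" "\<And>x. x \<in> N0 \<union> C1 \<Longrightarrow> g x = (if x \<in> N0 then x else 0)"
      using l2_pair.linear_independent_extend[OF C1(4), of "\<lambda>x. if x \<in> N0 then x else 0"] by auto
    have "x = y" if "x \<in> l2.span C1" "y \<in> l2.span C1" "S x = S y" for x y
    proof -
      have d: "x - y \<in> l2.span C1" using that by (simp add: l2.span_diff)
      have g0: "g (x - y) = 0"
        by (rule l2_pair.linear_eq_0_on_span[OF g(1) _ d]) (use g(2) C1(2) in auto)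
      have "S (x - y) = 0" using that(3) by (simp add: clinear_diff[OF linS])
      then have "x - y \<in> l2.span N0" by (simp add: spanN0 N_def)
      then have "g (x - y) = x - y"
        by (rule l2_pair.linear_eq_on[OF g(1) l2.linear_ident]) (use g(2) in auto)
      then show "x = y" using g0 by simp
    qed
    then show ?thesis by (rule inj_onI)
  qed
  have indS: "l2.independent (S ` C1)"
    using l2_pair.linear_independent_injective_image[OF linS _ inj] C1(4) l2.independent_mono by blast
  have cardS: "card (S ` C1) = card C1"
    using inj by (intro card_image) (meson inj_on_subset l2.span_superset)
  have "S ` C1 \<subseteq> V" using C1(3) SV by blast
  then obtain C0 where C0: "finite C0" "C0 \<inter> S ` C1 = {}" "C0 \<subseteq> V" "l2.independent (S ` C1 \<union> C0)" "V \<subseteq> l2.span (S ` C1 \<union> C0)"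
    "card (S ` C1) + card C0 = l2.dim V"
    using l2_basis_extension_card[OF B(1) _ indS V(3)] by metis
  have cardC0: "card C0 = card N0" using C0(6) C1(6) cardS by simp
  have U: "l2.span (range S \<union> C0) = UNIV"
  proof (intro equalityI subset_UNIV subsetI)
    fix x
    have "F x \<in> l2.span (S ` C1 \<union> C0)" using V(2) C0(5) by blast
    then have "F x \<in> l2.span (range S \<union> C0)" using l2.span_mono[of "S ` C1 \<union> C0" "range S \<union> C0"] by blast
    moreover have "S x \<in> l2.span (range S \<union> C0)" by (intro l2.span_base) auto
    ultimately have "S x - F x \<in> l2.span (range S \<union> C0)" by (intro l2.span_diff)
    then show "x \<in> l2.span (range S \<union> C0)" by (simp add: S_def)
  qed
  then show "\<exists>C. finite C \<and> l2.span (range S \<union> C) = UNIV" using C0(1) by blast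
  obtain g where g: "clinear g" "\<And>x. x \<in> S ` C1 \<union> C0 \<Longrightarrow> g x = (if x \<in> C0 then x else 0)"
    using l2_pair.linear_independent_extend[OF C0(4), of "\<lambda>x. if x \<in> C0 then x else 0"] by auto
  have gS: "g (S x) = 0" if "x \<in> V" for x
    by (rule l2_pair.linear_eq_0_on_span[OF g(1) _ SVC[OF that]]) (use g(2) C0(2) in auto)
  define q where "q x = - g (F x)" for x
  have linq: "clinear q"
    unfolding q_def by (rule clinearI)
      (simp_all add: clinear_add[OF lin] clinear_add[OF g(1)] clinear_scale[OF lin] clinear_scale[OF g(1)])
  have qR: "q (S y) = 0" for y unfolding q_def SF using gS V(2) by auto
  have qC: "q c = c" if "c \<in> C0" for c
  proof -
    have "q c = g c - g (S c)"
      unfolding q_def S_def by (simp add: clinear_add[OF g(1)])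
    then show ?thesis using gS[of c] C0(3) that g(2)[of c] by auto
  qed
  have "card N0 \<le> n" if n: "\<exists>C. finite C \<and> card C = n \<and> l2.span (range S \<union> C) = UNIV" for n
  proof -
    obtain C where C: "finite C" "card C = n" "l2.span (range S \<union> C) = UNIV" using n by blast
    have indC0: "l2.independent C0" using C0(4) l2.independent_mono by blast
    have "range q = l2.span (q ` (range S \<union> C))"
      unfolding l2_pair.linear_span_image[OF linq] C(3) ..
    also have "\<dots> \<subseteq> l2.span (insert 0 (q ` C))"
      using qR by (intro l2.span_mono) auto
    finally have "C0 \<subseteq> l2.span (q ` C)"
      using qC by (auto simp: l2.span_insert_0) (metis rangeI subsetD)
    then have "card C0 \<le> card (q ` C)"
      using l2.independent_span_bound[OF _ indC0, of "q ` C"] C(1) by blast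
    also have "\<dots> \<le> n" using card_image_le[OF C(1), of q] C(2) by simp
    finally show ?thesis using cardC0 by simp
  qed
  moreover have "\<exists>C. finite C \<and> card C = card N0 \<and> l2.span (range S \<union> C) = UNIV"
    using C0(1) cardC0 U by blast
  ultimately have "codim (range S) = card N0"
    unfolding codim_def by (intro Least_equality) auto
  then show "codim (range S) = l2.dim {f. S f = 0}" using N0(4) by (simp add: N_def)
qed

lemma l2_dim_image_inj:
  assumes J: "clinear J" "inj J"
  shows "l2.dim (J ` N) = l2.dim N"
proof -
  obtain B where B: "B \<subseteq> N" "l2.independent B" "N \<subseteq> l2.span B" "card B = l2.dim N"
    using l2.basis_exists by blast
  have "l2.independent (J ` B)"
    using l2_pair.linear_independent_injective_image[OF J(1) B(2)] J(2) inj_on_subset by blast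
  moreover have "J ` N \<subseteq> l2.span (J ` B)"
    using B(3) by (auto simp: l2_pair.linear_span_image[OF J(1)])
  moreover have "card (J ` B) = card B"
    using J(2) by (intro card_image) (meson inj_on_subset subset_UNIV)
  ultimately show ?thesis
    using l2.basis_card_eq_dim[of "J ` B" "J ` N"] B(1,4) by (auto simp: image_mono)
qed

text \<open>\<open>J\<close> parametrizes the domain by all of $L^2$. It leaves the range unchanged
  and carries the kernel over injectively, so only its algebra matters and no topology on
  \<open>D\<close> enters.\<close>

lemma fredholm_factor_id_plus_finite_rank:
  assumes J: "clinear J" "inj J" "range J = D" and F: "finite_rank F" and P: "\<And>f. P (J f) = f + F f"
  shows "fredholm D P" "fredholm_index D P = 0"
proof -
  let ?S = "\<lambda>f. f + F f"
  have ker: "op_kernel D P = J ` {f. ?S f = 0}"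
    unfolding op_kernel_def J(3)[symmetric] using P by auto
  have ran: "P ` D = range ?S"
    unfolding J(3)[symmetric] image_image P ..
  note idx = index_id_plus_finite_rank[OF F]
  obtain B where B: "finite B" "l2.span B = {f. ?S f = 0}" using idx(2) by blast
  have "l2.span (J ` B) = op_kernel D P"
    unfolding ker B(2)[symmetric] l2_pair.linear_span_image[OF J(1)] ..
  then have "finite_dim (op_kernel D P)" using B(1) unfolding finite_dim_def by blast
  then show "fredholm D P"
    unfolding fredholm_def ran finite_codim_def using idx(1) closed_range_id_plus_finite_rank[OF F] by blast
  show "fredholm_index D P = 0"
    unfolding fredholm_index_def ran idx(3) ker by (simp add: l2_dim_image_inj J)
qed

text \<open>Solving \<open>M x + E x = y\<close> is a fixed point problem for
  \<open>M' (y - E x)\<close>, a contraction with factor 1/2. Absorbing that half in the a priori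
  estimate gives the bound \<open>2 * C\<close> for the inverse.\<close>

lemma small_perturbation_inverse:
  assumes M: "clinear M" "clinear M'" "\<And>f. M (M' f) = f" "\<And>f. M' (M f) = f" "\<And>f. norm (M' f) \<le> C * norm f"
    and E: "clinear E" "\<And>f. norm (E f) \<le> e * norm f" and Ce: "0 < C" "C * e \<le> 1 / 2" "0 \<le> e"
  obtains G where "clinear G" "inj G" "surj G" "\<And>f. M (G f) + E (G f) = f" "\<And>f. norm (G f) \<le> 2 * C * norm f"
proof -
  let ?A = "\<lambda>f. M f + E f"
  have linA: "clinear ?A"
    by (rule clinearI) (simp_all add: clinear_add[OF M(1)] clinear_add[OF E(1)] clinear_scale[OF M(1)] clinear_scale[OF E(1)] l2.scale_right_distrib)
  have ME: "norm (M' (E f)) \<le> 1 / 2 * norm f" for f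
  proof -
    have "norm (M' (E f)) \<le> C * norm (E f)" by (rule M(5))
    also have "\<dots> \<le> C * (e * norm f)" using Ce(1) by (intro mult_left_mono E) simp
    also have "\<dots> \<le> 1 / 2 * norm f" using mult_right_mono[OF Ce(2) norm_ge_zero[of f]] by (simp add: mult.assoc)
    finally show ?thesis .
  qed
  have lower: "norm f \<le> 2 * C * norm (?A f)" for f
  proof -
    have "M' (?A f) = f + M' (E f)" by (simp add: clinear_add[OF M(2)] M(4))
    then have "norm f \<le> norm (M' (?A f)) + norm (M' (E f))"
      by (metis add_diff_cancel_right' norm_triangle_ineq4)
    then have "norm f \<le> C * norm (?A f) + 1 / 2 * norm f" using M(5)[of "?A f"] ME[of f] by linarith
    then show ?thesis by simp
  qed
  have injA: "f = g" if "?A f = ?A g" for f g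
  proof -
    have "?A (f - g) = 0" using that clinear_diff[OF linA, of f g] by simp
    then show ?thesis using lower[of "f - g"] by simp
  qed
  have "\<exists>x. ?A x = y" for y
  proof -
    have "\<exists>!x. M' (y - E x) = x"
    proof (rule banach_fix_type[of "1/2"])
      show "\<forall>x z. dist (M' (y - E x)) (M' (y - E z)) \<le> 1 / 2 * dist x z"
      proof (intro allI)
        fix x z
        have "M' (y - E x) - M' (y - E z) = M' (E (z - x))"
          by (simp add: clinear_diff[OF M(2), symmetric] clinear_diff[OF E(1)])
        then show "dist (M' (y - E x)) (M' (y - E z)) \<le> 1 / 2 * dist x z"
          using ME[of "z - x"] by (simp add: dist_norm norm_minus_commute)
      qed
    qed auto
    then obtain x where "M' (y - E x) = x" by blast
    then have "M x = y - E x" using M(3)[of "y - E x"] by simp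
    then show ?thesis by (intro exI[of _ x]) simp
  qed
  then obtain G where G: "\<And>y. ?A (G y) = y" by metis
  have GA: "G (?A f) = f" for f by (rule injA) (rule G)
  show thesis
  proof
    show "clinear G"
      by (rule clinearI; rule injA) (simp_all only: clinear_add[OF linA] clinear_scale[OF linA] G)
    show "inj G" using G by (rule inj_on_inverseI)
    show "surj G" using GA by (rule surjI)
    show "M (G f) + E (G f) = f" for f by (rule G)
    show "norm (G f) \<le> 2 * C * norm f" for f using lower[of "G f"] by (simp add: G)
  qed
qed

lemma finite_rank_clinear: "finite_rank F \<Longrightarrow> clinear F"
  by (simp add: finite_rank_def)

text \<open>Splitting \<open>K\<close> into finite rank \<open>F\<close> and a remainder small
  against the inverse of \<open>M\<close>, the map \<open>M + (K - F)\<close> has an inverse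
  \<open>G\<close>. Along \<open>J \<circ> G\<close> the operator \<open>P\<close> becomes the
  identity plus \<open>F \<circ> G\<close>.\<close>

proposition fredholm_invertible_plus_approximable:
  assumes J: "clinear J" "inj J" "range J = D"
    and M: "clinear M" "clinear M'" "\<And>f. M (M' f) = f" "\<And>f. M' (M f) = f" "\<And>f. norm (M' f) \<le> C * norm f"
    and K: "clinear K" "approximable K" and P: "\<And>f. P (J f) = M f + K f"
  shows "fredholm D P" "fredholm_index D P = 0"
proof -
  \<comment> \<open>A strictly positive bound for \<open>M'\<close>, needed for the tolerance
    \<open>1 / (2 * C')\<close>.\<close>
  define C' where "C' = \<bar>C\<bar> + 1"
  have C': "0 < C'" by (simp add: C'_def)
  have M'C: "norm (M' f) \<le> C' * norm f" for f
  proof -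
    have "C * norm f \<le> C' * norm f" unfolding C'_def by (intro mult_right_mono) auto
    then show ?thesis using M(5)[of f] by linarith
  qed
  have "0 < 1 / (2 * C')" using C' by simp
  then obtain F where F: "finite_rank F" "\<And>f. norm (K f - F f) \<le> 1 / (2 * C') * norm f"
    using K(2) unfolding approximable_def by blast
  note linF = finite_rank_clinear[OF F(1)]
  have E: "clinear (\<lambda>f. K f - F f)"
    by (rule clinearI) (simp_all add: clinear_add[OF K(1)] clinear_add[OF linF] clinear_scale[OF K(1)] clinear_scale[OF linF] l2.scale_right_diff_distrib)
  obtain G where G: "clinear G" "inj G" "surj G" "\<And>f. M (G f) + (K (G f) - F (G f)) = f" "\<And>f. norm (G f) \<le> 2 * C' * norm f"
    by (rule small_perturbation_inverse[OF M(1-4) M'C E F(2) C']) (use C' in auto)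
  have 1: "clinear (\<lambda>f. J (G f))" using Vector_Spaces.linear_compose[OF G(1) J(1)] by (simp add: o_def)
  have 2: "inj (\<lambda>f. J (G f))" using inj_compose[OF J(2) G(2)] by (simp add: o_def)
  have 3: "range (\<lambda>f. J (G f)) = D" using J(3) G(3) by (metis image_image)
  have 4: "finite_rank (\<lambda>f. F (G f))" by (rule finite_rank_compose_right[OF F(1) G(1,5)])
  have 5: "P (J (G f)) = f + F (G f)" for f
    using G(4)[of f] P[of "G f"] by (simp add: algebra_simps)
  show "fredholm D P" "fredholm_index D P = 0"
    using fredholm_factor_id_plus_finite_rank[OF 1 2 3 4, of P] 5 by auto
qed

subsection \<open>Operators with closed range\<close>

text \<open>The open mapping theorem for \<open>L\<close> onto its range. Baire gives approximate
  preimages of controlled size that halve the residual, and iterating sums them to an exact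
  preimage.\<close>

lemma closed_range_preimage_bound:
  fixes L :: "'a::banach \<Rightarrow> 'b::banach"
  assumes L: "bounded_linear L" and cl: "closed (range L)"
  obtains C where "0 < C" "\<And>y. y \<in> range L \<Longrightarrow> \<exists>x. L x = y \<and> norm x \<le> C * norm y"
proof -
  interpret L: bounded_linear L by fact
  let ?Y = "range L"
  let ?X = "top_of_set ?Y"
  define T where "T n = closure (L ` ball 0 (real n))" for n :: nat
  have TY: "T n \<subseteq> ?Y" for n
    unfolding T_def using cl by (intro closure_minimal) auto
  have un: "\<Union>(range T) = ?Y"
  proof
    show "\<Union>(range T) \<subseteq> ?Y" using TY by blast
    show "?Y \<subseteq> \<Union>(range T)"
    proof
      fix y assume "y \<in> ?Y"
      then obtain x where x: "y = L x" by blast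
      obtain n :: nat where "norm x < real n" using reals_Archimedean2 by blast
      then have "y \<in> T n" unfolding T_def x by (intro closure_subset[THEN subsetD]) auto
      then show "y \<in> \<Union>(range T)" by blast
    qed
  qed
  \<comment> \<open>Closedness makes the range itself completely metrizable, so Baire category
    applies inside it.\<close>
  have cm: "completely_metrizable_space ?X"
    by (rule completely_metrizable_space_closedin[OF completely_metrizable_space_euclidean]) (use cl in simp)
  have int: "?X interior_of (\<Union>(range T)) = ?Y"
    unfolding un using interior_of_topspace[of ?X] by simp
  have "\<exists>n. ?X interior_of (T n) \<noteq> {}"
  proof (rule ccontr)
    assume "\<nexists>n. ?X interior_of (T n) \<noteq> {}"
    moreover have "closedin ?X (T n)" for n
      by (rule closed_subset[OF TY]) (simp add: T_def)
    ultimately have "?X interior_of (\<Union>(range T)) = {}"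
      by (intro Baire_category_alt[OF disjI1[OF cm]]) auto
    then show False unfolding int by blast
  qed
  then obtain n where "?X interior_of (T n) \<noteq> {}" by blast
  then obtain y0 where y0: "y0 \<in> ?X interior_of (T n)" by blast
  have "openin ?X (?X interior_of (T n))" by simp
  from iffD1[OF openin_euclidean_subtopology_iff this] obtain r where r: "0 < r" "\<And>y. y \<in> ?Y \<Longrightarrow> dist y y0 < r \<Longrightarrow> y \<in> ?X interior_of (T n)"
    using y0 by blast
  have y0Y: "y0 \<in> ?Y" and y0T: "y0 \<in> T n"
    using y0 interior_of_subset[of ?X "T n"] TY by auto
  define N where "N = real n"
  have approach: "\<exists>a. norm a < N \<and> norm (L a - w) < r / 8" if "w \<in> T n" for w
  proof -
    have "0 < r / 8" using r(1) by simp
    with that have "\<exists>v\<in>L ` ball 0 N. dist v w < r / 8"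
      unfolding T_def N_def closure_approachable by blast
    then show ?thesis by (auto simp: dist_norm)
  qed
  have half: "\<exists>x. norm x \<le> (4 * N / r) * norm y \<and> norm (y - L x) \<le> norm y / 2" if y: "y \<in> ?Y" for y
  proof (cases "y = 0")
    case True
    then show ?thesis by (intro exI[of _ 0]) (simp add: L.zero)
  next
    case False
    \<comment> \<open>Scales \<open>y\<close> to norm \<open>r / 2\<close>, so that
      \<open>y0 + s y\<close> stays within the ball about \<open>y0\<close>. The base point cancels
      in the difference of approximants, leaving an error of \<open>r / 8 + r / 8\<close>, which
      scales back to \<open>norm y / 2\<close>.\<close>
    define s where "s = r / (2 * norm y)"
    have s: "0 < s" using False r(1) by (simp add: s_def)
    have sy: "norm (s *\<^sub>R y) = r / 2" using False r(1) by (simp add: s_def)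
    have "y0 + s *\<^sub>R y \<in> ?Y"
      using y y0Y by (auto simp: image_iff) (metis L.add L.scaleR)
    then have "y0 + s *\<^sub>R y \<in> T n"
      using r(2)[of "y0 + s *\<^sub>R y"] interior_of_subset[of ?X "T n"] r(1) sy by (auto simp: dist_norm)
    then obtain a where a: "norm a < N" "norm (L a - (y0 + s *\<^sub>R y)) < r / 8"
      using approach by blast
    obtain b where b: "norm b < N" "norm (L b - y0) < r / 8"
      using approach[OF y0T] by blast
    define x where "x = (1 / s) *\<^sub>R (a - b)"
    have "norm x \<le> (1 / s) * (2 * N)"
    proof -
      have "norm (a - b) \<le> 2 * N" using norm_triangle_ineq4[of a b] a(1) b(1) by linarith
      then show ?thesis unfolding x_def using s by (simp add: divide_right_mono)
    qed
    also have "\<dots> = (4 * N / r) * norm y" using False r(1) by (simp add: s_def)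
    finally have x: "norm x \<le> (4 * N / r) * norm y" .
    have "y - L x = (1 / s) *\<^sub>R (s *\<^sub>R y - L (a - b))"
    proof -
      have "L x = (1 / s) *\<^sub>R L (a - b)" unfolding x_def by (rule L.scaleR)
      then show ?thesis using s by (simp add: scaleR_diff_right)
    qed
    also have "s *\<^sub>R y - L (a - b) = (L b - y0) - (L a - (y0 + s *\<^sub>R y))"
      by (simp add: L.diff)
    finally have "norm (y - L x) = (1 / s) * norm ((L b - y0) - (L a - (y0 + s *\<^sub>R y)))"
      using s by simp
    also have "\<dots> \<le> (1 / s) * (r / 4)"
      using norm_triangle_ineq4[of "L b - y0" "L a - (y0 + s *\<^sub>R y)"] a(2) b(2) s
      by (intro mult_left_mono) auto
    also have "\<dots> = norm y / 2" using False r(1) by (simp add: s_def)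
    finally show ?thesis using x by blast
  qed
  define C where "C = 4 * N / r"
  have C0: "0 \<le> C" using r(1) by (simp add: C_def N_def)
  obtain h where h: "\<And>y. y \<in> ?Y \<Longrightarrow> norm (h y) \<le> C * norm y" "\<And>y. y \<in> ?Y \<Longrightarrow> norm (y - L (h y)) \<le> norm y / 2"
    using half unfolding C_def by metis
  \<comment> \<open>The geometric series contributes \<open>2 * C\<close>; the extra 1 only makes
    the constant positive.\<close>
  have "\<exists>x. L x = y \<and> norm x \<le> (2 * C + 1) * norm y" if y: "y \<in> ?Y" for y
  proof -
    \<comment> \<open>The successive residuals, starting from \<open>y\<close>; the partial sums of
      corrections telescope to \<open>y - z n\<close>.\<close>
    define z where "z k = ((\<lambda>w. w - L (h w)) ^^ k) y" for k
    have zS: "z (Suc k) = z k - L (h (z k))" for k by (simp add: z_def)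
    have zY: "z k \<in> ?Y" for k
    proof (induction k)
      case 0 then show ?case using y by (simp add: z_def)
    next
      case (Suc k)
      then obtain w where "z k = L w" by blast
      then have "z (Suc k) = L (w - h (z k))" by (simp add: zS L.diff)
      then show ?case by blast
    qed
    have zn: "norm (z k) \<le> norm y * (1/2) ^ k" for k
    proof (induction k)
      case (Suc k)
      then show ?case using h(2)[OF zY[of k]] by (simp add: zS)
    qed (simp add: z_def)
    have hb: "norm (h (z k)) \<le> C * norm y * (1/2) ^ k" for k
      using h(1)[OF zY[of k]] mult_left_mono[OF zn[of k] C0] by simp
    have sg: "summable (\<lambda>k. C * norm y * (1/2) ^ k)"
      by (intro summable_mult summable_geometric) simp
    have sn: "summable (\<lambda>k. norm (h (z k)))"
      by (rule summable_comparison_test'[OF sg, of 0]) (simp add: hb)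
    define x where "x = (\<Sum>k. h (z k))"
    have sx: "(\<lambda>n. \<Sum>k<n. h (z k)) \<longlonglongrightarrow> x"
      unfolding x_def by (rule summable_LIMSEQ[OF summable_norm_cancel[OF sn]])
    have "norm x \<le> (\<Sum>k. norm (h (z k)))" unfolding x_def by (rule summable_norm[OF sn])
    also have "\<dots> \<le> (\<Sum>k. C * norm y * (1/2) ^ k)" by (intro suminf_le hb sn sg)
    also have "\<dots> = 2 * C * norm y" by (subst suminf_mult) (simp_all add: suminf_geometric)
    also have "\<dots> \<le> (2 * C + 1) * norm y" by (simp add: distrib_right)
    finally have nx: "norm x \<le> (2 * C + 1) * norm y" .
    have part: "L (\<Sum>k<n. h (z k)) = y - z n" for n
      by (induction n) (simp_all add: L.zero L.add zS, simp add: z_def)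
    have "(\<lambda>n. y - z n) \<longlonglongrightarrow> L x"
      using L.tendsto[OF sx] by (simp add: part)
    moreover have "z \<longlonglongrightarrow> 0"
    proof (rule Lim_null_comparison)
      show "\<forall>\<^sub>F k in sequentially. norm (z k) \<le> norm y * (1/2) ^ k" using zn by simp
      show "(\<lambda>k. norm y * (1/2) ^ k) \<longlonglongrightarrow> 0"
        by (intro tendsto_mult_right_zero LIMSEQ_power_zero) simp
    qed
    then have "(\<lambda>n. y - z n) \<longlonglongrightarrow> y - 0" by (intro tendsto_diff tendsto_const)
    ultimately have "L x = y" using LIMSEQ_unique by force
    with nx show ?thesis by blast
  qed
  moreover have "0 < 2 * C + 1" using C0 by simp
  ultimately show thesis using that by blast
qed

definition infinite_dim :: "l2 set \<Rightarrow> bool" where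
  "infinite_dim U \<longleftrightarrow> \<not> (\<exists>B. finite B \<and> U \<subseteq> l2.span B)"

text \<open>By \<open>finite_rank_decompose\<close>, \<open>U\<close> exceeds this intersection by a
  finite-dimensional space only.\<close>

lemma infinite_dim_inter_kernel:
  assumes U: "l2.subspace U" "infinite_dim U" and F: "finite_rank F"
  shows "l2.subspace (U \<inter> {f. F f = 0})" "infinite_dim (U \<inter> {f. F f = 0})"
proof -
  show "l2.subspace (U \<inter> {f. F f = 0})"
    by (intro l2.subspace_inter U clinear_kernel_subspace finite_rank_clinear F)
  obtain C where C: "finite C" "C \<subseteq> U" "F ` U \<subseteq> l2.span (F ` C)"
    by (rule finite_rank_preimage_basis[OF F U(1)])
  show "infinite_dim (U \<inter> {f. F f = 0})"
    unfolding infinite_dim_def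
  proof
    assume "\<exists>B. finite B \<and> U \<inter> {f. F f = 0} \<subseteq> l2.span B"
    then obtain B where B: "finite B" "U \<inter> {f. F f = 0} \<subseteq> l2.span B" by blast
    have "U \<subseteq> l2.span (B \<union> C)"
    proof
      fix x assume "x \<in> U"
      then obtain c where c: "c \<in> l2.span C" "x - c \<in> U" "F (x - c) = 0"
        by (rule finite_rank_decompose[OF F U(1) C(2,3)])
      have "x - c \<in> l2.span (B \<union> C)" using c B(2) l2.span_mono[of B "B \<union> C"] by blast
      moreover have "c \<in> l2.span (B \<union> C)" using c(1) l2.span_mono[of C "B \<union> C"] by blast
      ultimately show "x \<in> l2.span (B \<union> C)" using l2.span_add by fastforce
    qed
    then show False using U(2) B(1) C(1) unfolding infinite_dim_def by (meson finite_UnI)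
  qed
qed

lemma inner_scaleC_eq_Re_pairing:
  "inner f (scaleC_l2 a b) = Re (cnj a * pairing (\<lambda>x. cnj (rep_l2 b x)) f)"
proof -
  have "inner f (scaleC_l2 a b) = inner (l2_of (rep_l2 f)) (l2_of (\<lambda>x. a * rep_l2 b x))"
    by (simp add: l2_of_scale)
  also have "\<dots> = Re (LINT x|lborel. cnj a * (rep_l2 f x * cnj (rep_l2 b x)))"
    by (subst inner_l2_of_Re) (simp_all add: square_integrable_scale mult_ac)
  finally show ?thesis by (simp add: pairing_def)
qed

text \<open>Orthogonality to one vector \<open>b\<close> is the kernel of the rank-one map to the
  multiples of \<open>b\<close>, so each \<open>b\<close> costs only finitely many dimensions. All
  complex multiples of \<open>b\<close> are tested because \<open>inner\<close> is merely a real
  part.\<close>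

lemma infinite_dim_orthogonal:
  assumes "finite B" "l2.subspace U" "infinite_dim U"
  obtains f where "f \<in> U" "f \<noteq> 0" "\<And>n. n \<in> l2.span B \<Longrightarrow> inner f n = 0"
proof -
  let ?O = "\<lambda>B. U \<inter> {f. \<forall>b\<in>B. \<forall>a. inner f (scaleC_l2 a b) = 0}"
  have "l2.subspace (?O B) \<and> infinite_dim (?O B)"
    using assms(1)
  proof (induction B rule: finite_induct)
    case empty
    then show ?case using assms by simp
  next
    case (insert b B)
    show ?case
    \<comment> \<open>For \<open>b = 0\<close> the rank-one map no longer detects the pairing, but
      the orthogonality condition is void.\<close>
    proof (cases "b = 0")
      case True
      then have "?O (insert b B) = ?O B" by auto
      then show ?thesis using insert.IH by simp
    next
      case False
      let ?w = "\<lambda>x. cnj (rep_l2 b x)"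
      let ?F = "\<lambda>f. scaleC_l2 (pairing ?w f) b"
      have F: "finite_rank ?F"
        by (rule finite_rank_pairing) (simp add: square_integrable_cnj)
      have "(\<forall>a. inner f (scaleC_l2 a b) = 0) \<longleftrightarrow> ?F f = 0" for f
      proof
        assume *: "\<forall>a. inner f (scaleC_l2 a b) = 0"
        have "Re (cnj (pairing ?w f) * pairing ?w f) = 0"
          using *[rule_format, of "pairing ?w f"] unfolding inner_scaleC_eq_Re_pairing .
        then have "(norm (pairing ?w f))\<^sup>2 = 0"
          by (simp only: cmod_power2) (simp add: power2_eq_square)
        then show "?F f = 0" by simp
      next
        assume "?F f = 0"
        then have "pairing ?w f = 0" using False by simp
        then show "\<forall>a. inner f (scaleC_l2 a b) = 0" by (simp add: inner_scaleC_eq_Re_pairing)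
      qed
      then have "?O (insert b B) = ?O B \<inter> {f. ?F f = 0}" by auto
      then show ?thesis using infinite_dim_inter_kernel[OF _ _ F, of "?O B"] insert.IH by simp
    qed
  qed
  then have O: "l2.subspace (?O B)" "infinite_dim (?O B)" by auto
  have "\<not> ?O B \<subseteq> l2.span {}" using O(2) unfolding infinite_dim_def by blast
  then obtain f where f: "f \<in> ?O B" "f \<noteq> 0" by auto
  have "inner f n = 0" if "n \<in> l2.span B" for n
  proof -
    have sub: "l2.subspace {n. \<forall>a. inner f (scaleC_l2 a n) = 0}"
      unfolding l2.subspace_def by (auto simp: l2.scale_right_distrib inner_add_right)
    have "B \<subseteq> {n. \<forall>a. inner f (scaleC_l2 a n) = 0}" using f(1) by auto
    from l2.span_minimal[OF this sub] that have "\<forall>a. inner f (scaleC_l2 a n) = 0" by blast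
    from this[rule_format, of 1] show ?thesis by simp
  qed
  then show thesis using that f by blast
qed

text \<open>A closed range yields preimages bounded by the image. If \<open>f\<close> is orthogonal
  to the kernel and its image is tiny, a small \<open>x\<close> with the same image differs from
  \<open>f\<close> by a kernel element, and then \<open>(norm f)\<^sup>2 = inner f x\<close>
  contradicts the smallness of \<open>x\<close>.\<close>

proposition not_fredholm_if_small_on_infinite_dim:
  assumes J: "clinear J" "inj J" "range J = D"
    and M: "clinear M" "\<And>f. norm (M f) \<le> A * norm f" and K: "clinear K" "\<And>f. norm (K f) \<le> A' * norm f" "approximable K"
    and P: "\<And>f. P (J f) = M f + K f"
    and small: "\<And>e. 0 < e \<Longrightarrow> \<exists>W. l2.subspace W \<and> infinite_dim W \<and> (\<forall>f\<in>W. norm (M f) \<le> e * norm f)"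
  shows "\<not> fredholm D P"
proof
  assume fr: "fredholm D P"
  let ?L = "\<lambda>f. M f + K f"
  have linL: "clinear ?L"
    by (rule clinearI) (simp_all add: clinear_add[OF M(1)] clinear_add[OF K(1)] clinear_scale[OF M(1)] clinear_scale[OF K(1)] l2.scale_right_distrib)
  have "norm (?L f) \<le> (A + A') * norm f" for f
    using norm_triangle_le[of "M f" "K f", OF add_mono[OF M(2) K(2)]] by (simp add: distrib_right)
  then have bl: "bounded_linear ?L" by (rule clinear_bounded_linear[OF linL])
  have ran: "P ` D = range ?L" unfolding J(3)[symmetric] image_image P ..
  have cl: "closed (range ?L)" using fr unfolding fredholm_def ran by blast
  obtain C where C: "0 < C" "\<And>y. y \<in> range ?L \<Longrightarrow> \<exists>x. ?L x = y \<and> norm x \<le> C * norm y"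
    using closed_range_preimage_bound[OF bl cl] by metis
  have ker: "op_kernel D P = J ` {f. ?L f = 0}"
    unfolding op_kernel_def J(3)[symmetric] using P by auto
  obtain B where B: "finite B" "l2.span B = op_kernel D P"
    using fr unfolding fredholm_def finite_dim_def by blast
  have BJ: "B \<subseteq> J ` {f. ?L f = 0}" using B(2) ker l2.span_superset by blast
  obtain B' where B': "finite B'" "B' \<subseteq> {f. ?L f = 0}" "B = J ` B'"
    using finite_subset_image[OF B(1) BJ] by blast
  have kerB: "f \<in> l2.span B'" if "?L f = 0" for f
  proof -
    have "J f \<in> J ` l2.span B'"
      using that B(2) unfolding ker B'(3) l2_pair.linear_span_image[OF J(1)] by blast
    then show ?thesis using J(2) by (auto simp: inj_on_def)
  qed
  \<comment> \<open>The error \<open>e\<close> occurs twice, from \<open>M\<close> on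
    \<open>W\<close> and from \<open>K - F\<close> where \<open>F\<close> vanishes; this value makes
    \<open>C * (2 * e)\<close> equal to 1/2.\<close>
  define e where "e = 1 / (4 * C)"
  have e: "0 < e" using C(1) by (simp add: e_def)
  obtain F where F: "finite_rank F" "\<And>f. norm (K f - F f) \<le> e * norm f"
    using K(3) e unfolding approximable_def by blast
  obtain W where W: "l2.subspace W" "infinite_dim W" "\<And>f. f \<in> W \<Longrightarrow> norm (M f) \<le> e * norm f"
    using small[OF e] by blast
  obtain f where f: "f \<in> W \<inter> {f. F f = 0}" "f \<noteq> 0" and orth: "\<And>n. n \<in> l2.span B' \<Longrightarrow> inner f n = 0"
    using infinite_dim_orthogonal[OF B'(1) infinite_dim_inter_kernel[OF W(1,2) F(1)]] by metis
  have "norm (?L f) \<le> e * norm f + e * norm f"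
    using W(3)[of f] F(2)[of f] f(1) by (intro norm_triangle_le add_mono) auto
  then have "C * norm (?L f) \<le> C * (2 * e * norm f)" using C(1) by (intro mult_left_mono) auto
  also have "\<dots> = norm f / 2" using C(1) by (simp add: e_def)
  finally have half: "C * norm (?L f) \<le> norm f / 2" .
  obtain x where x: "?L x = ?L f" "norm x \<le> C * norm (?L f)" using C(2)[of "?L f"] by blast
  have "?L (f - x) = 0" using x(1) clinear_diff[OF linL, of f x] by simp
  then have "inner f (f - x) = 0" using kerB orth by blast
  then have "(norm f)\<^sup>2 = inner f x" by (simp add: inner_diff_right power2_norm_eq_inner)
  also have "\<dots> \<le> norm f * norm x" by (rule norm_cauchy_schwarz)
  also have "\<dots> \<le> norm f * (norm f / 2)" using x(2) half by (intro mult_left_mono) auto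
  finally show False using f(2) by (simp add: power2_eq_square)
qed

text \<open>Applying the functional \<open>p k\<close> to a linear relation isolates the coefficient
  of \<open>e k\<close>.\<close>

lemma infinite_dim_if_biorthogonal:
  fixes e :: "nat \<Rightarrow> l2" and p :: "nat \<Rightarrow> l2 \<Rightarrow> complex"
  assumes e: "\<And>j. e j \<in> W" and add: "\<And>k f g. p k (f + g) = p k f + p k g"
    and scale: "\<And>k a f. p k (scaleC_l2 a f) = a * p k f"
    and bi: "\<And>j k. p k (e j) = 0 \<longleftrightarrow> j \<noteq> k"
  shows "infinite_dim W"
  unfolding infinite_dim_def
proof
  assume "\<exists>B. finite B \<and> W \<subseteq> l2.span B"
  then obtain B where B: "finite B" "W \<subseteq> l2.span B" by blast
  have inj: "inj e" using bi by (metis injI)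
  \<comment> \<open>Indices run from 0 to \<open>card B\<close> inclusive, giving one vector more
    than \<open>B\<close> can accommodate.\<close>
  let ?E = "e ` {..card B}"
  have "l2.independent ?E"
  proof (rule l2.independent_if_scalars_zero)
    fix f x assume z: "(\<Sum>x\<in>?E. scaleC_l2 (f x) x) = 0" and "x \<in> ?E"
    then obtain k where k: "x = e k" "k \<in> {..card B}" by blast
    have p0: "p k 0 = 0" using scale[of k 0 0] by simp
    have "0 = p k (\<Sum>x\<in>?E. scaleC_l2 (f x) x)" by (simp add: z p0)
    also have "\<dots> = (\<Sum>x\<in>?E. f x * p k x)"
      using sum_comp_morphism[of "p k" "\<lambda>x. scaleC_l2 (f x) x" ?E] p0 add scale by (simp add: o_def)
    also have "\<dots> = (\<Sum>j\<le>card B. f (e j) * p k (e j))"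
      using inj by (subst sum.reindex) (auto intro: inj_on_subset)
    also have "\<dots> = (\<Sum>j\<le>card B. if j = k then f (e k) * p k (e k) else 0)"
      by (intro sum.cong) (use bi in auto)
    also have "\<dots> = f (e k) * p k (e k)" using k(2) by simp
    finally show "f x = 0" using bi[of k k] k(1) by simp
  qed simp
  then have "card ?E \<le> card B"
    using l2.independent_span_bound[OF B(1)] B(2) e by blast
  moreover have "card ?E = Suc (card B)"
    using inj by (subst card_image) (auto intro: inj_on_subset)
  ultimately show False by simp
qed

section \<open>Calculus of bounded symbols and low-frequency spaces\<close>

lemma square_integrable_mult_rep_l2_of:
  assumes [measurable]: "m \<in> borel_measurable borel" and f: "square_integrable f"
  shows "square_integrable (\<lambda>x. m x * rep_l2 (l2_of f) x) \<longleftrightarrow> square_integrable (\<lambda>x. m x * f x)"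
proof (rule square_integrable_cong_AE)
  have [measurable]: "f \<in> borel_measurable borel" using f by (simp add: square_integrable_def)
  have [measurable]: "rep_l2 h \<in> borel_measurable borel" for h using measurable_rep_l2 by simp
  show "AE x in lborel. m x * rep_l2 (l2_of f) x = m x * f x"
    using rep_l2_of[OF f] by eventually_elim simp
  show "(\<lambda>x. m x * rep_l2 (l2_of f) x) \<in> borel_measurable lborel" "(\<lambda>x. m x * f x) \<in> borel_measurable lborel"
    by simp_all
qed

lemma bounded_symbol_const: "bounded_symbol (\<lambda>_. a)"
  unfolding bounded_symbol_def by auto

lemma bounded_symbol_mult:
  assumes "bounded_symbol m" "bounded_symbol n" shows "bounded_symbol (\<lambda>x. m x * n x)"
proof -
  obtain C D where C: "\<And>x. norm (m x) \<le> C" and D: "\<And>x. norm (n x) \<le> D"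
    using assms unfolding bounded_symbol_def by blast
  have "norm (m x * n x) \<le> C * D" for x
    using order_trans[OF norm_ge_zero C] by (auto simp: norm_mult intro!: mult_mono C D)
  then show ?thesis using assms unfolding bounded_symbol_def by auto
qed

lemma bounded_symbol_add:
  assumes "bounded_symbol m" "bounded_symbol n" shows "bounded_symbol (\<lambda>x. m x + n x)"
proof -
  obtain C D where C: "\<And>x. norm (m x) \<le> C" and D: "\<And>x. norm (n x) \<le> D"
    using assms unfolding bounded_symbol_def by blast
  have "norm (m x + n x) \<le> C + D" for x
    by (intro norm_triangle_le add_mono C D)
  then show ?thesis using assms unfolding bounded_symbol_def by auto
qed

lemma bounded_symbol_cmult: "bounded_symbol m \<Longrightarrow> bounded_symbol (\<lambda>x. a * m x)"
  by (rule bounded_symbol_mult[OF bounded_symbol_const])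

lemma bounded_symbol_norm_bound:
  assumes "bounded_symbol m"
  obtains C where "\<And>f. norm (mult_op m f) \<le> C * norm f" "\<And>f. norm (fourier_multiplier m f) \<le> C * norm f"
proof -
  obtain C where C: "\<And>x. norm (m x) \<le> C" using assms unfolding bounded_symbol_def by blast
  show thesis
    using norm_mult_op_le[of m C] norm_fourier_multiplier_le[of m C] C assms
    by (intro that[of C]) (auto simp: bounded_symbol_def)
qed

lemma mult_op_compose:
  "bounded_symbol m \<Longrightarrow> bounded_symbol n \<Longrightarrow> mult_op m (mult_op n f) = mult_op (\<lambda>x. m x * n x) f"
  by (intro mult_op_mult square_integrable_bounded_symbol) (auto simp: bounded_symbol_def)

lemma fourier_multiplier_compose:
  "bounded_symbol m \<Longrightarrow> bounded_symbol n \<Longrightarrow>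
    fourier_multiplier m (fourier_multiplier n f) = fourier_multiplier (\<lambda>x. m x * n x) f"
  by (simp add: fourier_multiplier_eq mult_op_compose)

lemma fourier_multiplier_one [simp]: "fourier_multiplier (\<lambda>_. 1) f = f"
  by (simp add: fourier_multiplier_eq)

lemma mult_op_symbol_add:
  assumes "bounded_symbol m" "bounded_symbol n"
  shows "mult_op (\<lambda>x. m x + n x) f = mult_op m f + mult_op n f"
  using assms by (intro mult_op_plus square_integrable_bounded_symbol square_integrable_rep)

lemma mult_op_symbol_cmult:
  assumes "bounded_symbol m" shows "mult_op (\<lambda>x. a * m x) f = scaleC_l2 a (mult_op m f)"
  using assms by (intro mult_op_cmult square_integrable_bounded_symbol square_integrable_rep)

lemma fourier_multiplier_symbol_add:
  assumes "bounded_symbol m" "bounded_symbol n"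
  shows "fourier_multiplier (\<lambda>x. m x + n x) f = fourier_multiplier m f + fourier_multiplier n f"
  by (simp add: fourier_multiplier_eq mult_op_symbol_add assms clinear_add[OF clinear_inverse_fourier])

lemma fourier_multiplier_symbol_cmult:
  assumes "bounded_symbol m"
  shows "fourier_multiplier (\<lambda>x. a * m x) f = scaleC_l2 a (fourier_multiplier m f)"
  by (simp add: fourier_multiplier_eq mult_op_symbol_cmult assms clinear_scale[OF clinear_inverse_fourier])

text \<open>Inverse transforms of indicators of disjoint frequency intervals are biorthogonal to the
  pairings with those indicators.\<close>

lemma infinite_dim_low_frequencies:
  assumes \<rho>: "0 < \<rho>"
  defines "W \<equiv> {f. mult_op (indicator {-\<rho>..\<rho>}) (fourier_l2 f) = fourier_l2 f}"
  shows "l2.subspace W" "infinite_dim W"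
proof -
  have bs: "bounded_symbol (indicator {-\<rho>..\<rho>})"
    unfolding bounded_symbol_def by (auto intro!: exI[of _ 1] simp: indicator_def)
  show "l2.subspace W"
    unfolding l2.subspace_def W_def
    by (auto simp: clinear_add[OF clinear_fourier] clinear_scale[OF clinear_fourier] clinear_add[OF clinear_mult_op[OF bs]] clinear_scale[OF clinear_mult_op[OF bs]])
       (use clinear_scale[OF clinear_fourier, of 0] clinear_scale[OF clinear_mult_op[OF bs], of 0] in auto)
  \<comment> \<open>Consecutive denominators \<open>2 j + 1\<close> and \<open>2 j + 2\<close> give
    pairwise disjoint intervals of positive length inside \<open>{-\<rho>..\<rho>}\<close>.\<close>
  define I where "I j = {\<rho> / (2 * real j + 2)..\<rho> / (2 * real j + 1)}" for j :: nat
  define q where "q j = (indicator (I j) :: real \<Rightarrow> complex)" for j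
  have q: "square_integrable (q j)" for j unfolding q_def I_def by (rule square_integrable_indicator)
  have disj: "I j \<inter> I k = {}" if "j < k" for j k
  proof -
    have "\<rho> / (2 * real k + 1) < \<rho> / (2 * real j + 2)"
      using that \<rho> by (intro divide_strict_left_mono) auto
    then show ?thesis unfolding I_def by auto
  qed
  then have disj': "I j \<inter> I k = {}" if "j \<noteq> k" for j k using that by (metis Int_commute linorder_neqE_nat)
  have sub: "I j \<subseteq> {-\<rho>..\<rho>}" for j
  proof -
    have "0 \<le> \<rho> / (2 * real j + 2)" "\<rho> / (2 * real j + 1) \<le> \<rho>"
      using \<rho> by (auto simp: divide_le_eq)
    then have "-\<rho> \<le> \<rho> / (2 * real j + 2)" "\<rho> / (2 * real j + 1) \<le> \<rho>" using \<rho> by linarith+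
    then show ?thesis unfolding I_def by (simp only: atLeastatMost_subset_iff) simp
  qed
  show "infinite_dim W"
  proof (rule infinite_dim_if_biorthogonal[where e="\<lambda>j. inverse_fourier_l2 (l2_of (q j))" and p="\<lambda>k f. pairing (q k) (fourier_l2 f)"])
    fix j
    have "indicator {-\<rho>..\<rho>} x * q j x = q j x" for x using sub[of j] by (auto simp: q_def indicator_def)
    then have eq: "(\<lambda>x. indicator {-\<rho>..\<rho>} x * q j x) = q j" by (rule ext)
    show "inverse_fourier_l2 (l2_of (q j)) \<in> W"
      unfolding W_def using bs by (simp add: mult_op_l2_of q bounded_symbol_def eq)
  next
    fix j k
    have "pairing (q k) (l2_of (q j)) = (LINT x|lborel. of_real (indicator (I j \<inter> I k) x))"
      unfolding pairing_l2_of[OF q q] by (intro Bochner_Integration.integral_cong) (auto simp: q_def indicator_def)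
    also have "\<dots> = of_real (measure lborel (I j \<inter> I k))"
      by (simp only: integral_complex_of_real) simp
    finally have p: "pairing (q k) (l2_of (q j)) = of_real (measure lborel (I j \<inter> I k))" .
    have "\<rho> / (2 * real j + 2) < \<rho> / (2 * real j + 1)"
      using \<rho> by (intro divide_strict_left_mono) auto
    then have "measure lborel (I j \<inter> I j) \<noteq> 0" unfolding I_def using \<rho> by simp
    then show "pairing (q k) (fourier_l2 (inverse_fourier_l2 (l2_of (q j)))) = 0 \<longleftrightarrow> j \<noteq> k"
      using disj'[of j k] p by (cases "j = k") auto
  qed (simp_all add: pairing_add pairing_scale q clinear_add[OF clinear_fourier] clinear_scale[OF clinear_fourier])
qed

lemma fourier_multiplier_small_on_low_frequencies:
  assumes m: "bounded_symbol m" and e: "\<And>x. \<bar>x\<bar> \<le> \<rho> \<Longrightarrow> norm (m x) \<le> e" "0 \<le> e"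
    and f: "mult_op (indicator {-\<rho>..\<rho>}) (fourier_l2 f) = fourier_l2 f"
  shows "norm (fourier_multiplier m f) \<le> e * norm f"
proof -
  have bs: "bounded_symbol (indicator {-\<rho>..\<rho>})"
    unfolding bounded_symbol_def by (auto intro!: exI[of _ 1] simp: indicator_def)
  have "fourier_multiplier m f = fourier_multiplier (\<lambda>x. m x * indicator {-\<rho>..\<rho>} x) f"
    unfolding fourier_multiplier_eq mult_op_compose[OF m bs, symmetric] f ..
  moreover have "norm (m x * indicator {-\<rho>..\<rho>} x) \<le> e" for x
    using e(1)[of x] e(2) by (auto simp: indicator_def abs_le_iff)
  ultimately show ?thesis
    using bounded_symbol_mult[OF m bs] norm_fourier_multiplier_le[of "\<lambda>x. m x * indicator {-\<rho>..\<rho>} x" e f]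
    by (simp add: bounded_symbol_def)
qed

subsection \<open>The solitary wave profile\<close>

lemma dp_profile_DERIV:
  assumes "dp_solitary_profile c k u"
  shows "DERIV u x :> deriv u x" "DERIV (deriv u) x :> deriv (deriv u) x"
proof -
  have d: "(deriv ^^ n) u field_differentiable (at x)" for n
    using assms by (simp add: dp_solitary_profile_def)
  show "DERIV u x :> deriv u x" using d[of 0] by (simp add: DERIV_deriv_iff_field_differentiable)
  show "DERIV (deriv u) x :> deriv (deriv u) x" using d[of 1] by (simp add: DERIV_deriv_iff_field_differentiable)
qed

lemma dp_profile_continuous:
  assumes "dp_solitary_profile c k u" shows "continuous_on A u"
  using dp_profile_DERIV(1)[OF assms] by (meson DERIV_isCont continuous_at_imp_continuous_on)

text \<open>Near infinity the limit \<open>k < c\<close> keeps \<open>u\<close> away from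
  \<open>c\<close>; on the remaining compact interval \<open>u\<close> attains its maximum. This
  keeps \<open>1 / (c - u)\<close> bounded.\<close>

lemma dp_profile_bounded_away:
  assumes u: "dp_solitary_profile c k u" and kc: "k < c"
  obtains b where "b < c" "\<And>x. u x \<le> b"
proof -
  have "(u \<longlongrightarrow> k) at_infinity" using u by (simp add: dp_solitary_profile_def)
  then have "\<forall>\<^sub>F x in at_infinity. u x < (k + c) / 2" by (rule order_tendstoD) (use kc in simp)
  then obtain R where R: "\<And>x. R \<le> \<bar>x\<bar> \<Longrightarrow> u x < (k + c) / 2" by (auto simp: eventually_at_infinity)
  have "\<exists>x\<in>{-\<bar>R\<bar>..\<bar>R\<bar>}. \<forall>y\<in>{-\<bar>R\<bar>..\<bar>R\<bar>}. u y \<le> u x"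
    by (rule continuous_attains_sup) (auto intro: dp_profile_continuous[OF u])
  then obtain x0 where "\<forall>y\<in>{-\<bar>R\<bar>..\<bar>R\<bar>}. u y \<le> u x0" by blast
  then have x0: "u y \<le> u x0" if "\<bar>y\<bar> \<le> \<bar>R\<bar>" for y
    using that by (meson abs_le_D1 abs_le_D2 atLeastAtMost_iff minus_le_iff)
  have "u x0 < c" using u by (simp add: dp_solitary_profile_def)
  show thesis
  proof
    show "max (u x0) ((k + c) / 2) < c" using \<open>u x0 < c\<close> kc by simp
    show "u x \<le> max (u x0) ((k + c) / 2)" for x
    proof (cases "\<bar>x\<bar> \<le> \<bar>R\<bar>")
      case True
      then show ?thesis using x0[of x] by (simp add: le_max_iff_disj)
    next
      case False
      then have "R \<le> \<bar>x\<bar>" by linarith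
      then show ?thesis using R[of x] by (simp add: le_max_iff_disj)
    qed
  qed
qed

text \<open>The profile equation, solved for the second derivative, bounds it by \<open>A\<close>,
  since \<open>c - u \<ge> c - b\<close>. Together with \<open>0 < u < c\<close> this bounds the
  first derivative.\<close>

lemma dp_profile_lipschitz:
  assumes u: "dp_solitary_profile c k u" and kc: "0 < k" "k < c"
  obtains L where "\<And>x y. \<bar>u x - u y\<bar> \<le> L * \<bar>x - y\<bar>"
proof -
  obtain b where b: "b < c" "\<And>x. u x \<le> b" by (rule dp_profile_bounded_away[OF u kc(2)]) blast
  have u0: "0 < u x" and uc: "u x < c" and ode: "(c - u x) ^ 3 * (u x - deriv (deriv u) x) = k * (c - k) ^ 3" for x
    using u by (auto simp: dp_solitary_profile_def)
  define A where "A = c + k * (c - k) ^ 3 / (c - b) ^ 3"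
  have D2: "\<bar>deriv (deriv u) x\<bar> \<le> A" for x
  proof -
    have p: "0 < (c - u x) ^ 3" using uc[of x] by simp
    then have "deriv (deriv u) x = u x - k * (c - k) ^ 3 / (c - u x) ^ 3"
      using ode[of x] by (simp add: field_simps)
    moreover have "0 \<le> k * (c - k) ^ 3 / (c - u x) ^ 3" using p kc by simp
    moreover have "k * (c - k) ^ 3 / (c - u x) ^ 3 \<le> k * (c - k) ^ 3 / (c - b) ^ 3"
      using b b(2)[of x] uc[of x] kc by (intro divide_left_mono power_mono mult_pos_pos zero_less_power) auto
    ultimately show ?thesis using u0[of x] uc[of x] unfolding A_def by linarith
  qed
  have A0: "0 \<le> A" using D2[of 0] by linarith
  \<comment> \<open>Over a unit interval \<open>u\<close> changes by less than \<open>c\<close>, so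
    its derivative is at most \<open>c\<close> in modulus at some \<open>z\<close> there, and it
    varies by at most \<open>A\<close> between \<open>x\<close> and \<open>z\<close>.\<close>
  have D1: "\<bar>deriv u x\<bar> \<le> c + A" for x
  proof -
    obtain z where z: "x < z" "z < x + 1" "u (x + 1) - u x = (x + 1 - x) * deriv u z"
      using MVT2[of x "x + 1" u "deriv u"] dp_profile_DERIV(1)[OF u] by auto
    obtain w where w: "deriv u z - deriv u x = (z - x) * deriv (deriv u) w"
      using MVT2[of x z "deriv u" "deriv (deriv u)"] z(1) dp_profile_DERIV(2)[OF u] by auto
    have "\<bar>deriv u z - deriv u x\<bar> \<le> 1 * A"
      unfolding w abs_mult using z D2[of w] by (intro mult_mono) auto
    moreover have "\<bar>deriv u z\<bar> \<le> c" using z(3) u0[of x] u0[of "x + 1"] uc[of x] uc[of "x + 1"] by simp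
    ultimately show ?thesis by linarith
  qed
  have "\<bar>u x - u y\<bar> \<le> (c + A) * \<bar>x - y\<bar>" for x y
    using field_differentiable_bound[of UNIV u "deriv u" "c + A" x y] dp_profile_DERIV(1)[OF u] D1
    by simp
  then show thesis using that by blast
qed

subsection \<open>Symbols\<close>

definition resolvent_symbol :: "real \<Rightarrow> real \<Rightarrow> complex" where
  "resolvent_symbol \<alpha> \<eta> = conj_symbol \<alpha> \<eta> * inverse (1 - (conj_symbol \<alpha> \<eta>)\<^sup>2)"

lemma measurable_conj_symbol [measurable]: "conj_symbol \<alpha> \<in> borel_measurable borel"
  unfolding conj_symbol_def[abs_def] by measurable

lemma measurable_resolvent_symbol [measurable]: "resolvent_symbol \<alpha> \<in> borel_measurable borel"
  unfolding resolvent_symbol_def[abs_def] by measurable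

lemma Re_one_minus_conj_symbol_sq: "Re (1 - (conj_symbol \<alpha> \<eta>)\<^sup>2) = 1 - \<alpha>\<^sup>2 + \<eta>\<^sup>2"
  and Im_one_minus_conj_symbol_sq: "Im (1 - (conj_symbol \<alpha> \<eta>)\<^sup>2) = 2 * \<alpha> * \<eta>"
  by (simp_all add: conj_symbol_def power2_eq_square)

lemma one_minus_conj_symbol_sq_nonzero:
  assumes "\<alpha>\<^sup>2 < 1" shows "1 - (conj_symbol \<alpha> \<eta>)\<^sup>2 \<noteq> 0"
proof -
  have "0 < Re (1 - (conj_symbol \<alpha> \<eta>)\<^sup>2)"
    unfolding Re_one_minus_conj_symbol_sq using assms by (simp add: add_pos_nonneg)
  then show ?thesis by auto
qed

text \<open>The denominator is bounded below by its real part, which is at least a multiple of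
  \<open>1 + \<eta>\<^sup>2\<close>, while the numerator grows only linearly.\<close>

lemma norm_resolvent_symbol_le:
  assumes \<alpha>: "0 < \<alpha>" "\<alpha> < 1" shows "norm (resolvent_symbol \<alpha> \<eta>) \<le> 2 / (1 - \<alpha>\<^sup>2)"
proof -
  have a: "0 < 1 - \<alpha>\<^sup>2" "1 - \<alpha>\<^sup>2 \<le> 1" using \<alpha> by (auto simp: power_less_one_iff)
  have "norm (conj_symbol \<alpha> \<eta>) \<le> \<bar>\<eta>\<bar> + \<alpha>"
    unfolding conj_symbol_def using norm_triangle_ineq4[of "\<i> * of_real \<eta>" "of_real \<alpha>"] \<alpha> by (simp add: norm_mult)
  also have "\<dots> \<le> 2 + 2 * \<eta>\<^sup>2"
  proof -
    have "0 \<le> (\<bar>\<eta>\<bar> - 1)\<^sup>2" by simp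
    then have "2 * \<bar>\<eta>\<bar> \<le> 1 + \<eta>\<^sup>2" by (simp add: power2_diff)
    then show ?thesis using \<alpha> zero_le_power2[of \<eta>] by linarith
  qed
  also have "\<dots> \<le> 2 / (1 - \<alpha>\<^sup>2) * (1 - \<alpha>\<^sup>2 + \<eta>\<^sup>2)"
  proof -
    have "\<eta>\<^sup>2 * (1 - \<alpha>\<^sup>2) \<le> \<eta>\<^sup>2" using a by (simp add: mult_left_le)
    then show ?thesis using a(1) by (simp add: field_simps)
  qed
  also have "\<dots> \<le> 2 / (1 - \<alpha>\<^sup>2) * norm (1 - (conj_symbol \<alpha> \<eta>)\<^sup>2)"
    using complex_Re_le_cmod[of "1 - (conj_symbol \<alpha> \<eta>)\<^sup>2"] a(1)
    unfolding Re_one_minus_conj_symbol_sq by (intro mult_left_mono) auto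
  finally have "norm (conj_symbol \<alpha> \<eta>) \<le> 2 / (1 - \<alpha>\<^sup>2) * norm (1 - (conj_symbol \<alpha> \<eta>)\<^sup>2)" .
  moreover have "0 < norm (1 - (conj_symbol \<alpha> \<eta>)\<^sup>2)"
    using one_minus_conj_symbol_sq_nonzero[of \<alpha> \<eta>] a by simp
  ultimately have "norm (conj_symbol \<alpha> \<eta>) / norm (1 - (conj_symbol \<alpha> \<eta>)\<^sup>2) \<le> 2 / (1 - \<alpha>\<^sup>2)"
    by (simp only: pos_divide_le_eq)
  then show ?thesis
    by (simp add: resolvent_symbol_def norm_mult norm_inverse divide_inverse[of "norm (conj_symbol \<alpha> \<eta>)"])
qed

lemma bounded_symbol_resolvent:
  assumes "0 < \<alpha>" "\<alpha> < 1" shows "bounded_symbol (resolvent_symbol \<alpha>)"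
  unfolding bounded_symbol_def using norm_resolvent_symbol_le[OF assms] by auto

text \<open>The bound is the value at \<open>\<eta> = 0\<close>, and it produces the term
  \<open>3 k / (1 - \<alpha>\<^sup>2)\<close> of the gap. With
  \<open>a = 1 - \<alpha>\<^sup>2\<close> the real part equals
  \<open>- \<alpha> (a - \<eta>\<^sup>2) / D\<close>, so the claim amounts to
  \<open>(a - \<eta>\<^sup>2) a \<le> D\<close>.\<close>

lemma Re_resolvent_symbol_ge:
  assumes \<alpha>: "0 < \<alpha>" "\<alpha> < 1" shows "- \<alpha> / (1 - \<alpha>\<^sup>2) \<le> Re (resolvent_symbol \<alpha> \<eta>)"
proof -
  define a where "a = 1 - \<alpha>\<^sup>2"
  have a: "0 < a" using \<alpha> by (auto simp: a_def power_less_one_iff)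
  define D where "D = (a + \<eta>\<^sup>2)\<^sup>2 + (2 * \<alpha> * \<eta>)\<^sup>2"
  have "0 < a + \<eta>\<^sup>2" using a by (simp add: add_pos_nonneg)
  then have "0 < (a + \<eta>\<^sup>2)\<^sup>2" by (rule zero_less_power)
  then have D: "0 < D" unfolding D_def using zero_le_power2[of "2 * \<alpha> * \<eta>"] by linarith
  have "Re (resolvent_symbol \<alpha> \<eta>) = (- \<alpha> * (a + \<eta>\<^sup>2) + \<eta> * (2 * \<alpha> * \<eta>)) / D"
  proof -
    have "Re (resolvent_symbol \<alpha> \<eta>) = Re (conj_symbol \<alpha> \<eta> / (1 - (conj_symbol \<alpha> \<eta>)\<^sup>2))"
      by (simp add: resolvent_symbol_def divide_inverse)
    also have "\<dots> = (- \<alpha> * (a + \<eta>\<^sup>2) + \<eta> * (2 * \<alpha> * \<eta>)) / D"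
      unfolding Re_divide Re_one_minus_conj_symbol_sq Im_one_minus_conj_symbol_sq
      by (simp add: conj_symbol_def a_def D_def)
    finally show ?thesis .
  qed
  moreover have "- \<alpha> / a \<le> (- \<alpha> * (a + \<eta>\<^sup>2) + \<eta> * (2 * \<alpha> * \<eta>)) / D"
  proof -
    have "(a - \<eta>\<^sup>2) * a \<le> D"
    proof -
      have "D - (a - \<eta>\<^sup>2) * a = 3 * (a * \<eta>\<^sup>2) + (\<eta>\<^sup>2)\<^sup>2 + (2 * \<alpha> * \<eta>)\<^sup>2"
        by (simp add: D_def power2_eq_square algebra_simps)
      moreover have "0 \<le> 3 * (a * \<eta>\<^sup>2) + (\<eta>\<^sup>2)\<^sup>2 + (2 * \<alpha> * \<eta>)\<^sup>2" using a by simp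
      ultimately show ?thesis by linarith
    qed
    then have "\<alpha> * ((a - \<eta>\<^sup>2) * a) \<le> \<alpha> * D" using \<alpha> by (intro mult_left_mono) auto
    then have "- \<alpha> * D \<le> (- \<alpha> * (a + \<eta>\<^sup>2) + \<eta> * (2 * \<alpha> * \<eta>)) * a"
      by (simp add: algebra_simps power2_eq_square)
    then show ?thesis by (simp only: pos_le_divide_eq[OF D] times_divide_eq_left pos_divide_le_eq[OF a])
  qed
  ultimately show ?thesis by (simp add: a_def)
qed

subsection \<open>The conjugated operator\<close>

definition dp_char_symbol :: "real \<Rightarrow> real \<Rightarrow> real \<Rightarrow> complex \<Rightarrow> real \<Rightarrow> complex" where
  "dp_char_symbol c k \<alpha> z \<eta> = z - of_real (c - k) * conj_symbol \<alpha> \<eta>"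

lemma measurable_dp_char_symbol [measurable]: "dp_char_symbol c k \<alpha> z \<in> borel_measurable borel"
  unfolding dp_char_symbol_def[abs_def] by measurable

lemma Re_dp_char_symbol: "Re (dp_char_symbol c k \<alpha> z \<eta>) = Re z + (c - k) * \<alpha>"
  and Im_dp_char_symbol: "Im (dp_char_symbol c k \<alpha> z \<eta>) = Im z - (c - k) * \<eta>"
  by (simp_all add: dp_char_symbol_def conj_symbol_def)

lemma dp_char_symbol_nonzero:
  assumes "0 < Re z + (c - k) * \<alpha>" shows "dp_char_symbol c k \<alpha> z \<eta> \<noteq> 0"
  using assms Re_dp_char_symbol[of c k \<alpha> z \<eta>] by auto

text \<open>The constant positive real part of \<open>Q\<close> bounds the inverse; the imaginary
  part, linear in \<open>\<eta>\<close> with slope of modulus \<open>c - k\<close>, makes it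
  decay.\<close>

lemma symbol_vanishing_inverse_dp_char_symbol:
  assumes z: "0 < Re z + (c - k) * \<alpha>" and kc: "k < c"
  shows "symbol_vanishing (\<lambda>\<eta>. inverse (dp_char_symbol c k \<alpha> z \<eta>))"
  unfolding symbol_vanishing_def
proof (intro conjI allI impI)
  let ?Q = "dp_char_symbol c k \<alpha> z"
  have "norm (inverse (?Q \<eta>)) \<le> inverse (Re z + (c - k) * \<alpha>)" for \<eta>
    unfolding norm_inverse using complex_Re_le_cmod[of "?Q \<eta>"] z
    by (intro le_imp_inverse_le) (auto simp: Re_dp_char_symbol)
  then show "bounded_symbol (\<lambda>\<eta>. inverse (?Q \<eta>))" unfolding bounded_symbol_def by auto
  fix e :: real assume e: "0 < e"
  have "norm (inverse (?Q \<eta>)) \<le> e" if "(inverse e + \<bar>Im z\<bar>) / (c - k) < \<bar>\<eta>\<bar>" for \<eta>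
  proof -
    have "inverse e + \<bar>Im z\<bar> < \<bar>(c - k) * \<eta>\<bar>"
      using that kc by (simp add: pos_divide_less_eq abs_mult mult.commute)
    then have "inverse e \<le> \<bar>Im (?Q \<eta>)\<bar>" unfolding Im_dp_char_symbol by linarith
    also have "\<dots> \<le> norm (?Q \<eta>)" by (rule abs_Im_le_cmod)
    finally have "inverse (norm (?Q \<eta>)) \<le> inverse (inverse e)" using e by (intro le_imp_inverse_le) auto
    then show ?thesis by (simp add: norm_inverse)
  qed
  then show "\<exists>R. \<forall>\<eta>. R < \<bar>\<eta>\<bar> \<longrightarrow> norm (inverse (?Q \<eta>)) \<le> e" by blast
qed

lemma symbol_vanishing_bounded: "symbol_vanishing m \<Longrightarrow> bounded_symbol m"
  by (simp add: symbol_vanishing_def)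

text \<open>Substituting \<open>(c - k) s = z - Q\<close> shows that dividing the unbounded
  \<open>s\<close> by \<open>Q\<close> gives a bounded symbol.\<close>

lemma conj_symbol_mult_inverse:
  assumes "0 < Re z + (c - k) * \<alpha>" "k < c"
  shows "conj_symbol \<alpha> \<eta> * inverse (dp_char_symbol c k \<alpha> z \<eta>)
    = of_real (1 / (c - k)) * (z * inverse (dp_char_symbol c k \<alpha> z \<eta>) + (-1))"
proof -
  have "(z - dp_char_symbol c k \<alpha> z \<eta>) * inverse (dp_char_symbol c k \<alpha> z \<eta>) = z * inverse (dp_char_symbol c k \<alpha> z \<eta>) + (-1)"
    using dp_char_symbol_nonzero[OF assms(1), of \<eta>] by (simp add: left_diff_distrib)
  moreover have "z - dp_char_symbol c k \<alpha> z \<eta> = of_real (c - k) * conj_symbol \<alpha> \<eta>"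
    by (simp add: dp_char_symbol_def)
  ultimately have "of_real (c - k) * (conj_symbol \<alpha> \<eta> * inverse (dp_char_symbol c k \<alpha> z \<eta>)) = z * inverse (dp_char_symbol c k \<alpha> z \<eta>) + (-1)"
    by (simp only: mult.assoc)
  moreover have "of_real (1 / (c - k)) * (of_real (c - k) * w) = w" for w :: complex
    using assms(2) by (simp add: mult.assoc[symmetric] del: of_real_divide of_real_diff flip: of_real_mult)
  ultimately show ?thesis by metis
qed

lemma bounded_symbol_conj_symbol_quotient:
  assumes "0 < Re z + (c - k) * \<alpha>" "k < c"
  shows "bounded_symbol (\<lambda>\<eta>. conj_symbol \<alpha> \<eta> * inverse (dp_char_symbol c k \<alpha> z \<eta>))"
  unfolding conj_symbol_mult_inverse[OF assms]
  by (intro bounded_symbol_cmult bounded_symbol_add bounded_symbol_const symbol_vanishing_bounded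
    symbol_vanishing_inverse_dp_char_symbol assms)

lemma conj_symbol_square_integrable:
  assumes "f \<in> sobolev_H1"
  shows "square_integrable (\<lambda>\<eta>. conj_symbol \<alpha> \<eta> * rep_l2 (fourier_l2 f) \<eta>)"
proof -
  have "square_integrable (\<lambda>\<eta>. \<i> * (of_real \<eta> * rep_l2 (fourier_l2 f) \<eta>) - of_real \<alpha> * rep_l2 (fourier_l2 f) \<eta>)"
    using assms by (intro square_integrable_diff square_integrable_scale) (auto simp: sobolev_H1_iff)
  then show ?thesis by (simp add: conj_symbol_def algebra_simps)
qed

text \<open>Since \<open>\<eta> = - \<i> (s + \<alpha>)\<close>, the function
  \<open>\<eta> / Q\<close> is bounded: division by \<open>Q\<close> gains one derivative.\<close>

lemma fourier_multiplier_in_H1: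
  assumes z: "0 < Re z + (c - k) * \<alpha>" and kc: "k < c"
  shows "fourier_multiplier (\<lambda>\<eta>. inverse (dp_char_symbol c k \<alpha> z \<eta>)) f \<in> sobolev_H1"
proof -
  let ?n = "\<lambda>\<eta>. inverse (dp_char_symbol c k \<alpha> z \<eta>)"
  have n: "bounded_symbol ?n" by (intro symbol_vanishing_bounded symbol_vanishing_inverse_dp_char_symbol z kc)
  have eq: "complex_of_real \<eta> * ?n \<eta> = - \<i> * (conj_symbol \<alpha> \<eta> * ?n \<eta> + of_real \<alpha> * ?n \<eta>)" for \<eta>
  proof -
    have eq0: "complex_of_real \<eta> = - \<i> * (conj_symbol \<alpha> \<eta> + of_real \<alpha>)" by (simp add: conj_symbol_def)
    have "complex_of_real \<eta> * ?n \<eta> = (- \<i> * (conj_symbol \<alpha> \<eta> + of_real \<alpha>)) * ?n \<eta>"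
      by (simp only: eq0[symmetric])
    then show ?thesis by (simp only: mult.assoc distrib_right)
  qed
  have "bounded_symbol (\<lambda>\<eta>. of_real \<eta> * ?n \<eta>)"
    unfolding eq by (intro bounded_symbol_cmult bounded_symbol_add bounded_symbol_conj_symbol_quotient z kc n)
  then have "square_integrable (\<lambda>\<eta>. (of_real \<eta> * ?n \<eta>) * rep_l2 (fourier_l2 f) \<eta>)"
    by (rule square_integrable_bounded_symbol) simp
  then have "square_integrable (\<lambda>\<eta>. of_real \<eta> * (?n \<eta> * rep_l2 (fourier_l2 f) \<eta>))"
    by (simp only: mult.assoc)
  then have "square_integrable (\<lambda>\<eta>. of_real \<eta> * rep_l2 (l2_of (\<lambda>\<eta>. ?n \<eta> * rep_l2 (fourier_l2 f) \<eta>)) \<eta>)"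
    by (subst square_integrable_mult_rep_l2_of) (auto intro: square_integrable_bounded_symbol[OF n])
  then show ?thesis
    by (simp add: sobolev_H1_iff fourier_multiplier_eq mult_op_def)
qed

lemma bounded_symbol_of_real:
  assumes "u \<in> borel_measurable borel" "\<And>x. \<bar>u x\<bar> \<le> B"
  shows "bounded_symbol (\<lambda>x. complex_of_real (u x))"
  using assms unfolding bounded_symbol_def by auto

lemma symbol_vanishing_of_real:
  assumes "u \<in> borel_measurable borel" "\<And>x. \<bar>u x\<bar> \<le> B" and lim: "(u \<longlongrightarrow> 0) at_infinity"
  shows "symbol_vanishing (\<lambda>x. complex_of_real (u x))"
  unfolding symbol_vanishing_def
proof (intro conjI allI impI)
  show "bounded_symbol (\<lambda>x. complex_of_real (u x))" by (rule bounded_symbol_of_real[OF assms(1,2)])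
  fix e :: real assume "0 < e"
  with lim have "\<forall>\<^sub>F x in at_infinity. dist (u x) 0 < e" by (rule tendstoD)
  then obtain R where "\<And>x. R \<le> norm x \<Longrightarrow> dist (u x) 0 < e" by (auto simp: eventually_at_infinity)
  then show "\<exists>R. \<forall>x. R < \<bar>x\<bar> \<longrightarrow> norm (complex_of_real (u x)) \<le> e"
    by (intro exI[of _ R]) (auto intro: less_imp_le)
qed

text \<open>Writing \<open>4 - s\<^sup>2 = (1 - s\<^sup>2) + 3\<close> splits the symbol into
  \<open>s + 3 r\<close>. On $H^1$ both terms of order one combine into \<open>s\<close> acting on
  \<open>(c - u) g\<close>, the product that the substitution makes constant-coefficient.\<close>

lemma dp_conj_operator_on_H1:
  assumes \<alpha>: "0 < \<alpha>" "\<alpha> < 1" and g: "g \<in> sobolev_H1" and ug: "multiply_l2 u g \<in> sobolev_H1"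
  shows "dp_conj_operator c \<alpha> u g = fourier_multiplier (conj_symbol \<alpha>) (scaleC_l2 (of_real c) g - multiply_l2 u g)
    - scaleC_l2 3 (fourier_multiplier (resolvent_symbol \<alpha>) (multiply_l2 u g))"
proof -
  let ?s = "conj_symbol \<alpha>" and ?r = "resolvent_symbol \<alpha>"
  let ?h = "multiply_l2 u g"
  note r = bounded_symbol_resolvent[OF \<alpha>]
  have ms: "?s \<in> borel_measurable borel" by measurable
  have "\<alpha>\<^sup>2 < 1" using \<alpha> by (simp add: power_less_one_iff)
  then have nz: "1 - (?s \<eta>)\<^sup>2 \<noteq> 0" for \<eta> by (rule one_minus_conj_symbol_sq_nonzero)
  have sym: "?s \<eta> * inverse (1 - (?s \<eta>)\<^sup>2) * (4 - (?s \<eta>)\<^sup>2) = ?s \<eta> + 3 * ?r \<eta>" for \<eta>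
  proof -
    have "4 - (?s \<eta>)\<^sup>2 = (1 - (?s \<eta>)\<^sup>2) + 3" by simp
    then have "?s \<eta> * inverse (1 - (?s \<eta>)\<^sup>2) * (4 - (?s \<eta>)\<^sup>2)
      = ?s \<eta> * (inverse (1 - (?s \<eta>)\<^sup>2) * (1 - (?s \<eta>)\<^sup>2)) + 3 * ?r \<eta>"
      by (simp only: resolvent_symbol_def distrib_left mult_ac)
    then show ?thesis using nz[of \<eta>] by simp
  qed
  note sg = conj_symbol_square_integrable[OF g, of \<alpha>] and sh = conj_symbol_square_integrable[OF ug, of \<alpha>]
  have "square_integrable (\<lambda>\<eta>. 3 * ?r \<eta> * rep_l2 (fourier_l2 ?h) \<eta>)"
    by (rule square_integrable_bounded_symbol[OF bounded_symbol_cmult[OF r]]) simp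
  then have 1: "fourier_multiplier (\<lambda>\<eta>. ?s \<eta> + 3 * ?r \<eta>) ?h = fourier_multiplier ?s ?h + scaleC_l2 3 (fourier_multiplier ?r ?h)"
    unfolding fourier_multiplier_symbol_cmult[OF r, symmetric]
    by (simp add: fourier_multiplier_eq mult_op_plus sh clinear_add[OF clinear_inverse_fourier, symmetric])
  have s1: "square_integrable (\<lambda>\<eta>. ?s \<eta> * rep_l2 (scaleC_l2 (of_real c) (fourier_l2 g)) \<eta>)"
  proof -
    have "square_integrable (\<lambda>\<eta>. ?s \<eta> * (of_real c * rep_l2 (fourier_l2 g) \<eta>))"
      using square_integrable_scale[OF sg, of "of_real c"] by (simp add: mult.left_commute)
    then show ?thesis
      using square_integrable_mult_rep_l2_of[OF ms, of "\<lambda>\<eta>. of_real c * rep_l2 (fourier_l2 g) \<eta>"]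
      by (simp add: l2_of_scale square_integrable_scale)
  qed
  have s2: "square_integrable (\<lambda>\<eta>. ?s \<eta> * rep_l2 (scaleC_l2 (-1) (fourier_l2 ?h)) \<eta>)"
  proof -
    have "square_integrable (\<lambda>\<eta>. ?s \<eta> * ((-1) * rep_l2 (fourier_l2 ?h) \<eta>))"
      using square_integrable_scale[OF sh, of "-1"] by (simp add: mult.left_commute)
    then show ?thesis
      using square_integrable_mult_rep_l2_of[OF ms, of "\<lambda>\<eta>. (-1) * rep_l2 (fourier_l2 ?h) \<eta>"]
        l2_of_scale[OF square_integrable_rep[of "fourier_l2 ?h"], of "-1"]
        square_integrable_scale[OF square_integrable_rep[of "fourier_l2 ?h"], of "-1"]
      by simp
  qed
  have "fourier_l2 (scaleC_l2 (of_real c) g - ?h) = scaleC_l2 (of_real c) (fourier_l2 g) + scaleC_l2 (-1) (fourier_l2 ?h)"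
    by (simp add: clinear_diff[OF clinear_fourier] clinear_scale[OF clinear_fourier])
  then have "mult_op ?s (fourier_l2 (scaleC_l2 (of_real c) g - ?h))
      = scaleC_l2 (of_real c) (mult_op ?s (fourier_l2 g)) + scaleC_l2 (-1) (mult_op ?s (fourier_l2 ?h))"
    by (simp only: mult_op_domain_add[OF ms s1 s2] mult_op_domain_scale[OF ms sg] mult_op_domain_scale[OF ms sh])
  then have 2: "fourier_multiplier ?s (scaleC_l2 (of_real c) g - ?h)
      = scaleC_l2 (of_real c) (fourier_multiplier ?s g) - fourier_multiplier ?s ?h"
    by (simp add: fourier_multiplier_eq clinear_diff[OF clinear_inverse_fourier] clinear_scale[OF clinear_inverse_fourier])
  show ?thesis
    unfolding dp_conj_operator_def sym 1 2 by simp
qed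

text \<open>Substituting \<open>g = w v\<close> with \<open>w = (c - k) / (c - u)\<close> and \<open>v = n(D) f\<close>, \<open>n\<close> the inverse of the
  symbol of \<open>z - (c - k) (\<partial> - \<alpha>)\<close>, removes the variable coefficient from the leading
  part; what remains of it are multiplications by the decaying functions \<open>w - 1\<close> and \<open>u w - k\<close>.\<close>

proposition dp_resolvent_factorization:
  fixes z :: complex
  assumes kc: "0 < k" "k < c" and u: "dp_solitary_profile c k u" and \<alpha>: "0 < \<alpha>" "\<alpha> < 1"
    and z: "0 < Re z + (c - k) * \<alpha>"
  obtains J K C where "clinear J" "inj J" "range J = sobolev_H1"
    "clinear K" "\<And>f. norm (K f) \<le> C * norm f" "approximable K"
    "\<And>f. scaleC_l2 z (J f) - dp_conj_operator c \<alpha> u (J f)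
      = fourier_multiplier (\<lambda>\<eta>. 1 + 3 * of_real k * (resolvent_symbol \<alpha> \<eta> * inverse (dp_char_symbol c k \<alpha> z \<eta>))) f + K f"
proof -
  let ?Q = "dp_char_symbol c k \<alpha> z" and ?s = "conj_symbol \<alpha>" and ?r = "resolvent_symbol \<alpha>"
  define n where "n \<eta> = inverse (?Q \<eta>)" for \<eta>
  have nv: "symbol_vanishing n"
    unfolding n_def[abs_def] by (rule symbol_vanishing_inverse_dp_char_symbol[OF z kc(2)])
  note n = symbol_vanishing_bounded[OF nv]
  note r = bounded_symbol_resolvent[OF \<alpha>]
  have Qn: "?Q \<eta> * n \<eta> = 1" for \<eta> unfolding n_def using dp_char_symbol_nonzero[OF z, of \<eta>] by simp
  obtain b where b: "b < c" "\<And>x. u x \<le> b" by (rule dp_profile_bounded_away[OF u kc(2)]) blast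
  obtain L where L: "\<And>x y. \<bar>u x - u y\<bar> \<le> L * \<bar>x - y\<bar>" by (rule dp_profile_lipschitz[OF u kc]) blast
  have u0: "0 < u x" and uc: "u x < c" for x using u by (auto simp: dp_solitary_profile_def)
  have ulim: "(u \<longlongrightarrow> k) at_infinity" using u by (simp add: dp_solitary_profile_def)
  have um[measurable]: "u \<in> borel_measurable borel"
    by (rule borel_measurable_continuous_onI[OF dp_profile_continuous[OF u]])
  define w where "w x = (c - k) / (c - u x)" for x
  define w' where "w' x = (c - u x) / (c - k)" for x
  have wm[measurable]: "w \<in> borel_measurable borel" "w' \<in> borel_measurable borel"
    unfolding w_def[abs_def] w'_def[abs_def] by measurable
  have wpos: "0 < w x" for x using kc uc by (simp add: w_def)
  have wB: "\<bar>w x\<bar> \<le> (c - k) / (c - b)" for x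
  proof -
    have "w x \<le> (c - k) / (c - b)"
      unfolding w_def using kc b b(2)[of x] uc[of x] by (intro divide_left_mono mult_pos_pos) auto
    then show ?thesis using wpos[of x] by simp
  qed
  have wL: "\<bar>w x - w y\<bar> \<le> ((c - k) * L / (c - b)\<^sup>2) * \<bar>x - y\<bar>" for x y
  proof -
    have p: "0 < c - u x" "0 < c - u y" "0 < c - b" using uc b by auto
    have "w x - w y = (c - k) * (u x - u y) / ((c - u x) * (c - u y))"
      using p unfolding w_def by (simp add: divide_simps) (simp add: algebra_simps)
    then have "\<bar>w x - w y\<bar> = (c - k) * \<bar>u x - u y\<bar> / ((c - u x) * (c - u y))"
      using p kc by (simp add: abs_mult)
    also have "\<dots> \<le> (c - k) * (L * \<bar>x - y\<bar>) / ((c - b) * (c - b))"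
      using p kc b(2)[of x] b(2)[of y] L[of x y]
      by (intro frac_le mult_left_mono mult_mono) auto
    finally show ?thesis by (simp add: power2_eq_square)
  qed
  have w'B: "\<bar>w' x\<bar> \<le> c / (c - k)" for x
    unfolding w'_def using kc uc[of x] u0[of x] by (simp add: divide_right_mono)
  have w'L: "\<bar>w' x - w' y\<bar> \<le> (L / (c - k)) * \<bar>x - y\<bar>" for x y
  proof -
    have "w' x - w' y = (u y - u x) / (c - k)" unfolding w'_def by (simp add: diff_divide_distrib)
    then show ?thesis using L[of x y] kc by (simp add: abs_minus_commute divide_right_mono)
  qed
  have uB: "\<bar>u x\<bar> \<le> c" for x using u0[of x] uc[of x] by simp
  note bw = bounded_symbol_of_real[OF wm(1) wB] and bw' = bounded_symbol_of_real[OF wm(2) w'B] and bu = bounded_symbol_of_real[OF um uB]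
  have ww': "w x * w' x = 1" for x using kc uc[of x] by (simp add: w_def w'_def)

  define J where "J f = multiply_l2 w (fourier_multiplier n f)" for f
  have mw: "multiply_l2 w' (multiply_l2 w f) = f" "multiply_l2 w (multiply_l2 w' f) = f" for f
    using ww' by (simp_all add: multiply_l2_eq mult_op_compose bw bw' mult.commute flip: of_real_mult)
  have linJ: "clinear J"
    using Vector_Spaces.linear_compose[OF clinear_fourier_multiplier[OF n] clinear_mult_op[OF bw]]
    by (simp add: J_def[abs_def] multiply_l2_eq o_def)
  have nH1: "fourier_multiplier n f \<in> sobolev_H1" for f
    unfolding n_def[abs_def] by (rule fourier_multiplier_in_H1[OF z kc(2)])
  have JH1: "J f \<in> sobolev_H1" for f
    unfolding J_def by (rule sobolev_H1_multiply[OF nH1 wB wL wm(1)])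
  have Qm: "?Q \<in> borel_measurable borel" by measurable
  have nm: "n \<in> borel_measurable borel" using n by (simp add: bounded_symbol_def)
  have Qnf: "mult_op ?Q (fourier_l2 (fourier_multiplier n f)) = fourier_l2 f" for f
  proof -
    have "mult_op ?Q (mult_op n (fourier_l2 f)) = mult_op (\<lambda>\<eta>. ?Q \<eta> * n \<eta>) (fourier_l2 f)"
      by (rule mult_op_mult[OF Qm square_integrable_bounded_symbol[OF n square_integrable_rep]])
    then show ?thesis by (simp add: fourier_multiplier_eq Qn)
  qed
  have injJ: "inj J"
  proof (rule injI)
    fix f g assume "J f = J g"
    then have "multiply_l2 w' (J f) = multiply_l2 w' (J g)" by simp
    then have "fourier_multiplier n f = fourier_multiplier n g" by (simp add: J_def mw)
    then have "fourier_l2 f = fourier_l2 g" using Qnf by metis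
    then show "f = g" by (metis inverse_fourier_fourier)
  qed
  have ranJ: "range J = sobolev_H1"
  proof
    show "range J \<subseteq> sobolev_H1" using JH1 by blast
    show "sobolev_H1 \<subseteq> range J"
    proof
      fix g assume "g \<in> sobolev_H1"
      then have v: "multiply_l2 w' g \<in> sobolev_H1" by (rule sobolev_H1_multiply[OF _ w'B w'L wm(2)])
      \<comment> \<open>The preimage under \<open>J\<close> is \<open>Q(D)\<close> applied to
        \<open>w' g\<close>, defined because \<open>w' g\<close> lies in $H^1$.\<close>
      let ?v = "fourier_l2 (multiply_l2 w' g)"
      have "square_integrable (\<lambda>\<eta>. z * rep_l2 ?v \<eta> - of_real (c - k) * (?s \<eta> * rep_l2 ?v \<eta>))"
        by (intro square_integrable_diff square_integrable_scale conj_symbol_square_integrable v square_integrable_rep)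
      then have sQ: "square_integrable (\<lambda>\<eta>. ?Q \<eta> * rep_l2 ?v \<eta>)"
        by (simp add: dp_char_symbol_def left_diff_distrib mult.assoc)
      have "mult_op n (mult_op ?Q ?v) = mult_op (\<lambda>\<eta>. n \<eta> * ?Q \<eta>) ?v"
        by (rule mult_op_mult[OF nm sQ])
      then have "fourier_multiplier n (inverse_fourier_l2 (mult_op ?Q ?v)) = multiply_l2 w' g"
        using Qn by (simp add: fourier_multiplier_eq mult.commute[of "n _"])
      then have "J (inverse_fourier_l2 (mult_op ?Q ?v)) = g" by (simp add: J_def mw)
      then show "g \<in> range J" by (metis rangeI)
    qed
  qed

  define \<phi>1 where "\<phi>1 x = w x - 1" for x
  define \<phi>2 where "\<phi>2 x = u x * w x - k" for x
  have pm[measurable]: "\<phi>1 \<in> borel_measurable borel" "\<phi>2 \<in> borel_measurable borel"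
    unfolding \<phi>1_def[abs_def] \<phi>2_def[abs_def] by measurable
  have wlim: "(w \<longlongrightarrow> 1) at_infinity"
  proof -
    have "((\<lambda>x. (c - k) / (c - u x)) \<longlongrightarrow> (c - k) / (c - k)) at_infinity"
      using kc by (intro tendsto_intros ulim) auto
    then show ?thesis using kc by (simp add: w_def[abs_def])
  qed
  have p1: "symbol_vanishing (\<lambda>x. complex_of_real (\<phi>1 x))"
  proof (rule symbol_vanishing_of_real[OF pm(1)])
    show "\<bar>\<phi>1 x\<bar> \<le> (c - k) / (c - b) + 1" for x unfolding \<phi>1_def using wB[of x] by linarith
    show "(\<phi>1 \<longlongrightarrow> 0) at_infinity" unfolding \<phi>1_def[abs_def] using tendsto_diff[OF wlim tendsto_const[of 1]] by simp
  qed
  have p2: "symbol_vanishing (\<lambda>x. complex_of_real (\<phi>2 x))"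
  proof (rule symbol_vanishing_of_real[OF pm(2)])
    fix x
    have "\<bar>u x * w x\<bar> \<le> c * ((c - k) / (c - b))"
      unfolding abs_mult using kc by (intro mult_mono uB wB) auto
    then show "\<bar>\<phi>2 x\<bar> \<le> c * ((c - k) / (c - b)) + k" unfolding \<phi>2_def using kc by linarith
  next
    show "(\<phi>2 \<longlongrightarrow> 0) at_infinity"
      unfolding \<phi>2_def[abs_def] using tendsto_diff[OF tendsto_mult[OF ulim wlim] tendsto_const[of k]] by simp
  qed
  let ?K1 = "\<lambda>f. mult_op (\<lambda>x. of_real (\<phi>1 x)) (fourier_multiplier n f)"
  let ?K2 = "\<lambda>f. mult_op (\<lambda>x. of_real (\<phi>2 x)) (fourier_multiplier n f)"
  \<comment> \<open>Only two variable coefficients survive: \<open>\<phi>1\<close> from the term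
    \<open>z J f\<close> and \<open>\<phi>2\<close> from the one with \<open>r\<close>. Each acts
    after \<open>n(D)\<close>, whose symbol decays as well.\<close>
  define K where "K f = scaleC_l2 z (?K1 f) + scaleC_l2 3 (fourier_multiplier ?r (?K2 f))" for f
  note bp1 = symbol_vanishing_bounded[OF p1] and bp2 = symbol_vanishing_bounded[OF p2]
  have linK: "clinear K"
    unfolding K_def[abs_def]
    by (rule clinearI)
      (simp_all add: clinear_add[OF clinear_fourier_multiplier[OF n]] clinear_scale[OF clinear_fourier_multiplier[OF n]]
        clinear_add[OF clinear_fourier_multiplier[OF r]] clinear_scale[OF clinear_fourier_multiplier[OF r]]
        clinear_add[OF clinear_mult_op[OF bp1]] clinear_scale[OF clinear_mult_op[OF bp1]]
        clinear_add[OF clinear_mult_op[OF bp2]] clinear_scale[OF clinear_mult_op[OF bp2]]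
        l2.scale_right_distrib mult.commute)
  obtain Cr where Cr: "\<And>f. norm (fourier_multiplier ?r f) \<le> Cr * norm f" by (rule bounded_symbol_norm_bound[OF r]) blast
  have apK: "approximable K"
    unfolding K_def[abs_def]
    by (intro approximable_add approximable_scale approximable_mult_multiplier p1 nv
      approximable_compose_left[OF approximable_mult_multiplier[OF p2 nv] clinear_fourier_multiplier[OF r] Cr])
  obtain C where CK: "\<And>f. norm (K f) \<le> C * norm f"
  proof -
    obtain F where F: "finite_rank F" "\<And>f. norm (K f - F f) \<le> 1 * norm f"
      using apK unfolding approximable_def by (metis zero_less_one)
    obtain D where D: "\<And>f. norm (F f) \<le> D * norm f" using F(1) unfolding finite_rank_def by blast
    have "norm (K f) \<le> (1 + D) * norm f" for f
      using norm_triangle_le[OF add_mono[OF F(2)[of f] D[of f]]] by (simp add: distrib_right)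
    then show thesis using that by blast
  qed

  have main: "scaleC_l2 z (J f) - dp_conj_operator c \<alpha> u (J f)
      = fourier_multiplier (\<lambda>\<eta>. 1 + 3 * of_real k * (?r \<eta> * n \<eta>)) f + K f" for f
  proof -
    let ?v = "fourier_multiplier n f"
    have uH1: "multiply_l2 u (J f) \<in> sobolev_H1"
      by (rule sobolev_H1_multiply[OF JH1 uB L um])
    have bk: "bounded_symbol (\<lambda>x. complex_of_real (u x) * of_real (w x))" by (rule bounded_symbol_mult[OF bu bw])
    have uJ: "multiply_l2 u (J f) = mult_op (\<lambda>x. of_real (u x) * of_real (w x)) ?v"
      by (simp add: J_def multiply_l2_eq mult_op_compose bu bw)
    have uJ2: "multiply_l2 u (J f) = scaleC_l2 (of_real k) ?v + ?K2 f"
    proof -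
      have "(\<lambda>x. complex_of_real (u x) * of_real (w x)) = (\<lambda>x. of_real k * 1 + of_real (\<phi>2 x))"
        by (simp add: \<phi>2_def)
      then show ?thesis
        unfolding uJ using mult_op_symbol_add[OF bounded_symbol_cmult[OF bounded_symbol_const[of 1]] bp2, of "of_real k" ?v]
          mult_op_symbol_cmult[OF bounded_symbol_const[of 1], of "of_real k" ?v] by simp
    qed
    have J2: "J f = ?v + ?K1 f"
    proof -
      have "(\<lambda>x. complex_of_real (w x)) = (\<lambda>x. 1 + of_real (\<phi>1 x))" by (simp add: \<phi>1_def)
      then show ?thesis
        unfolding J_def multiply_l2_eq using mult_op_symbol_add[OF bounded_symbol_const[of 1] bp1, of ?v] by simp
    qed
    \<comment> \<open>The point of the choice of \<open>w\<close>: \<open>(c - u) w\<close> is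
      exactly the constant \<open>c - k\<close>, so the first-order term has no variable coefficient
      left.\<close>
    have diff: "scaleC_l2 (of_real c) (J f) - multiply_l2 u (J f) = scaleC_l2 (of_real (c - k)) ?v"
    proof -
      have "scaleC_l2 (of_real c) (J f) = mult_op (\<lambda>x. of_real c * of_real (w x)) ?v"
        by (simp add: J_def multiply_l2_eq mult_op_symbol_cmult bw)
      then have "scaleC_l2 (of_real c) (J f) - multiply_l2 u (J f) = mult_op (\<lambda>x. of_real c * of_real (w x) - of_real (u x) * of_real (w x)) ?v"
        unfolding uJ by (simp add: mult_op_symbol_diff bounded_symbol_cmult bw bk)
      also have "(\<lambda>x. complex_of_real c * of_real (w x) - of_real (u x) * of_real (w x)) = (\<lambda>x. of_real (c - k) * 1)"
      proof
        fix x
        have "(c - u x) * w x = c - k" using uc[of x] by (simp add: w_def)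
        then have "c * w x - u x * w x = c - k" by (simp only: left_diff_distrib)
        then show "complex_of_real c * of_real (w x) - of_real (u x) * of_real (w x) = of_real (c - k) * 1"
          by (simp flip: of_real_mult of_real_diff)
      qed
      also have "mult_op (\<lambda>x. of_real (c - k) * 1) ?v = scaleC_l2 (of_real (c - k)) (mult_op (\<lambda>_. 1) ?v)"
        by (rule mult_op_symbol_cmult[OF bounded_symbol_const])
      finally show ?thesis by simp
    qed
    \<comment> \<open>On the Fourier side \<open>(c - k) s n = z n - 1\<close>. Subtracted from
      \<open>z J f\<close>, this cancels the part \<open>z n(D) f\<close> and leaves the identity as
      leading term.\<close>
    have sv: "fourier_multiplier ?s (scaleC_l2 (of_real (c - k)) ?v) = scaleC_l2 z ?v - f"
    proof -
      have ms: "?s \<in> borel_measurable borel" by measurable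
      have bsn: "bounded_symbol (\<lambda>\<eta>. ?s \<eta> * n \<eta>)"
        unfolding n_def by (rule bounded_symbol_conj_symbol_quotient[OF z kc(2)])
      have bnc: "bounded_symbol (\<lambda>\<eta>. of_real (c - k) * n \<eta>)" by (rule bounded_symbol_cmult[OF n])
      have "fourier_multiplier ?s (scaleC_l2 (of_real (c - k)) ?v) = fourier_multiplier ?s (fourier_multiplier (\<lambda>\<eta>. of_real (c - k) * n \<eta>) f)"
        by (simp only: fourier_multiplier_symbol_cmult[OF n])
      also have "\<dots> = fourier_multiplier (\<lambda>\<eta>. ?s \<eta> * (of_real (c - k) * n \<eta>)) f"
        unfolding fourier_multiplier_eq fourier_inverse_fourier
        by (subst mult_op_mult[OF ms square_integrable_bounded_symbol[OF bnc square_integrable_rep]]) (rule refl)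
      also have "(\<lambda>\<eta>. ?s \<eta> * (of_real (c - k) * n \<eta>)) = (\<lambda>\<eta>. z * n \<eta> - 1)"
      proof
        fix \<eta>
        have "?s \<eta> * (of_real (c - k) * n \<eta>) = (z - ?Q \<eta>) * n \<eta>" by (simp add: dp_char_symbol_def)
        then show "?s \<eta> * (of_real (c - k) * n \<eta>) = z * n \<eta> - 1" using Qn[of \<eta>] by (simp add: left_diff_distrib)
      qed
      also have "fourier_multiplier (\<lambda>\<eta>. z * n \<eta> - 1) f = scaleC_l2 z ?v - f"
        using fourier_multiplier_symbol_diff[OF bounded_symbol_cmult[OF n] bounded_symbol_const[of 1], of z f]
        by (simp add: fourier_multiplier_symbol_cmult n)
      finally show ?thesis .
    qed
    have rv: "fourier_multiplier ?r (multiply_l2 u (J f)) = scaleC_l2 (of_real k) (fourier_multiplier (\<lambda>\<eta>. ?r \<eta> * n \<eta>) f) + fourier_multiplier ?r (?K2 f)"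
      unfolding uJ2 by (simp add: clinear_add[OF clinear_fourier_multiplier[OF r]] clinear_scale[OF clinear_fourier_multiplier[OF r]] fourier_multiplier_compose r n)
    have sy: "fourier_multiplier (\<lambda>\<eta>. 1 + 3 * of_real k * (?r \<eta> * n \<eta>)) f = f + scaleC_l2 (3 * of_real k) (fourier_multiplier (\<lambda>\<eta>. ?r \<eta> * n \<eta>) f)"
      using fourier_multiplier_symbol_add[OF bounded_symbol_const[of 1] bounded_symbol_cmult[OF bounded_symbol_mult[OF r n]], of "3 * of_real k" f]
      by (simp add: fourier_multiplier_symbol_cmult[OF bounded_symbol_mult[OF r n]])
    show ?thesis
      unfolding dp_conj_operator_on_H1[OF \<alpha> JH1 uH1] diff sv rv sy K_def
      by (simp add: J2 l2.scale_right_distrib algebra_simps)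
  qed
  show thesis
    by (rule that[OF linJ injJ ranJ linK CK apK]) (use main in \<open>simp add: n_def\<close>)
qed

theorem proposition3p4:
  fixes c k \<alpha> :: real and u\<^sub>0 :: "real \<Rightarrow> real"
  assumes "c > 0" and "0 < k" and "k < c / 4"
    and "dp_solitary_profile c k u\<^sub>0"
    and "0 < \<alpha>" and "\<alpha> < 1"
    and "0 < \<alpha>\<^sup>2" and "\<alpha>\<^sup>2 < (c - 4 * k) / (c - k)"
  shows "essential_spectrum sobolev_H1 (dp_conj_operator c \<alpha> u\<^sub>0) \<subseteq> {z. Re z < 0} \<and>
    setdist {z. Re z = 0} (essential_spectrum sobolev_H1 (dp_conj_operator c \<alpha> u\<^sub>0))
      = \<alpha> * (c - k - 3 * k / (1 - \<alpha>\<^sup>2)) \<and>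
    \<alpha> * (c - k - 3 * k / (1 - \<alpha>\<^sup>2)) > 0"
proof -
  note k = \<open>0 < k\<close> and \<alpha> = \<open>0 < \<alpha>\<close> \<open>\<alpha> < 1\<close> and prof = \<open>dp_solitary_profile c k u\<^sub>0\<close>
  have kc: "k < c" using \<open>k < c / 4\<close> \<open>c > 0\<close> by simp
  define \<Delta> where "\<Delta> = \<alpha> * (c - k - 3 * k / (1 - \<alpha>\<^sup>2))"
  let ?S = "essential_spectrum sobolev_H1 (dp_conj_operator c \<alpha> u\<^sub>0)"
  have a: "0 < 1 - \<alpha>\<^sup>2" using \<alpha> by (simp add: power_less_one_iff)
  have \<Delta>0: "0 < \<Delta>"
  proof -
    \<comment> \<open>The hypothesis on \<open>\<alpha>\<close> is positivity of the gap in
      disguise, as \<open>c - 4 k = (c - k) - 3 k\<close>.\<close>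
    have "\<alpha>\<^sup>2 * (c - k) < c - 4 * k" using assms(8) kc by (simp add: pos_less_divide_eq)
    then have "3 * k < (c - k) * (1 - \<alpha>\<^sup>2)" by (simp add: algebra_simps)
    then have "3 * k / (1 - \<alpha>\<^sup>2) < c - k" using a by (simp add: pos_divide_less_eq)
    then show ?thesis unfolding \<Delta>_def using \<alpha> by simp
  qed
  have \<Delta>_eq: "\<Delta> = (c - k) * \<alpha> - 3 * k * (\<alpha> / (1 - \<alpha>\<^sup>2))"
    by (simp add: \<Delta>_def algebra_simps)
  have ka: "0 < 3 * k * (\<alpha> / (1 - \<alpha>\<^sup>2))" using k \<alpha> a by simp
  let ?r = "resolvent_symbol \<alpha>" and ?Q = "dp_char_symbol c k \<alpha>"
  let ?m = "\<lambda>z \<eta>. 1 + 3 * of_real k * (?r \<eta> * inverse (?Q z \<eta>))"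
  note r = bounded_symbol_resolvent[OF \<alpha>]

  have regular: "z \<notin> ?S" if z: "- \<Delta> < Re z" for z
  proof -
    have z': "0 < Re z + (c - k) * \<alpha>" using z ka unfolding \<Delta>_eq by linarith
    obtain J K C where JK: "clinear J" "inj J" "range J = sobolev_H1"
      "clinear K" "\<And>f. norm (K f) \<le> C * norm f" "approximable K"
      "\<And>f. scaleC_l2 z (J f) - dp_conj_operator c \<alpha> u\<^sub>0 (J f) = fourier_multiplier (?m z) f + K f"
      by (rule dp_resolvent_factorization[OF k kc prof \<alpha> z']) blast
    \<comment> \<open>The numerator of the symbol: it equals \<open>p / Q\<close>, so its reciprocal
      is \<open>Q / p = 1 - 3 k r / p\<close>. The latter form shows boundedness although
      \<open>Q\<close> itself is unbounded.\<close>
    define p where "p \<eta> = ?Q z \<eta> + 3 * of_real k * ?r \<eta>" for \<eta>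
    have Rep: "Re z + \<Delta> \<le> Re (p \<eta>)" for \<eta>
    proof -
      have "3 * k * (- \<alpha> / (1 - \<alpha>\<^sup>2)) \<le> 3 * k * Re (?r \<eta>)"
        using Re_resolvent_symbol_ge[OF \<alpha>, of \<eta>] k by (intro mult_left_mono) auto
      then show ?thesis by (simp add: p_def Re_dp_char_symbol \<Delta>_eq)
    qed
    then have np: "Re z + \<Delta> \<le> norm (p \<eta>)" for \<eta> using complex_Re_le_cmod order_trans by blast
    have p0: "p \<eta> \<noteq> 0" for \<eta> using np[of \<eta>] z by auto
    have Q0: "?Q z \<eta> \<noteq> 0" for \<eta> by (rule dp_char_symbol_nonzero[OF z'])
    have [measurable]: "p \<in> borel_measurable borel" unfolding p_def[abs_def] by measurable
    have bp: "bounded_symbol (\<lambda>\<eta>. inverse (p \<eta>))"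
    proof -
      have "norm (inverse (p \<eta>)) \<le> inverse (Re z + \<Delta>)" for \<eta>
        unfolding norm_inverse using np[of \<eta>] z by (intro le_imp_inverse_le) auto
      then show ?thesis unfolding bounded_symbol_def by auto
    qed
    let ?m' = "\<lambda>\<eta>. 1 + (- 3 * of_real k) * (?r \<eta> * inverse (p \<eta>))"
    have bm: "bounded_symbol (?m z)" "bounded_symbol ?m'"
      by (intro bounded_symbol_add bounded_symbol_const bounded_symbol_cmult bounded_symbol_mult r bp
        symbol_vanishing_bounded symbol_vanishing_inverse_dp_char_symbol z' kc)+
    have mm: "?m z \<eta> * ?m' \<eta> = 1" for \<eta>
    proof -
      have "?m z \<eta> = p \<eta> * inverse (?Q z \<eta>)" using Q0[of \<eta>] by (simp add: p_def distrib_right)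
      moreover have "?m' \<eta> = ?Q z \<eta> * inverse (p \<eta>)"
      proof -
        have "?Q z \<eta> = p \<eta> + (- 3 * of_real k) * ?r \<eta>" by (simp add: p_def)
        then show ?thesis using p0[of \<eta>] by (simp only: distrib_right) simp
      qed
      moreover have "p \<eta> * inverse (?Q z \<eta>) * (?Q z \<eta> * inverse (p \<eta>)) = 1"
      proof -
        have "p \<eta> * inverse (?Q z \<eta>) * (?Q z \<eta> * inverse (p \<eta>)) = (p \<eta> * inverse (p \<eta>)) * (?Q z \<eta> * inverse (?Q z \<eta>))"
          by (simp only: mult_ac)
        then show ?thesis by (simp only: right_inverse[OF p0] right_inverse[OF Q0] mult_1)
      qed
      ultimately show ?thesis by (simp only:)
    qed
    obtain D where D: "\<And>f. norm (fourier_multiplier ?m' f) \<le> D * norm f" by (rule bounded_symbol_norm_bound[OF bm(2)]) blast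
    have inv: "fourier_multiplier (?m z) (fourier_multiplier ?m' f) = f" "fourier_multiplier ?m' (fourier_multiplier (?m z) f) = f" for f
      using mm by (simp_all only: fourier_multiplier_compose[OF bm] fourier_multiplier_compose[OF bm(2,1)] mult.commute[of "1 + (- 3 * of_real k) * _"] fourier_multiplier_one)
    note fr = fredholm_invertible_plus_approximable[OF JK(1-3) clinear_fourier_multiplier[OF bm(1)] clinear_fourier_multiplier[OF bm(2)] inv D JK(4,6),
        of "\<lambda>f. scaleC_l2 z f - dp_conj_operator c \<alpha> u\<^sub>0 f"]
    show "z \<notin> ?S"
      unfolding essential_spectrum_def using fr JK(7) by simp
  qed

  have singular: "of_real (- \<Delta>) \<in> ?S"
  proof -
    let ?z = "complex_of_real (- \<Delta>)"
    \<comment> \<open>At \<open>z = - \<Delta>\<close> the real part of \<open>Q\<close> is still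
      \<open>3 k \<alpha> / (1 - \<alpha>\<^sup>2) > 0\<close>, so the factorization remains
      available.\<close>
    have z': "0 < Re ?z + (c - k) * \<alpha>" using ka unfolding \<Delta>_eq by simp
    obtain J K C where JK: "clinear J" "inj J" "range J = sobolev_H1"
      "clinear K" "\<And>f. norm (K f) \<le> C * norm f" "approximable K"
      "\<And>f. scaleC_l2 ?z (J f) - dp_conj_operator c \<alpha> u\<^sub>0 (J f) = fourier_multiplier (?m ?z) f + K f"
      by (rule dp_resolvent_factorization[OF k kc prof \<alpha> z']) blast
    have bm: "bounded_symbol (?m ?z)"
      by (intro bounded_symbol_add bounded_symbol_const bounded_symbol_cmult bounded_symbol_mult r
        symbol_vanishing_bounded symbol_vanishing_inverse_dp_char_symbol z' kc)
    obtain D where D: "\<And>f. norm (fourier_multiplier (?m ?z) f) \<le> D * norm f" by (rule bounded_symbol_norm_bound[OF bm]) blast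
    have m0: "?m ?z 0 = 0"
    proof -
      have Q: "?Q ?z 0 = of_real (3 * k * (\<alpha> / (1 - \<alpha>\<^sup>2)))"
        by (simp add: dp_char_symbol_def conj_symbol_def \<Delta>_eq algebra_simps)
      have R: "?r 0 = of_real (- (\<alpha> / (1 - \<alpha>\<^sup>2)))"
        by (simp add: resolvent_symbol_def conj_symbol_def divide_inverse)
      have "?m ?z 0 = of_real (1 + 3 * k * (- (\<alpha> / (1 - \<alpha>\<^sup>2)) * inverse (3 * k * (\<alpha> / (1 - \<alpha>\<^sup>2)))))"
        unfolding Q R by (simp only: of_real_add of_real_mult of_real_inverse of_real_1 of_real_numeral)
      also have "1 + 3 * k * (- (\<alpha> / (1 - \<alpha>\<^sup>2)) * inverse (3 * k * (\<alpha> / (1 - \<alpha>\<^sup>2)))) = 0"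
        using k \<alpha> a by (simp add: field_simps)
      finally show ?thesis by (simp only: of_real_0)
    qed
    have "isCont (?m ?z) 0"
      unfolding resolvent_symbol_def dp_char_symbol_def conj_symbol_def
      using one_minus_conj_symbol_sq_nonzero[of \<alpha> 0] dp_char_symbol_nonzero[OF z', of 0] a
      by (intro continuous_intros) (auto simp: conj_symbol_def dp_char_symbol_def)
    then have cont: "(?m ?z \<longlongrightarrow> 0) (at 0)" using m0 by (simp add: isCont_def)
    have "\<exists>W. l2.subspace W \<and> infinite_dim W \<and> (\<forall>f\<in>W. norm (fourier_multiplier (?m ?z) f) \<le> e * norm f)" if e: "0 < e" for e
    proof -
      obtain d where d: "0 < d" "\<And>\<eta>. \<eta> \<noteq> 0 \<Longrightarrow> \<bar>\<eta>\<bar> < d \<Longrightarrow> norm (?m ?z \<eta>) < e"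
        using LIM_D[OF cont e] by (auto simp only: diff_zero real_norm_def)
      \<comment> \<open>Continuity gives a strict bound on a punctured open interval; halving
        \<open>d\<close> fits the closed band of frequencies, and \<open>\<eta> = 0\<close> is
        covered by the zero of the symbol.\<close>
      have small: "norm (?m ?z \<eta>) \<le> e" if "\<bar>\<eta>\<bar> \<le> d / 2" for \<eta>
      proof (cases "\<eta> = 0")
        case True
        then show ?thesis using m0 e by (simp only: norm_zero less_imp_le)
      next
        case False
        then show ?thesis using d(2)[of \<eta>] that d(1) by (intro less_imp_le) simp
      qed
      have d2: "0 < d / 2" using d(1) by simp
      show ?thesis
        using infinite_dim_low_frequencies[OF d2] fourier_multiplier_small_on_low_frequencies[OF bm small less_imp_le[OF e]]
        by blast
    qed
    then have "\<not> fredholm sobolev_H1 (\<lambda>f. scaleC_l2 ?z f - dp_conj_operator c \<alpha> u\<^sub>0 f)"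
      by (intro not_fredholm_if_small_on_infinite_dim[OF JK(1-3) clinear_fourier_multiplier[OF bm] D JK(4-6)]) (rule JK(7))
    then show ?thesis unfolding essential_spectrum_def by simp
  qed

  have left: "Re z \<le> - \<Delta>" if "z \<in> ?S" for z using regular[of z] that by linarith
  have "?S \<subseteq> {z. Re z < 0}" using left \<Delta>0 by fastforce
  moreover have "setdist {z. Re z = 0} ?S = \<Delta>"
  proof (rule antisym)
    \<comment> \<open>The pair \<open>0\<close> and \<open>- \<Delta>\<close> realizes the
      distance.\<close>
    have "setdist {z. Re z = 0} ?S \<le> dist 0 (complex_of_real (- \<Delta>))"
      by (rule setdist_le_dist) (use singular in auto)
    then show "setdist {z. Re z = 0} ?S \<le> \<Delta>" using \<Delta>0 by simp
    have "\<Delta> \<le> dist x y" if "x \<in> {z. Re z = 0}" "y \<in> ?S" for x y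
    proof -
      have "\<Delta> \<le> Re (x - y)" using left[OF that(2)] that(1) by simp
      also have "\<dots> \<le> norm (x - y)" by (rule complex_Re_le_cmod)
      finally show ?thesis by (simp add: dist_norm)
    qed
    \<comment> \<open>\<open>setdist\<close> is 0 by convention when a set is empty, so both sets
      must be shown inhabited; \<open>singular\<close> does it for \<open>?S\<close>.\<close>
    moreover have "{z. Re z = 0} \<noteq> {}" by (auto intro: exI[of _ 0])
    ultimately show "\<Delta> \<le> setdist {z. Re z = 0} ?S"
      using singular by (intro le_setdistI) auto
  qed
  ultimately show ?thesis using \<Delta>0 by (simp add: \<Delta>_def)
qed

end
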